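(* Let $K$ be a field of characteristic zero and let $\mathfrak q$ be a finite-dimensional Lie algebra over $K$ with $\mathrm{ind}\,\mathfrak q=1$. Then $\mathfrak q$ is contact if and only if $\alpha\notin\mathrm{ad}^*(\mathfrak q)\cdot\alpha$ for a generic point $\alpha\in\mathfrak q^*$. If moreover $K$ is algebraically closed and $\mathfrak q=\mathrm{Lie}\,Q$ for a connected affine algebraic group $Q$, then this condition is equivalent to the condition that a generic $Q$-orbit in $\mathfrak q^*$ is not conical.
   Context: For $\alpha\in\mathfrak q^*$, let $d_{\mathfrak q}\alpha\in\wedge^2\mathfrak q^*$ be the Chevalley--Eilenberg differential of $\alpha$, i.e. (up to an irrelevant sign convention) $d_{\mathfrak q}\alpha(\xi,\eta)=-\alpha([\xi,\eta])$. A finite-dimensional Lie algebra $\mathfrak q$ is called contact if $\dim\mathfrak q=2n+1$ is odd and there is $\alpha\in\mathfrak q^*$ with $(d_{\mathfrak q}\alpha)^{\wedge n}\wedge\alpha\neq 0$. For $\gamma\in\mathfrak q^*$, set $\mathfrak q_\gamma=\{\xi\in\mathfrak q\mid\gamma([\xi,\mathfrak q])=0\}$; the index is $\mathrm{ind}\,\mathfrak q=\min_{\gamma\in\mathfrak q^*}\dim\mathfrak q_\gamma$. Here $\mathrm{ad}^*:\mathfrak q\to\mathfrak{gl}(\mathfrak q^* )$ is the coadjoint representation, $(\mathrm{ad}^*(\xi)\alpha)(\eta)=-\alpha([\xi,\eta])$. A statement holds for a generic point of $\mathfrak q^*$ (for a generic orbit) if it holds for all points of some non-empty Zariski open subset $U\subset\mathfrak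 q^*$ (for all orbits meeting $U$). Over an algebraically closed field, an orbit $Q\alpha\subset\mathfrak q^*$ of the coadjoint action is conical if $K^{\times}\alpha\subset Q\alpha$. *)

theory Defs
  imports
    Complex_Main
    "HOL-Library.FuncSet"
    "HOL-Combinatorics.Permutations"
    "HOL-Computational_Algebra.Polynomial"
begin

section \<open>Algebras of functions and Zariski topologies\<close>

text \<open>The unital algebra of functions generated by a set of functions. Over an infinite field,
  taking for the generators the coordinate functions of an affine space gives its coordinate ring.\<close>

inductive_set gen_algebra :: "('a \<Rightarrow> 'k::comm_ring_1) set \<Rightarrow> ('a \<Rightarrow> 'k) set"
  for S :: "('a \<Rightarrow> 'k) set"
  where
    const: "(\<lambda>_. c) \<in> gen_algebra S"
  | gen: "f \<in> S \<Longrightarrow> f \<in> gen_algebra S"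
  | add: "f \<in> gen_algebra S \<Longrightarrow> g \<in> gen_algebra S \<Longrightarrow> (\<lambda>x. f x + g x) \<in> gen_algebra S"
  | mult: "f \<in> gen_algebra S \<Longrightarrow> g \<in> gen_algebra S \<Longrightarrow> (\<lambda>x. f x * g x) \<in> gen_algebra S"

definition zariski_closed :: "('a \<Rightarrow> 'k::comm_ring_1) set \<Rightarrow> 'a set \<Rightarrow> 'a set \<Rightarrow> bool" where
  "zariski_closed A X Z \<longleftrightarrow> (\<exists>S\<subseteq>A. Z = {x \<in> X. \<forall>f\<in>S. f x = 0})"

definition zariski_open :: "('a \<Rightarrow> 'k::comm_ring_1) set \<Rightarrow> 'a set \<Rightarrow> 'a set \<Rightarrow> bool" where
  "zariski_open A X U \<longleftrightarrow> U \<subseteq> X \<and> zariski_closed A X (X - U)"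


section \<open>Alternating forms\<close>

text \<open>Elements of the \<open>p\<close>-th exterior power of the dual space are alternating \<open>p\<close>-linear forms.
  A \<open>p\<close>-form is encoded as a function of a sequence \<open>v\<close> of vectors that depends only on
  \<open>v 0, \<dots>, v (p - 1)\<close>. The division by factorials restricts the wedge product to
  characteristic zero.\<close>

definition wedge :: "nat \<Rightarrow> nat \<Rightarrow> ((nat \<Rightarrow> 'v) \<Rightarrow> 'k) \<Rightarrow> ((nat \<Rightarrow> 'v) \<Rightarrow> 'k)
    \<Rightarrow> (nat \<Rightarrow> 'v) \<Rightarrow> 'k::field_char_0" where
  "wedge p q \<omega> \<eta> v =
     (\<Sum>\<sigma> | \<sigma> permutes {..<p + q}. of_int (sign \<sigma>) * \<omega> (\<lambda>i. v (\<sigma> i)) * \<eta> (\<lambda>i. v (\<sigma> (p + i))))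
       / (fact p * fact q)"

primrec wedge_power :: "nat \<Rightarrow> ((nat \<Rightarrow> 'v) \<Rightarrow> 'k) \<Rightarrow> nat \<Rightarrow> (nat \<Rightarrow> 'v) \<Rightarrow> 'k::field_char_0" where
  "wedge_power p \<omega> 0 = (\<lambda>_. 1)"
| "wedge_power p \<omega> (Suc n) = wedge p (n * p) \<omega> (wedge_power p \<omega> n)"


section \<open>Lie algebras\<close>

locale lie_algebra = vector_space scale
  for scale :: "'k::field_char_0 \<Rightarrow> 'q::ab_group_add \<Rightarrow> 'q" +
  fixes bracket :: "'q \<Rightarrow> 'q \<Rightarrow> 'q"
  assumes bracket_linear_right: "Vector_Spaces.linear scale scale (\<lambda>y. bracket x y)"
    and bracket_linear_left: "Vector_Spaces.linear scale scale (\<lambda>x. bracket x y)"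
    and bracket_self: "bracket x x = 0"
    and jacobi: "bracket x (bracket y z) + bracket y (bracket z x) + bracket z (bracket x y) = 0"
begin

definition dual :: "('q \<Rightarrow> 'k) set" where
  "dual = {\<alpha>. Vector_Spaces.linear scale (*) \<alpha>}"

definition ce_differential :: "('q \<Rightarrow> 'k) \<Rightarrow> (nat \<Rightarrow> 'q) \<Rightarrow> 'k" where
  "ce_differential \<alpha> v = - \<alpha> (bracket (v 0) (v 1))"

definition contact :: bool where
  "contact \<longleftrightarrow> (\<exists>n. dim (UNIV :: 'q set) = 2 * n + 1 \<and>
     (\<exists>\<alpha>\<in>dual. wedge (2 * n) 1 (wedge_power 2 (ce_differential \<alpha>) n) (\<lambda>v. \<alpha> (v 0)) \<noteq> (\<lambda>_. 0)))"

definition stabilizer :: "('q \<Rightarrow> 'k) \<Rightarrow> 'q set" where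
  "stabilizer \<gamma> = {\<xi>. \<forall>\<eta>. \<gamma> (bracket \<xi> \<eta>) = 0}"

definition index :: nat where
  "index = (INF \<gamma>\<in>dual. dim (stabilizer \<gamma>))"

definition ad_star :: "'q \<Rightarrow> ('q \<Rightarrow> 'k) \<Rightarrow> 'q \<Rightarrow> 'k" where
  "ad_star \<xi> \<alpha> = (\<lambda>\<eta>. - \<alpha> (bracket \<xi> \<eta>))"

definition open_in_dual :: "('q \<Rightarrow> 'k) set \<Rightarrow> bool" where
  "open_in_dual U \<longleftrightarrow> zariski_open (gen_algebra (range (\<lambda>\<xi> \<alpha>. \<alpha> \<xi>))) dual U"

definition generic_point :: "(('q \<Rightarrow> 'k) \<Rightarrow> bool) \<Rightarrow> bool" where
  "generic_point P \<longleftrightarrow> (\<exists>U. open_in_dual U \<and> U \<noteq> {} \<and> (\<forall>\<alpha>\<in>U. P \<alpha>))"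

end

locale fin_dim_lie_algebra = lie_algebra +
  assumes finite_dimensional: "\<exists>B. finite B \<and> span B = UNIV"


section \<open>Affine algebraic groups\<close>

text \<open>Affine varieties over an algebraically closed field, given by their points and their
  algebra \<open>A\<close> of regular functions: \<open>A\<close> is finitely generated, and the points are in bijection
  with the algebra homomorphisms from \<open>A\<close> to the ground field.\<close>

definition algebra_character :: "('a \<Rightarrow> 'k::field) set \<Rightarrow> (('a \<Rightarrow> 'k) \<Rightarrow> 'k) \<Rightarrow> bool" where
  "algebra_character A \<chi> \<longleftrightarrow>
     (\<forall>c. \<chi> (\<lambda>_. c) = c) \<and>
     (\<forall>f\<in>A. \<forall>g\<in>A. \<chi> (\<lambda>x. f x + g x) = \<chi> f + \<chi> g \<and> \<chi> (\<lambda>x. f x * g x) = \<chi> f * \<chi> g)"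

definition affine_variety :: "('a \<Rightarrow> 'k::field) set \<Rightarrow> bool" where
  "affine_variety A \<longleftrightarrow>
     (\<exists>S. finite S \<and> A = gen_algebra S) \<and>
     (\<forall>\<chi>. algebra_character A \<chi> \<longrightarrow> (\<exists>!x. \<forall>f\<in>A. \<chi> f = f x))"

definition product_algebra ::
    "('a \<Rightarrow> 'k::comm_ring_1) set \<Rightarrow> ('b \<Rightarrow> 'k) set \<Rightarrow> ('a \<times> 'b \<Rightarrow> 'k) set" where
  "product_algebra A B = gen_algebra ((\<lambda>f (x, y). f x) ` A \<union> (\<lambda>g (x, y). g y) ` B)"

text \<open>In characteristic zero every affine algebraic group is reduced, so that varieties suffice.\<close>

locale affine_algebraic_group = group mult one ginv
  for mult :: "'g \<Rightarrow> 'g \<Rightarrow> 'g" and one :: 'g and ginv :: "'g \<Rightarrow> 'g" +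
  fixes A :: "('g \<Rightarrow> 'k::field_char_0) set"
  assumes variety: "affine_variety A"
    and mult_regular: "f \<in> A \<Longrightarrow> (\<lambda>(x, y). f (mult x y)) \<in> product_algebra A A"
    and ginv_regular: "f \<in> A \<Longrightarrow> (\<lambda>x. f (ginv x)) \<in> A"
begin

definition connected_group :: bool where
  "connected_group \<longleftrightarrow>
     \<not> (\<exists>Y Z. zariski_closed A UNIV Y \<and> zariski_closed A UNIV Z \<and>
           Y \<noteq> {} \<and> Z \<noteq> {} \<and> Y \<inter> Z = {} \<and> Y \<union> Z = UNIV)"

text \<open>The Lie algebra of the group: the derivations of \<open>A\<close> commuting with left translations,
  with the commutator as bracket. As elements of \<open>A \<rightarrow>\<^sub>E A\<close>, they are determined by their
  values on \<open>A\<close>.\<close>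

definition left_invariant_derivations :: "(('g \<Rightarrow> 'k) \<Rightarrow> 'g \<Rightarrow> 'k) set" where
  "left_invariant_derivations = {D \<in> A \<rightarrow>\<^sub>E A.
     (\<forall>f\<in>A. \<forall>h\<in>A. D (\<lambda>x. f x + h x) = (\<lambda>x. D f x + D h x)) \<and>
     (\<forall>c. \<forall>f\<in>A. D (\<lambda>x. c * f x) = (\<lambda>x. c * D f x)) \<and>
     (\<forall>f\<in>A. \<forall>h\<in>A. D (\<lambda>x. f x * h x) = (\<lambda>x. D f x * h x + f x * D h x)) \<and>
     (\<forall>g. \<forall>f\<in>A. D (\<lambda>x. f (mult g x)) = (\<lambda>x. D f (mult g x)))}"

text \<open>With \<open>(\<rho>\<^sub>g f) x = f (x g)\<close>, the adjoint action of \<open>g\<close> on left-invariant derivations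
  is \<open>D \<mapsto> \<rho>\<^sub>g \<circ> D \<circ> \<rho>\<^sub>g\<inverse>\<close>; it is the differential of the conjugation \<open>x \<mapsto> g x g\<inverse>\<close>.\<close>

definition Ad_derivation :: "'g \<Rightarrow> (('g \<Rightarrow> 'k) \<Rightarrow> 'g \<Rightarrow> 'k) \<Rightarrow> ('g \<Rightarrow> 'k) \<Rightarrow> 'g \<Rightarrow> 'k" where
  "Ad_derivation g D = (\<lambda>f\<in>A. \<lambda>x. D (\<lambda>y. f (mult y (ginv g))) (mult x g))"

end

text \<open>An identification \<open>\<phi>\<close> of a Lie algebra with the Lie algebra of an affine algebraic group.\<close>

locale lie_algebra_of_group =
  lie_algebra scale bracket + affine_algebraic_group mult one ginv A
  for scale :: "'k::field_char_0 \<Rightarrow> 'q::ab_group_add \<Rightarrow> 'q"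
    and bracket :: "'q \<Rightarrow> 'q \<Rightarrow> 'q"
    and mult :: "'g \<Rightarrow> 'g \<Rightarrow> 'g" and one :: 'g and ginv :: "'g \<Rightarrow> 'g"
    and A :: "('g \<Rightarrow> 'k) set" +
  fixes \<phi> :: "'q \<Rightarrow> ('g \<Rightarrow> 'k) \<Rightarrow> 'g \<Rightarrow> 'k"
  assumes bij: "bij_betw \<phi> UNIV left_invariant_derivations"
    and add: "f \<in> A \<Longrightarrow> \<phi> (\<xi> + \<eta>) f = (\<lambda>x. \<phi> \<xi> f x + \<phi> \<eta> f x)"
    and scale: "f \<in> A \<Longrightarrow> \<phi> (scale c \<xi>) f = (\<lambda>x. c * \<phi> \<xi> f x)"
    and bracket: "f \<in> A \<Longrightarrow> \<phi> (bracket \<xi> \<eta>) f = (\<lambda>x. \<phi> \<xi> (\<phi> \<eta> f) x - \<phi> \<eta> (\<phi> \<xi> f) x)"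
begin

definition Ad :: "'g \<Rightarrow> 'q \<Rightarrow> 'q" where
  "Ad g \<xi> = inv_into UNIV \<phi> (Ad_derivation g (\<phi> \<xi>))"

definition coadjoint_orbit :: "('q \<Rightarrow> 'k) \<Rightarrow> ('q \<Rightarrow> 'k) set" where
  "coadjoint_orbit \<alpha> = range (\<lambda>g \<xi>. \<alpha> (Ad (ginv g) \<xi>))"

definition conical_orbit :: "('q \<Rightarrow> 'k) \<Rightarrow> bool" where
  "conical_orbit \<alpha> \<longleftrightarrow> (\<forall>c. c \<noteq> 0 \<longrightarrow> (\<lambda>\<xi>. c * \<alpha> \<xi>) \<in> coadjoint_orbit \<alpha>)"

definition generic_orbit_not_conical :: bool where
  "generic_orbit_not_conical \<longleftrightarrow>
     (\<exists>U. open_in_dual U \<and> U \<noteq> {} \<and>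
        (\<forall>\<alpha>\<in>dual. coadjoint_orbit \<alpha> \<inter> U \<noteq> {} \<longrightarrow> \<not> conical_orbit \<alpha>))"

end

end

theory Submission
  imports Defs "HOL-Computational_Algebra.Formal_Power_Series"
begin

text \<open>For \<open>n = (dim q - 1) / 2\<close>, the form \<open>(d\<alpha>)^n \<and> \<alpha>\<close> is nonzero exactly when the radical
  \<open>q\<^sub>\<alpha>\<close> of \<open>d\<alpha>\<close> is a line on which \<open>\<alpha>\<close> does not vanish, and \<open>\<alpha>\<close> lies in \<open>ad\<^sup>*(q) \<alpha>\<close> exactly when
  it vanishes on \<open>q\<^sub>\<alpha>\<close>. Since \<open>q\<^sub>\<alpha>\<close> is a line for generic \<open>\<alpha>\<close>, this gives the first equivalence.

  The second one holds pointwise: the orbit of \<open>\<alpha>\<close> is conical if and only if \<open>\<alpha> \<in> ad\<^sup>*(q) \<alpha>\<close>.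
  Instead of dimension theory, the proof uses that a finitely generated domain containing a
  transcendental element \<open>\<chi>\<close> has, for almost every constant \<open>c\<close>, a homomorphism to the dual numbers
  with \<open>\<chi> \<mapsto> c + \<epsilon>\<close>: its real part is a point, its infinitesimal part a tangent vector. For one
  direction this is applied to the image of the coordinate ring in the power series ring under
  the formal one-parameter subgroup \<open>exp(t\<zeta>)\<close>, for the other one to its image in an ultrapower of
  the field.\<close>

section \<open>Linear functionals\<close>

text \<open>A single group element that scales \<alpha> has only a number as its scaling factor; to
  differentiate the factor, it must vary. So both directions look for a generic point: a
  homomorphism from the coordinate ring to a domain that sends each coefficient
  \<open>\<lambda>h. \<alpha> (Ad h \<eta>)\<close> to \<alpha>(\<eta>) times one fixed
  transcendental \<chi>. Power series and the ultrapower both supply one: exp(t) satisfies no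
  polynomial equation over the field, and neither does the sequence 1, 2, 3, ... modulo a
  nonprincipal ultrafilter. The target is a domain because relations are compared by degree and
  cancelled, and of characteristic zero because the least relation of an algebraic element must not
  have a multiple root. Finitely many constants c are lost in the specialization, as certain nonzero
  elements (leading coefficients, derivatives) must stay nonzero. The loss is harmless: one constant
  is enough for a tangent vector, and scaling factors multiply, so all nonzero constants are
  products of two good ones.\<close>

context vector_space
begin

lemma linear_functional_iff:
  "Vector_Spaces.linear scale (*) f \<longleftrightarrow>
    (\<forall>x y. f (x + y) = f x + f y) \<and> (\<forall>c x. f (scale c x) = c * f x)"
  unfolding Vector_Spaces.linear_iff
  using vector_space_axioms by (auto simp: vector_space_def algebra_simps)

lemma functional_simps:
  assumes "Vector_Spaces.linear scale (*) f"
  shows "f (x + y) = f x + f y" "f (scale c x) = c * f x" "f 0 = 0" "f (- x) = - f x"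
    "f (x - y) = f x - f y" "f (sum g I) = (\<Sum>i\<in>I. f (g i))"
proof -
  interpret Vector_Spaces.linear scale "(*)" f by (rule assms)
  show "f (x + y) = f x + f y" "f (scale c x) = c * f x" "f 0 = 0" "f (- x) = - f x"
    "f (x - y) = f x - f y" "f (sum g I) = (\<Sum>i\<in>I. f (g i))"
    by (simp_all add: add scale neg diff sum)
qed

text \<open>Interpolate \<open>\<gamma>\<close> one basis vector at a time on a complement of the common kernel.\<close>

lemma functional_mem_of_kernel:
  assumes fin: "finite B\<^sub>0" "span B\<^sub>0 = UNIV"
    and lin: "\<And>e. e \<in> E \<Longrightarrow> Vector_Spaces.linear scale (*) e"
    and zero: "(\<lambda>_. 0) \<in> E"
    and add: "\<And>e e'. e \<in> E \<Longrightarrow> e' \<in> E \<Longrightarrow> (\<lambda>x. e x + e' x) \<in> E"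
    and mult: "\<And>c e. e \<in> E \<Longrightarrow> (\<lambda>x. c * e x) \<in> E"
    and \<gamma>: "Vector_Spaces.linear scale (*) \<gamma>"
    and ker: "\<And>x. (\<And>e. e \<in> E \<Longrightarrow> e x = 0) \<Longrightarrow> \<gamma> x = 0"
  shows "\<gamma> \<in> E"
proof -
  define N where "N = {x. \<forall>e\<in>E. e x = 0}"
  have "subspace N"
    unfolding subspace_def N_def using lin by (auto simp: functional_simps)
  \<comment> \<open>B spans the common kernel and C completes it to a basis. On B both \<gamma> and
    every member of E vanish, so only C - B has to be interpolated.\<close>
  obtain B where B: "B \<subseteq> N" "independent B" "N \<subseteq> span B"
    using basis_exists[of N] by metis
  obtain C where C: "B \<subseteq> C" "independent C" "UNIV \<subseteq> span C"
    using maximal_independent_subset_extend[of B UNIV] B by (metis subset_UNIV)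
  have "finite C" using independent_span_bound[OF fin(1) C(2)] fin(2) by auto
  have sum_mem: "(\<lambda>x. \<Sum>i\<in>I. f i x) \<in> E" if "\<And>i. i \<in> I \<Longrightarrow> f i \<in> E" for f and I :: "'b set"
    using that by (induction I rule: infinite_finite_induct) (auto intro: zero add)
  have interpolate: "\<exists>e\<in>E. \<forall>b\<in>S. e b = \<beta> b" if "finite S" "S \<subseteq> C - B" for S \<beta>
    using that
  proof (induction S arbitrary: \<beta> rule: finite_induct)
    case empty
    show ?case using zero by auto
  next
    case (insert b S)
    \<comment> \<open>The induction hypothesis, applied to indicator values, gives a dual family for
      S inside E.\<close>
    have "\<forall>s\<in>S. \<exists>e\<in>E. \<forall>t\<in>S. e t = (if t = s then 1 else 0)"
      using insert.IH[of "\<lambda>t. if t = _ then 1 else 0"] insert.prems by auto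
    then obtain d where d: "\<And>s. s \<in> S \<Longrightarrow> d s \<in> E"
      "\<And>s t. s \<in> S \<Longrightarrow> t \<in> S \<Longrightarrow> d s t = (if t = s then 1 else 0)"
      by metis
    \<comment> \<open>If all of E vanished on b', then b' would lie in the span of B, and b in the
      span of the other basis vectors.\<close>
    define b' where "b' = b - (\<Sum>s\<in>S. scale (d s b) s)"
    have "b' \<notin> N"
    proof
      assume "b' \<in> N"
      then have "b' \<in> span (C - {b})"
        using B(3) span_mono[of B "C - {b}"] C(1) insert.prems by blast
      moreover have "(\<Sum>s\<in>S. scale (d s b) s) \<in> span (C - {b})"
        using insert by (intro span_sum span_scale span_base) auto
      ultimately have "b' + (\<Sum>s\<in>S. scale (d s b) s) \<in> span (C - {b})" by (rule span_add)
      then have "b \<in> span (C - {b})" by (simp add: b'_def)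
      with C insert show False by (auto simp: dependent_def)
    qed
    then obtain e where e: "e \<in> E" "e b' \<noteq> 0" by (auto simp: N_def)
    \<comment> \<open>Subtracting the combination of the dual family that agrees with e on S makes
      the functional vanish on S; its value at b becomes \<open>e b'\<close>, which is
      nonzero.\<close>
    define e\<^sub>1 where "e\<^sub>1 x = e x + (\<Sum>s\<in>S. (- e s) * d s x)" for x
    have e1: "e\<^sub>1 \<in> E" unfolding e\<^sub>1_def using e d by (intro add sum_mem mult)
    have "e\<^sub>1 b = e b'"
      using lin[OF e(1)] by (simp add: e\<^sub>1_def b'_def functional_simps sum_negf mult.commute)
    with e have e1b: "e\<^sub>1 b \<noteq> 0" by simp
    have e1t: "e\<^sub>1 t = 0" if "t \<in> S" for t
    proof -
      have "(\<Sum>s\<in>S. (- e s) * d s t) = (\<Sum>s\<in>S. if s = t then - e t else 0)"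
        using d(2) that by (intro sum.cong) auto
      then show ?thesis using that insert by (simp add: e\<^sub>1_def)
    qed
    obtain e\<^sub>0 where e0: "e\<^sub>0 \<in> E" "\<forall>t\<in>S. e\<^sub>0 t = \<beta> t"
      using insert.IH[of \<beta>] insert.prems by auto
    show ?case
    proof (intro bexI[of _ "\<lambda>x. e\<^sub>0 x + (\<beta> b - e\<^sub>0 b) / e\<^sub>1 b * e\<^sub>1 x"] ballI)
      fix t assume "t \<in> insert b S"
      then show "e\<^sub>0 t + (\<beta> b - e\<^sub>0 b) / e\<^sub>1 b * e\<^sub>1 t = \<beta> t"
        using e0 e1b e1t by auto
    qed (intro add mult e0 e1)
  qed
  obtain e where e: "e \<in> E" "\<forall>b\<in>C - B. e b = \<gamma> b"
    using interpolate[of "C - B" \<gamma>] \<open>finite C\<close> by blast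
  have eq: "e x = \<gamma> x" if "x \<in> C" for x
  proof (cases "x \<in> B")
    case True
    then have "x \<in> N" using B by auto
    then show ?thesis using e(1) ker[of x] by (auto simp: N_def)
  qed (use that e in auto)
  interpret vs: vector_space_pair scale "(*)"
    using \<gamma> by (simp add: vector_space_pair_def Vector_Spaces.linear_iff)
  have "e = \<gamma>"
  proof
    fix x
    show "e x = \<gamma> x"
      by (rule vs.linear_eq_on[OF lin[OF e(1)] \<gamma>, of _ C]) (use C eq in auto)
  qed
  with e show ?thesis by simp
qed

end

section \<open>Homomorphisms to the dual numbers\<close>

datatype 'a dual_number = Dual (dreal: 'a) (deps: 'a)

instantiation dual_number :: (comm_ring_1) comm_ring_1
begin

definition "0 = Dual 0 0"
definition "1 = Dual 1 0"
definition "x + y = Dual (dreal x + dreal y) (deps x + deps y)"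
definition "x - y = Dual (dreal x - dreal y) (deps x - deps y)"
definition "- x = Dual (- dreal x) (- deps x)"
definition "x * y = Dual (dreal x * dreal y) (dreal x * deps y + deps x * dreal y)"

instance
  by standard
    (auto simp: zero_dual_number_def one_dual_number_def plus_dual_number_def
      minus_dual_number_def uminus_dual_number_def times_dual_number_def algebra_simps)

end

lemma dual_number_sel [simp]:
  "dreal 0 = 0" "deps 0 = 0" "dreal 1 = 1" "deps 1 = 0"
  "dreal (x + y) = dreal x + dreal y" "deps (x + y) = deps x + deps y"
  "dreal (x - y) = dreal x - dreal y" "deps (x - y) = deps x - deps y"
  "dreal (- x) = - dreal x" "deps (- x) = - deps x"
  "dreal (x * y) = dreal x * dreal y" "deps (x * y) = dreal x * deps y + deps x * dreal y"
  by (simp_all add: zero_dual_number_def one_dual_number_def plus_dual_number_def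
      minus_dual_number_def uminus_dual_number_def times_dual_number_def)

lemma dreal_power [simp]: "dreal (x ^ n) = dreal x ^ n"
  by (induction n) auto

lemma dual_number_cancel:
  fixes x :: "'a :: idom dual_number"
  assumes "x * y = 0" "dreal x \<noteq> 0"
  shows "y = 0"
proof -
  have "dreal (x * y) = 0" "deps (x * y) = 0" using assms(1) by simp_all
  with assms(2) show ?thesis by (intro dual_number.expand) auto
qed

text \<open>First order Taylor expansion, with the coefficients split into real and infinitesimal
  parts. Since l is multiplied by the derivative at k, a simple root of the real part lifts to a
  root of p by solving a linear equation for l.\<close>

lemma poly_dual_number:
  fixes p :: "'a :: idom dual_number poly"
  shows "poly p (Dual k l) = Dual (poly (map_poly dreal p) k)
    (poly (map_poly deps p) k + l * poly (pderiv (map_poly dreal p)) k)"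
proof (induction p)
  case (pCons a p)
  have "map_poly dreal (pCons a p) = pCons (dreal a) (map_poly dreal p)"
    "map_poly deps (pCons a p) = pCons (deps a) (map_poly deps p)"
    by (auto intro!: poly_eqI simp: coeff_map_poly coeff_pCons split: nat.split)
  with pCons show ?case
    by (intro dual_number.expand) (simp add: pderiv_pCons algebra_simps)
qed (auto intro!: dual_number.expand)

section \<open>Subrings, adjoining an element, extending homomorphisms\<close>

definition is_subring :: "'a::comm_ring_1 set \<Rightarrow> bool" where
  "is_subring R \<longleftrightarrow> 0 \<in> R \<and> 1 \<in> R \<and> (\<forall>x\<in>R. - x \<in> R) \<and>
     (\<forall>x\<in>R. \<forall>y\<in>R. x + y \<in> R \<and> x * y \<in> R)"

text \<open>Homomorphisms are total functions on the ambient type, constrained only on the carrier,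
  so that a chain of rings R, R[x], R[x, y], ... stays inside a single type.\<close>

definition ring_hom_on :: "'a::comm_ring_1 set \<Rightarrow> ('a \<Rightarrow> 'b::comm_ring_1) \<Rightarrow> bool" where
  "ring_hom_on R \<psi> \<longleftrightarrow> \<psi> 0 = 0 \<and> \<psi> 1 = 1 \<and>
     (\<forall>x\<in>R. \<forall>y\<in>R. \<psi> (x + y) = \<psi> x + \<psi> y \<and> \<psi> (x * y) = \<psi> x * \<psi> y)"

definition polys_over :: "'a::comm_ring_1 set \<Rightarrow> 'a poly set" where
  "polys_over R = {p. \<forall>i. coeff p i \<in> R}"

definition adjoin :: "'a::comm_ring_1 set \<Rightarrow> 'a \<Rightarrow> 'a set" where
  "adjoin R x = (\<lambda>p. poly p x) ` polys_over R"

lemma ring_hom_on_dreal: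
  "ring_hom_on R \<psi> \<Longrightarrow> ring_hom_on R (\<lambda>x. dreal (\<psi> x))"
  by (simp add: ring_hom_on_def)

locale subring_of =
  fixes R :: "'a::comm_ring_1 set"
  assumes subring: "is_subring R"
begin

lemma closed [simp, intro]:
  "0 \<in> R" "1 \<in> R" "x \<in> R \<Longrightarrow> - x \<in> R" "x \<in> R \<Longrightarrow> y \<in> R \<Longrightarrow> x + y \<in> R"
  "x \<in> R \<Longrightarrow> y \<in> R \<Longrightarrow> x * y \<in> R"
  using subring unfolding is_subring_def by auto

lemma closed_diff [simp, intro]: "x \<in> R \<Longrightarrow> y \<in> R \<Longrightarrow> x - y \<in> R"
  using closed(4)[of x "- y"] by auto

lemma closed_sum [intro]: "(\<And>i. i \<in> I \<Longrightarrow> f i \<in> R) \<Longrightarrow> sum f I \<in> R"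
  by (induction I rule: infinite_finite_induct) auto

lemma closed_power [simp, intro]: "x \<in> R \<Longrightarrow> x ^ n \<in> R"
  by (induction n) auto

lemma closed_of_nat [simp, intro]: "of_nat n \<in> R"
  by (induction n) auto

lemma polys_over_closed [simp, intro]:
  "0 \<in> polys_over R" "1 \<in> polys_over R"
  "p \<in> polys_over R \<Longrightarrow> - p \<in> polys_over R"
  "p \<in> polys_over R \<Longrightarrow> q \<in> polys_over R \<Longrightarrow> p + q \<in> polys_over R"
  "p \<in> polys_over R \<Longrightarrow> q \<in> polys_over R \<Longrightarrow> p - q \<in> polys_over R"
  "p \<in> polys_over R \<Longrightarrow> q \<in> polys_over R \<Longrightarrow> p * q \<in> polys_over R"
  "c \<in> R \<Longrightarrow> p \<in> polys_over R \<Longrightarrow> smult c p \<in> polys_over R"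
  "c \<in> R \<Longrightarrow> p \<in> polys_over R \<Longrightarrow> pCons c p \<in> polys_over R"
  "c \<in> R \<Longrightarrow> monom c n \<in> polys_over R"
  unfolding polys_over_def
  by (auto simp: coeff_mult coeff_pCons coeff_monom intro!: closed_sum split: nat.split)

lemma coeff_polys_over [simp, intro]: "p \<in> polys_over R \<Longrightarrow> coeff p i \<in> R"
  by (simp add: polys_over_def)

lemma subring_adjoin: "is_subring (adjoin R x)"
  unfolding is_subring_def
proof (intro conjI ballI)
  show "0 \<in> adjoin R x" "1 \<in> adjoin R x"
    unfolding adjoin_def by (rule image_eqI[of _ _ 0], auto, rule image_eqI[of _ _ 1], auto)
next
  fix s t assume "s \<in> adjoin R x" "t \<in> adjoin R x"
  then obtain p q where "s = poly p x" "t = poly q x" "p \<in> polys_over R" "q \<in> polys_over R"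
    by (auto simp: adjoin_def)
  then show "s + t \<in> adjoin R x" "s * t \<in> adjoin R x"
    unfolding adjoin_def by (rule_tac image_eqI[of _ _ "p + q"], auto,
        rule_tac image_eqI[of _ _ "p * q"], auto)
next
  fix s assume "s \<in> adjoin R x"
  then obtain p where "s = poly p x" "p \<in> polys_over R"
    by (auto simp: adjoin_def)
  then show "- s \<in> adjoin R x"
    unfolding adjoin_def by (rule_tac image_eqI[of _ _ "- p"], auto)
qed

lemma subset_adjoin: "R \<subseteq> adjoin R x"
proof
  fix r assume "r \<in> R"
  then show "r \<in> adjoin R x" unfolding adjoin_def by (intro image_eqI[of _ _ "[:r:]"]) auto
qed

lemma mem_adjoin: "x \<in> adjoin R x"
  unfolding adjoin_def by (intro image_eqI[of _ _ "[:0, 1:]"]) auto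

end

locale subring_hom = subring_of R for R :: "'a::comm_ring_1 set" +
  fixes \<psi> :: "'a \<Rightarrow> 'b::comm_ring_1"
  assumes hom: "ring_hom_on R \<psi>"
begin

lemma hom_simps [simp]:
  "\<psi> 0 = 0" "\<psi> 1 = 1" "x \<in> R \<Longrightarrow> y \<in> R \<Longrightarrow> \<psi> (x + y) = \<psi> x + \<psi> y"
  "x \<in> R \<Longrightarrow> y \<in> R \<Longrightarrow> \<psi> (x * y) = \<psi> x * \<psi> y"
  using hom unfolding ring_hom_on_def by auto

lemma hom_uminus [simp]: "x \<in> R \<Longrightarrow> \<psi> (- x) = - \<psi> x"
  using hom_simps(3)[of x "- x"] by (simp add: eq_neg_iff_add_eq_0 add.commute)

lemma hom_diff [simp]: "x \<in> R \<Longrightarrow> y \<in> R \<Longrightarrow> \<psi> (x - y) = \<psi> x - \<psi> y"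
  using hom_simps(3)[of x "- y"] by auto

lemma hom_sum: "(\<And>i. i \<in> I \<Longrightarrow> f i \<in> R) \<Longrightarrow> \<psi> (sum f I) = (\<Sum>i\<in>I. \<psi> (f i))"
proof (induction I rule: infinite_finite_induct)
  case (insert x F)
  then show ?case using closed_sum[of F f] by auto
qed auto

lemma hom_power [simp]: "x \<in> R \<Longrightarrow> \<psi> (x ^ n) = \<psi> x ^ n"
  by (induction n) auto

lemma hom_of_nat [simp]: "\<psi> (of_nat n) = of_nat n"
  by (induction n) auto

lemma map_poly_hom:
  assumes "p \<in> polys_over R" "q \<in> polys_over R"
  shows "map_poly \<psi> (p + q) = map_poly \<psi> p + map_poly \<psi> q"
    and "map_poly \<psi> (p - q) = map_poly \<psi> p - map_poly \<psi> q"
    and "map_poly \<psi> (p * q) = map_poly \<psi> p * map_poly \<psi> q"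
    and "c \<in> R \<Longrightarrow> map_poly \<psi> (smult c p) = smult (\<psi> c) (map_poly \<psi> p)"
  using assms by (auto intro!: poly_eqI simp: coeff_map_poly coeff_mult hom_sum)

lemma map_poly_hom_const [simp]: "map_poly \<psi> [:c:] = [:\<psi> c:]"
  by (auto intro!: poly_eqI simp: coeff_map_poly coeff_pCons split: nat.split)

text \<open>Two polynomials with the same value at x differ by a relation of x. So sending x to y is
  well defined as soon as y satisfies the images of all relations.\<close>

lemma extend_to_adjoin:
  assumes wd: "\<And>p. p \<in> polys_over R \<Longrightarrow> poly p x = 0 \<Longrightarrow> poly (map_poly \<psi> p) y = 0"
  obtains \<psi>' where "ring_hom_on (adjoin R x) \<psi>'"
    "\<And>p. p \<in> polys_over R \<Longrightarrow> \<psi>' (poly p x) = poly (map_poly \<psi> p) y"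
    "\<And>r. r \<in> R \<Longrightarrow> \<psi>' r = \<psi> r" "\<psi>' x = y"
proof -
  define \<psi>' where "\<psi>' s = poly (map_poly \<psi> (SOME p. p \<in> polys_over R \<and> s = poly p x)) y" for s
  have eq: "\<psi>' (poly p x) = poly (map_poly \<psi> p) y" if p: "p \<in> polys_over R" for p
  proof -
    let ?q = "SOME q. q \<in> polys_over R \<and> poly p x = poly q x"
    have "?q \<in> polys_over R \<and> poly p x = poly ?q x"
      by (rule someI[of _ p]) (use p in auto)
    then have "poly (map_poly \<psi> (?q - p)) y = 0" using p by (intro wd) auto
    then show ?thesis
      using p \<open>?q \<in> polys_over R \<and> _\<close> by (simp add: \<psi>'_def map_poly_hom)
  qed
  have r: "\<psi>' r = \<psi> r" if "r \<in> R" for r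
    using eq[of "[:r:]"] that by simp
  have "\<psi>' x = y"
    using eq[of "[:0, 1:]"] by (simp add: map_poly_pCons)
  moreover have "ring_hom_on (adjoin R x) \<psi>'"
    unfolding ring_hom_on_def
  proof (intro conjI ballI)
    show "\<psi>' 0 = 0" "\<psi>' 1 = 1" using r[of 0] r[of 1] by auto
    fix s t assume "s \<in> adjoin R x" "t \<in> adjoin R x"
    then obtain p q where *: "s = poly p x" "t = poly q x" "p \<in> polys_over R" "q \<in> polys_over R"
      by (auto simp: adjoin_def)
    then show "\<psi>' (s + t) = \<psi>' s + \<psi>' t" "\<psi>' (s * t) = \<psi>' s * \<psi>' t"
      using eq[of "p + q"] eq[of "p * q"] eq[of p] eq[of q] by (simp_all add: map_poly_hom)
  qed
  ultimately show ?thesis using that eq r by blast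
qed

end

section \<open>Division with denominators and algebraic elements\<close>

lemma pseudo_division:
  fixes f w :: "'a::idom poly"
  assumes "is_subring R" "w \<in> polys_over R" "w \<noteq> 0" "f \<in> polys_over R"
  obtains N g \<rho> where "g \<in> polys_over R" "\<rho> \<in> polys_over R"
    "smult (lead_coeff w ^ N) f = w * g + \<rho>" "\<rho> = 0 \<or> degree \<rho> < degree w"
  using assms(4)
proof (induction "degree f" arbitrary: f thesis rule: less_induct)
  case less
  interpret subring_of R by standard (rule assms)
  show ?case
  proof (cases "f = 0 \<or> degree f < degree w")
    case True
    then show ?thesis using less.prems(1)[of 0 f 0] less.prems(2) by auto
  next
    case False
    \<comment> \<open>The usual division step without dividing in R: scaling f by the leading
      coefficient of w lets the leading terms cancel.\<close>
    define f' where "f' = smult (lead_coeff w) f - w * monom (lead_coeff f) (degree f - degree w)"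
    have f'R: "f' \<in> polys_over R" using less.prems assms by (auto simp: f'_def)
    have c0: "coeff f' (degree f) = 0"
      using False by (simp add: f'_def mult.commute[of w] coeff_monom_mult)
    have "degree (w * monom (lead_coeff f) (degree f - degree w)) \<le> degree f"
      using False by (intro order.trans[OF degree_mult_le]) (simp add: degree_monom_eq)
    then have le: "degree f' \<le> degree f"
      by (auto simp: f'_def intro!: degree_diff_le)
    show ?thesis
    proof (cases "degree f' < degree f")
      case True
      from less.hyps[OF this _ f'R] obtain g \<rho> N where *: "g \<in> polys_over R" "\<rho> \<in> polys_over R"
        "smult (lead_coeff w ^ N) f' = w * g + \<rho>" "\<rho> = 0 \<or> degree \<rho> < degree w" by metis
      have "smult (lead_coeff w ^ Suc N) f =
          w * (g + smult (lead_coeff w ^ N) (monom (lead_coeff f) (degree f - degree w))) + \<rho>"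
        using *(3) by (simp add: f'_def algebra_simps smult_diff_right)
      then show ?thesis
        using less.prems * assms by (intro less.prems(1)[of _ \<rho> "Suc N"]) auto
    next
      case False
      \<comment> \<open>The coefficient at \<open>degree f\<close> vanishes, so a degree that does
        not drop means that \<open>f'\<close> is zero.\<close>
      with le c0 have "f' = 0" by (metis leading_coeff_0_iff le_antisym not_less)
      then have "smult (lead_coeff w ^ 1) f =
          w * monom (lead_coeff f) (degree f - degree w) + 0"
        by (simp add: f'_def)
      then show ?thesis using less.prems by (intro less.prems(1)[of "monom (lead_coeff f) (degree f - degree w)" 0 1]) simp_all
    qed
  qed
qed

text \<open>Over a ring, m replaces the minimal polynomial: a relation of least degree, in general
  not monic, so that powers of its leading coefficient appear as denominators.\<close>

locale algebraic_over = subring_of R for R :: "'a::{idom,ring_char_0} set" +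
  fixes x :: 'a and m :: "'a poly"
  assumes m: "m \<in> polys_over R" "m \<noteq> 0" "poly m x = 0"
    and minimal: "\<And>p. p \<in> polys_over R \<Longrightarrow> p \<noteq> 0 \<Longrightarrow> poly p x = 0 \<Longrightarrow> degree m \<le> degree p"
begin

lemma degree_m: "degree m > 0"
proof (rule ccontr)
  assume "\<not> degree m > 0"
  then obtain c where "m = [:c:]" by (metis degree_eq_zeroE gr0I)
  with m show False by simp
qed

text \<open>By minimality the remainder of pseudo-division by m is zero. So m generates all
  relations once its leading coefficient is inverted.\<close>

lemma relation_multiple:
  assumes "f \<in> polys_over R" "poly f x = 0"
  obtains N g where "g \<in> polys_over R" "smult (lead_coeff m ^ N) f = m * g"
proof -
  obtain N g \<rho> where *: "g \<in> polys_over R" "\<rho> \<in> polys_over R"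
    "smult (lead_coeff m ^ N) f = m * g + \<rho>" "\<rho> = 0 \<or> degree \<rho> < degree m"
    using pseudo_division[OF subring m(1,2) assms(1)] by metis
  have "poly \<rho> x = poly (smult (lead_coeff m ^ N) f - m * g) x" using *(3) by simp
  also have "\<dots> = 0" using assms m by simp
  finally have "\<rho> = 0" using minimal[of \<rho>] * by force
  then show ?thesis using * that by auto
qed

text \<open>Among the nonzero multiples of s, written as w(x), take one with w of least degree. If w
  were not constant, dividing m by w would give either such a multiple with a smaller degree or a
  relation of x of smaller degree than m.\<close>

lemma divides_constant:
  assumes "s \<in> adjoin R x" "s \<noteq> 0"
  obtains q where "q \<in> polys_over R" "poly q x * s \<in> R" "poly q x * s \<noteq> 0"
proof -
  define W where "W w \<longleftrightarrow> w \<in> polys_over R \<and> poly w x \<noteq> 0 \<and>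
    (\<exists>q\<in>polys_over R. poly w x = poly q x * s)" for w
  obtain p where p: "p \<in> polys_over R" "s = poly p x" using assms by (auto simp: adjoin_def)
  \<comment> \<open>Reducing a polynomial that represents s modulo m makes the minimization start
    below \<open>degree m\<close>.\<close>
  have small: "\<exists>w. W w \<and> degree w < degree m"
  proof -
    obtain N g \<rho> where *: "g \<in> polys_over R" "\<rho> \<in> polys_over R"
      "smult (lead_coeff m ^ N) p = m * g + \<rho>" "\<rho> = 0 \<or> degree \<rho> < degree m"
      using pseudo_division[OF subring m(1,2) p(1)] by metis
    have "poly \<rho> x = poly (smult (lead_coeff m ^ N) p - m * g) x" using *(3) by simp
    also have "\<dots> = poly [:lead_coeff m ^ N:] x * s" using m p by simp
    finally have e: "poly \<rho> x = poly [:lead_coeff m ^ N:] x * s" .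
    then have "poly \<rho> x \<noteq> 0" using m assms by simp
    then show ?thesis using * e m unfolding W_def
      by (intro exI[of _ \<rho>]) (auto intro!: bexI[of _ "[:lead_coeff m ^ N:]"])
  qed
  define w where "w = arg_min degree W"
  have w: "W w" "\<And>v. W v \<Longrightarrow> degree w \<le> degree v"
    using small arg_min_natI[of W _ degree] arg_min_nat_le[of W _ degree] by (auto simp: w_def)
  then have dw: "degree w < degree m" using small by force
  obtain q where q: "q \<in> polys_over R" "poly w x = poly q x * s" using w(1) by (auto simp: W_def)
  have "degree w = 0"
  proof (rule ccontr)
    assume dw0: "degree w \<noteq> 0"
    obtain N g \<rho> where *: "g \<in> polys_over R" "\<rho> \<in> polys_over R"
      "smult (lead_coeff w ^ N) m = w * g + \<rho>" "\<rho> = 0 \<or> degree \<rho> < degree w"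
      using pseudo_division[OF subring _ _ m(1), of w] w(1) dw0 unfolding W_def by (metis degree_0)
    have "poly \<rho> x = poly (smult (lead_coeff w ^ N) m - w * g) x" using *(3) by simp
    also have wg: "\<dots> = - (poly w x * poly g x)" using m by simp
    also have "\<dots> = poly (- (g * q)) x * s" using q by simp
    finally have e: "poly \<rho> x = poly (- (g * q)) x * s" .
    have "poly \<rho> x = 0"
    proof (rule ccontr)
      assume "poly \<rho> x \<noteq> 0"
      then have "W \<rho>" using * e q unfolding W_def by (auto intro!: bexI[of _ "- (g * q)"])
      from w(2)[OF this] have "\<rho> = 0" using * by auto
      with \<open>poly \<rho> x \<noteq> 0\<close> show False by simp
    qed
    then have "poly g x = 0"
      using e q w(1) unfolding W_def by (auto simp: algebra_simps)
    have w0: "w \<noteq> 0" using dw0 by auto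
    have "degree \<rho> < degree m" using * dw dw0 by auto
    moreover have "degree (smult (lead_coeff w ^ N) m) = degree m" using w0 by simp
    ultimately have "degree (w * g) = degree m"
      using *(3) degree_add_eq_left[of "- \<rho>" "smult (lead_coeff w ^ N) m"] by simp
    moreover have g0: "g \<noteq> 0" using calculation degree_m by auto
    \<comment> \<open>The degrees of w and g add up to that of m and w is not constant, so the
      relation g is too small for the minimality of m.\<close>
    ultimately have "degree g < degree m" using w0 dw0 by (simp add: degree_mult_eq)
    with minimal[OF *(1) g0 \<open>poly g x = 0\<close>] show False by simp
  qed
  then obtain c where "w = [:c:]" by (metis degree_eq_zeroE)
  then have "poly w x = coeff w 0" by simp
  then have "poly q x * s \<in> R" "poly q x * s \<noteq> 0"
    using w(1) q coeff_polys_over[of w 0] unfolding W_def by auto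
  with q show ?thesis using that by blast
qed

end


lemma (in algebraic_over) polys_over_pderiv [simp, intro]:
  "p \<in> polys_over R \<Longrightarrow> pderiv p \<in> polys_over R"
  unfolding polys_over_def by (auto simp: coeff_pderiv simp del: of_nat_Suc)

lemma infinite_nonroot:
  fixes p :: "'k::field_char_0 poly"
  assumes "p \<noteq> 0"
  obtains k where "poly p k \<noteq> 0"
  using poly_roots_finite[OF assms] infinite_UNIV_char_0[where 'a = 'k]
  by (metis (mono_tags, lifting) UNIV_I finite_subset mem_Collect_eq subsetI)

text \<open>Hensel lifting in one step. The real part of \<psi> keeps the degree of m, so the image
  of m has a root; the hypothesis on d makes this root simple, and a simple root lifts to the dual
  numbers.\<close>

lemma (in algebraic_over) extend_dual_hom:
  fixes \<psi> :: "'a \<Rightarrow> 'k::field_char_0 dual_number"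
  assumes alg_closed: "\<And>p :: 'k poly. degree p > 0 \<Longrightarrow> \<exists>x. poly p x = 0"
    and \<psi>: "ring_hom_on R \<psi>" "dreal (\<psi> (lead_coeff m)) \<noteq> 0"
    and v: "v \<in> polys_over R" "poly v x * poly (pderiv m) x = d" "d \<in> R" "dreal (\<psi> d) \<noteq> 0"
  obtains \<psi>' where "ring_hom_on (adjoin R x) \<psi>'" "\<And>r. r \<in> R \<Longrightarrow> \<psi>' r = \<psi> r"
proof -
  interpret subring_hom R \<psi> by standard (rule \<psi>)
  define \<phi> where "\<phi> r = dreal (\<psi> r)" for r
  interpret re: subring_hom R \<phi>
    unfolding \<phi>_def by standard (rule ring_hom_on_dreal[OF \<psi>(1)])
  have \<phi>_map: "map_poly \<phi> p = map_poly dreal (map_poly \<psi> p)" for p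
    by (auto intro!: poly_eqI simp: coeff_map_poly \<phi>_def)
  define m0 where "m0 = map_poly \<phi> m"
  have "coeff m0 (degree m) \<noteq> 0"
    using \<psi>(2) by (simp add: m0_def coeff_map_poly \<phi>_def)
  then have "degree m0 > 0" using degree_m le_degree[of m0 "degree m"] by linarith
  with alg_closed obtain k where k: "poly m0 k = 0" by blast
  \<comment> \<open>This polynomial is a relation of x, hence a multiple of m up to a denominator.
    So its image vanishes at k, and the derivative of m0 at k divides the nonzero image of
    d.\<close>
  have "v * pderiv m - [:d:] \<in> polys_over R" "poly (v * pderiv m - [:d:]) x = 0"
    using v m by auto
  then obtain N g where g: "g \<in> polys_over R"
    "smult (lead_coeff m ^ N) (v * pderiv m - [:d:]) = m * g"
    by (rule relation_multiple)
  have "smult (\<phi> (lead_coeff m) ^ N) (map_poly \<phi> v * map_poly \<phi> (pderiv m) - [:\<phi> d:]) =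
      m0 * map_poly \<phi> g"
    using arg_cong[OF g(2), of "map_poly \<phi>"] v m g(1) unfolding m0_def
    by (simp add: re.map_poly_hom)
  then have "poly (smult (\<phi> (lead_coeff m) ^ N)
      (map_poly \<phi> v * map_poly \<phi> (pderiv m) - [:\<phi> d:])) k = 0"
    using k by simp
  moreover have "map_poly \<phi> (pderiv m) = pderiv m0"
    using m by (auto intro!: poly_eqI simp: m0_def coeff_map_poly coeff_pderiv simp del: of_nat_Suc)
  ultimately have dm0: "poly (pderiv m0) k \<noteq> 0"
    using \<psi>(2) v(4) by (auto simp: \<phi>_def)
  \<comment> \<open>The infinitesimal part is the solution of the linear equation in
    \<open>poly_dual_number\<close>.\<close>
  define y where "y = Dual k (- poly (map_poly deps (map_poly \<psi> m)) k / poly (pderiv m0) k)"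
  have y: "poly (map_poly \<psi> m) y = 0"
    unfolding y_def poly_dual_number using k dm0 by (auto simp: m0_def \<phi>_map zero_dual_number_def)
  have wd: "poly (map_poly \<psi> p) y = 0" if p: "p \<in> polys_over R" "poly p x = 0" for p
  proof -
    obtain N g where g: "g \<in> polys_over R" "smult (lead_coeff m ^ N) p = m * g"
      using relation_multiple[OF p] by metis
    have "smult (\<psi> (lead_coeff m) ^ N) (map_poly \<psi> p) = map_poly \<psi> m * map_poly \<psi> g"
      using arg_cong[OF g(2), of "map_poly \<psi>"] p m g(1) by (simp add: map_poly_hom)
    then have "\<psi> (lead_coeff m) ^ N * poly (map_poly \<psi> p) y = 0"
      using y by (metis mult_zero_left poly_mult poly_smult)
    then show ?thesis
      by (rule dual_number_cancel) (use \<psi>(2) in simp)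
  qed
  obtain \<psi>' where "ring_hom_on (adjoin R x) \<psi>'" "\<And>r. r \<in> R \<Longrightarrow> \<psi>' r = \<psi> r"
    using extend_to_adjoin[OF wd] by metis
  then show ?thesis by (rule that)
qed

text \<open>The element r collects everything that must not vanish for \<psi> to extend to x while s
  keeps a nonzero real part.\<close>

lemma dual_hom_extension:
  fixes R :: "'r::{idom,ring_char_0} set"
  assumes alg_closed: "\<And>p :: 'k::field_char_0 poly. degree p > 0 \<Longrightarrow> \<exists>x. poly p x = 0"
    and R: "is_subring R" and s: "s \<in> adjoin R x" "s \<noteq> 0"
  obtains r where "r \<in> R" "r \<noteq> 0"
    "\<And>\<psi> :: 'r \<Rightarrow> 'k dual_number. ring_hom_on R \<psi> \<Longrightarrow> dreal (\<psi> r) \<noteq> 0 \<Longrightarrow>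
      \<exists>\<psi>'. ring_hom_on (adjoin R x) \<psi>' \<and> (\<forall>r\<in>R. \<psi>' r = \<psi> r) \<and> dreal (\<psi>' s) \<noteq> 0"
proof (cases "\<exists>p\<in>polys_over R. p \<noteq> 0 \<and> poly p x = 0")
  case False
  interpret subring_of R by standard (rule R)
  obtain p where p: "p \<in> polys_over R" "s = poly p x" using s by (auto simp: adjoin_def)
  have "p \<noteq> 0" using p s by auto
  show ?thesis
  \<comment> \<open>There are no relations to respect: x may go to any constant that is not a root
    of the real part of the image of p.\<close>
  proof (rule that[of "lead_coeff p"])
    show "lead_coeff p \<in> R" "lead_coeff p \<noteq> 0" using p \<open>p \<noteq> 0\<close> by auto
    fix \<psi> :: "'r \<Rightarrow> 'k dual_number"
    assume \<psi>: "ring_hom_on R \<psi>" "dreal (\<psi> (lead_coeff p)) \<noteq> 0"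
    interpret subring_hom R \<psi> by standard (rule \<psi>)
    have "coeff (map_poly dreal (map_poly \<psi> p)) (degree p) \<noteq> 0"
      using \<psi> by (simp add: coeff_map_poly)
    then obtain k where k: "poly (map_poly dreal (map_poly \<psi> p)) k \<noteq> 0"
      by (metis infinite_nonroot coeff_0)
    have wd: "poly (map_poly \<psi> p) (Dual k 0) = 0" if "p \<in> polys_over R" "poly p x = 0" for p
      using that False by (cases "p = 0") auto
    obtain \<psi>' where "ring_hom_on (adjoin R x) \<psi>'" "\<And>r. r \<in> R \<Longrightarrow> \<psi>' r = \<psi> r"
      "\<psi>' s = poly (map_poly \<psi> p) (Dual k 0)"
      using extend_to_adjoin[OF wd] p by metis
    then show "\<exists>\<psi>'. ring_hom_on (adjoin R x) \<psi>' \<and> (\<forall>r\<in>R. \<psi>' r = \<psi> r) \<and> dreal (\<psi>' s) \<noteq> 0"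
      using k by (auto simp: poly_dual_number)
  qed
next
  case True
  define P where "P p \<longleftrightarrow> p \<in> polys_over R \<and> p \<noteq> 0 \<and> poly p x = 0" for p
  define m where "m = arg_min degree P"
  have m: "P m" "\<And>p. P p \<Longrightarrow> degree m \<le> degree p"
    using True arg_min_natI[of P _ degree] arg_min_nat_le[of P _ degree]
    by (auto simp: m_def P_def)
  interpret algebraic_over R x m
    by standard (use R m in \<open>auto simp: P_def\<close>)
  obtain q where q: "q \<in> polys_over R" "poly q x * s \<in> R" "poly q x * s \<noteq> 0"
    using divides_constant[OF s] by metis
  \<comment> \<open>Characteristic zero enters here: the derivative is a nonzero polynomial of
    smaller degree than m, so it cannot be a relation of x.\<close>
  have "pderiv m \<noteq> 0" using degree_m by (simp add: pderiv_eq_0_iff)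
  moreover have "degree (pderiv m) < degree m" using degree_m by (simp add: degree_pderiv)
  ultimately have "poly (pderiv m) x \<noteq> 0"
    using minimal[of "pderiv m"] m by (auto simp: P_def)
  moreover have "poly (pderiv m) x \<in> adjoin R x"
    unfolding adjoin_def using m by (auto simp: P_def)
  ultimately obtain v where v: "v \<in> polys_over R" "poly v x * poly (pderiv m) x \<in> R"
    "poly v x * poly (pderiv m) x \<noteq> 0"
    using divides_constant by metis
  \<comment> \<open>The three factors keep the degree of m, make the root simple, and keep s
    nonzero.\<close>
  let ?r = "lead_coeff m * (poly v x * poly (pderiv m) x) * (poly q x * s)"
  show ?thesis
  proof (rule that[of ?r])
    show "?r \<in> R" "?r \<noteq> 0" using m v q by (auto simp: P_def)
    fix \<psi> :: "'r \<Rightarrow> 'k dual_number"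
    assume \<psi>: "ring_hom_on R \<psi>" "dreal (\<psi> ?r) \<noteq> 0"
    interpret subring_hom R \<psi> by standard (rule \<psi>)
    have "\<psi> ?r = \<psi> (lead_coeff m) * \<psi> (poly v x * poly (pderiv m) x) * \<psi> (poly q x * s)"
      using m(1) v(2) q(2) by (auto simp: P_def)
    with \<psi> have nz: "dreal (\<psi> (lead_coeff m)) \<noteq> 0"
      "dreal (\<psi> (poly v x * poly (pderiv m) x)) \<noteq> 0" "dreal (\<psi> (poly q x * s)) \<noteq> 0"
      by auto
    obtain \<psi>' where \<psi>': "ring_hom_on (adjoin R x) \<psi>'" "\<And>r. r \<in> R \<Longrightarrow> \<psi>' r = \<psi> r"
      using extend_dual_hom[OF alg_closed \<psi>(1) nz(1) v(1) refl v(2) nz(2)] by metis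
    have "poly q x \<in> adjoin R x" using q by (auto simp: adjoin_def)
    then have "\<psi>' (poly q x * s) = \<psi>' (poly q x) * \<psi>' s"
      using \<psi>'(1) s unfolding ring_hom_on_def by blast
    then have "dreal (\<psi>' s) \<noteq> 0" using nz(3) \<psi>'(2)[OF q(2)] by auto
    then show "\<exists>\<psi>'. ring_hom_on (adjoin R x) \<psi>' \<and> (\<forall>r\<in>R. \<psi>' r = \<psi> r) \<and> dreal (\<psi>' s) \<noteq> 0"
      using \<psi>' by blast
  qed
qed

text \<open>The quantification over s makes the property inductive: adjoining an element turns the
  condition on s into a condition on some nonzero element of the smaller ring.\<close>

definition has_dual_points :: "('k::field_char_0 \<Rightarrow> 'r::comm_ring_1) \<Rightarrow> 'r \<Rightarrow> 'r set \<Rightarrow> bool" where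
  "has_dual_points \<iota> \<chi> R \<longleftrightarrow> is_subring R \<and> range \<iota> \<subseteq> R \<and> \<chi> \<in> R \<and>
     (\<forall>s\<in>R. s \<noteq> 0 \<longrightarrow> (\<exists>F. finite F \<and> (\<forall>c. c \<notin> F \<longrightarrow>
        (\<exists>\<psi>. ring_hom_on R \<psi> \<and> (\<forall>a. \<psi> (\<iota> a) = Dual a 0) \<and> \<psi> \<chi> = Dual c 1 \<and> dreal (\<psi> s) \<noteq> 0))))"

lemma has_dual_points_adjoin:
  fixes \<iota> :: "'k::field_char_0 \<Rightarrow> 'r::{idom,ring_char_0}"
  assumes alg_closed: "\<And>p :: 'k poly. degree p > 0 \<Longrightarrow> \<exists>x. poly p x = 0"
    and R: "has_dual_points \<iota> \<chi> R"
  shows "has_dual_points \<iota> \<chi> (adjoin R x)"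
proof -
  have sub: "is_subring R" using R by (simp add: has_dual_points_def)
  interpret subring_of R by standard (rule sub)
  show ?thesis
    unfolding has_dual_points_def
  proof (intro conjI ballI impI)
    show "is_subring (adjoin R x)" by (rule subring_adjoin)
    show "range \<iota> \<subseteq> adjoin R x" "\<chi> \<in> adjoin R x"
      using R subset_adjoin by (auto simp: has_dual_points_def)
    fix s assume s: "s \<in> adjoin R x" "s \<noteq> 0"
    obtain r where r: "r \<in> R" "r \<noteq> 0"
      "\<And>\<psi> :: 'r \<Rightarrow> 'k dual_number. ring_hom_on R \<psi> \<Longrightarrow> dreal (\<psi> r) \<noteq> 0 \<Longrightarrow>
        \<exists>\<psi>'. ring_hom_on (adjoin R x) \<psi>' \<and> (\<forall>r\<in>R. \<psi>' r = \<psi> r) \<and> dreal (\<psi>' s) \<noteq> 0"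
      using dual_hom_extension[OF alg_closed sub s] by metis
    obtain F where F: "finite F" "\<And>c. c \<notin> F \<Longrightarrow> \<exists>\<psi>. ring_hom_on R \<psi> \<and>
        (\<forall>a. \<psi> (\<iota> a) = Dual a 0) \<and> \<psi> \<chi> = Dual c 1 \<and> dreal (\<psi> r) \<noteq> 0"
      using R r unfolding has_dual_points_def by meson
    have mem: "\<chi> \<in> R" "\<iota> a \<in> R" for a using R by (auto simp: has_dual_points_def)
    show "\<exists>F. finite F \<and> (\<forall>c. c \<notin> F \<longrightarrow> (\<exists>\<psi>. ring_hom_on (adjoin R x) \<psi> \<and>
        (\<forall>a. \<psi> (\<iota> a) = Dual a 0) \<and> \<psi> \<chi> = Dual c 1 \<and> dreal (\<psi> s) \<noteq> 0))"
    proof (intro exI[of _ F] conjI allI impI)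
      fix c assume "c \<notin> F"
      from F(2)[OF this] obtain \<psi> where \<psi>: "ring_hom_on R \<psi>" "\<And>a. \<psi> (\<iota> a) = Dual a 0"
        "\<psi> \<chi> = Dual c 1" "dreal (\<psi> r) \<noteq> 0" by auto
      from r(3)[OF \<psi>(1,4)] obtain \<psi>' where "ring_hom_on (adjoin R x) \<psi>'"
        "\<forall>r\<in>R. \<psi>' r = \<psi> r" "dreal (\<psi>' s) \<noteq> 0" by blast
      with \<psi> mem show "\<exists>\<psi>. ring_hom_on (adjoin R x) \<psi> \<and>
        (\<forall>a. \<psi> (\<iota> a) = Dual a 0) \<and> \<psi> \<chi> = Dual c 1 \<and> dreal (\<psi> s) \<noteq> 0"
        by (intro exI[of _ \<psi>']) auto
    qed (rule F(1))
  qed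
qed

text \<open>The ring is a polynomial ring in \<chi>, and p(c + \<epsilon>) has real part p(c). The
  excluded constants are the roots of the polynomial p that represents s.\<close>

lemma has_dual_points_base:
  fixes \<iota> :: "'k::field_char_0 \<Rightarrow> 'r::idom"
  assumes \<iota>: "ring_hom_on UNIV \<iota>"
    and transcendental: "\<And>p. poly (map_poly \<iota> p) \<chi> = 0 \<Longrightarrow> p = 0"
  shows "has_dual_points \<iota> \<chi> (adjoin (range \<iota>) \<chi>)"
proof -
  interpret iota: subring_hom UNIV \<iota>
    by standard (auto simp: is_subring_def \<iota>)
  have inj: "inj \<iota>"
  proof (rule injI)
    fix a b assume eq: "\<iota> a = \<iota> b"
    have "\<iota> (inverse (a - b) * (a - b)) = 0" by (simp add: eq)
    then show "a = b"
      by (metis iota.hom_simps(2) left_inverse right_minus_eq zero_neq_one)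
  qed
  have sub: "is_subring (range \<iota>)"
    unfolding is_subring_def
  proof (intro conjI ballI)
    show "0 \<in> range \<iota>" "1 \<in> range \<iota>" by (metis iota.hom_simps(1,2) rangeI)+
  qed (auto, metis UNIV_I iota.hom_uminus rangeI, metis UNIV_I iota.hom_simps(3) rangeI,
      metis UNIV_I iota.hom_simps(4) rangeI)
  interpret subring_of "range \<iota>" by standard (rule sub)
  define \<psi> where "\<psi> r = Dual (inv \<iota> r) 0" for r
  have \<psi>: "\<psi> (\<iota> a) = Dual a 0" for a using inj by (simp add: \<psi>_def)
  have hom: "ring_hom_on (range \<iota>) \<psi>"
    unfolding ring_hom_on_def
  proof (intro conjI ballI)
    show "\<psi> 0 = 0" "\<psi> 1 = 1"
      using \<psi>[of 0] \<psi>[of 1] by (auto intro!: dual_number.expand)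
    fix x y assume "x \<in> range \<iota>" "y \<in> range \<iota>"
    then show "\<psi> (x + y) = \<psi> x + \<psi> y" "\<psi> (x * y) = \<psi> x * \<psi> y"
      by (auto simp flip: iota.hom_simps simp: \<psi> intro!: dual_number.expand)
  qed
  have lift: "\<exists>q. p = map_poly \<iota> q" if p: "p \<in> polys_over (range \<iota>)" for p
    using p \<iota> inj unfolding polys_over_def ring_hom_on_def
    by (intro exI[of _ "map_poly (inv \<iota>) p"]) (auto intro!: poly_eqI simp: coeff_map_poly f_inv_into_f
        inv_f_eq)
  show ?thesis
    unfolding has_dual_points_def
  proof (intro conjI ballI impI)
    show "is_subring (adjoin (range \<iota>) \<chi>)" by (rule subring_adjoin)
    show "range \<iota> \<subseteq> adjoin (range \<iota>) \<chi>" by (rule subset_adjoin)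
    show "\<chi> \<in> adjoin (range \<iota>) \<chi>" by (rule mem_adjoin)
    fix s assume s: "s \<in> adjoin (range \<iota>) \<chi>" "s \<noteq> 0"
    then obtain p where p: "s = poly (map_poly \<iota> p) \<chi>" "map_poly \<iota> p \<in> polys_over (range \<iota>)"
      using lift by (auto simp: adjoin_def)
    have "p \<noteq> 0" using p s by auto
    show "\<exists>F. finite F \<and> (\<forall>c. c \<notin> F \<longrightarrow> (\<exists>\<psi>. ring_hom_on (adjoin (range \<iota>) \<chi>) \<psi> \<and>
        (\<forall>a. \<psi> (\<iota> a) = Dual a 0) \<and> \<psi> \<chi> = Dual c 1 \<and> dreal (\<psi> s) \<noteq> 0))"
    proof (intro exI[of _ "{c. poly p c = 0}"] conjI allI impI)
      show "finite {c. poly p c = 0}" by (rule poly_roots_finite) fact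
      fix c assume c: "c \<notin> {c. poly p c = 0}"
      interpret h: subring_hom "range \<iota>" \<psi> by standard (rule hom)
      have wd: "poly (map_poly \<psi> q) (Dual c 1) = 0"
        if q: "q \<in> polys_over (range \<iota>)" "poly q \<chi> = 0" for q
      proof -
        obtain p where "q = map_poly \<iota> p" using lift[OF q(1)] by blast
        with q(2) transcendental[of p] show ?thesis by simp
      qed
      obtain \<psi>' where \<psi>': "ring_hom_on (adjoin (range \<iota>) \<chi>) \<psi>'"
        "\<And>p. p \<in> polys_over (range \<iota>) \<Longrightarrow> \<psi>' (poly p \<chi>) = poly (map_poly \<psi> p) (Dual c 1)"
        "\<And>r. r \<in> range \<iota> \<Longrightarrow> \<psi>' r = \<psi> r" "\<psi>' \<chi> = Dual c 1"
        using h.extend_to_adjoin[OF wd] by metis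
      have "map_poly dreal (map_poly \<psi> (map_poly \<iota> p)) = p"
        by (auto intro!: poly_eqI simp: coeff_map_poly \<psi>)
      then have "dreal (\<psi>' s) \<noteq> 0"
        using p c by (simp add: \<psi>'(2) poly_dual_number)
      then show "\<exists>\<psi>. ring_hom_on (adjoin (range \<iota>) \<chi>) \<psi> \<and>
        (\<forall>a. \<psi> (\<iota> a) = Dual a 0) \<and> \<psi> \<chi> = Dual c 1 \<and> dreal (\<psi> s) \<noteq> 0"
        using \<psi>' \<psi> by (intro exI[of _ \<psi>']) auto
    qed
  qed
qed

text \<open>Starting from polynomials in \<chi>, adjoin the elements of X one at a time; F is the
  excluded set that belongs to s = 1.\<close>

proposition finitely_generated_dual_points:
  fixes \<iota> :: "'k::field_char_0 \<Rightarrow> 'r::{idom,ring_char_0}"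
  assumes alg_closed: "\<And>p :: 'k poly. degree p > 0 \<Longrightarrow> \<exists>x. poly p x = 0"
    and \<iota>: "ring_hom_on UNIV \<iota>"
    and transcendental: "\<And>p. poly (map_poly \<iota> p) \<chi> = 0 \<Longrightarrow> p = 0"
    and "finite X"
  obtains R F where "is_subring R" "range \<iota> \<subseteq> R" "\<chi> \<in> R" "X \<subseteq> R" "finite F"
    "\<And>c. c \<notin> F \<Longrightarrow> \<exists>\<psi>. ring_hom_on R \<psi> \<and> (\<forall>a. \<psi> (\<iota> a) = Dual a 0) \<and> \<psi> \<chi> = Dual c 1"
proof -
  from \<open>finite X\<close> have "\<exists>R. has_dual_points \<iota> \<chi> R \<and> X \<subseteq> R"
  proof induction
    case empty
    show ?case using has_dual_points_base[OF \<iota> transcendental] by blast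
  next
    case (insert x X)
    then obtain R where R: "has_dual_points \<iota> \<chi> R" "X \<subseteq> R" by blast
    interpret subring_of R by standard (use R in \<open>simp add: has_dual_points_def\<close>)
    show ?case
      using has_dual_points_adjoin[OF alg_closed R(1)] R(2) subset_adjoin mem_adjoin by blast
  qed
  then obtain R where R: "has_dual_points \<iota> \<chi> R" "X \<subseteq> R" by blast
  then have "1 \<in> R" by (auto simp: has_dual_points_def is_subring_def)
  with R(1) obtain F where "finite F" "\<And>c. c \<notin> F \<Longrightarrow>
    \<exists>\<psi>. ring_hom_on R \<psi> \<and> (\<forall>a. \<psi> (\<iota> a) = Dual a 0) \<and> \<psi> \<chi> = Dual c 1"
    unfolding has_dual_points_def by (metis zero_neq_one)
  with R that show ?thesis unfolding has_dual_points_def by blast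
qed

section \<open>Ultrapowers\<close>

text \<open>The finite intersection property with "infinite" in place of "nonempty". On an infinite
  set, the maximal families with this property are the nonprincipal ultrafilters.\<close>

definition inf_intersections :: "'a set set \<Rightarrow> bool" where
  "inf_intersections C \<longleftrightarrow> (\<forall>F. finite F \<longrightarrow> F \<subseteq> C \<longrightarrow> infinite (\<Inter>F))"

lemma ex_maximal_inf_intersections:
  assumes "infinite (UNIV :: 'a set)"
  shows "\<exists>C :: 'a set set. inf_intersections C \<and> (\<forall>D. inf_intersections D \<longrightarrow> C \<subseteq> D \<longrightarrow> D = C)"
proof -
  have "\<exists>M\<in>Collect inf_intersections. \<forall>X\<in>Collect inf_intersections. M \<subseteq> X \<longrightarrow> X = (M :: 'a set set)"
  proof (rule subset_Zorn_nonempty)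
    show "Collect inf_intersections \<noteq> ({} :: 'a set set set)"
      using assms by (auto simp: inf_intersections_def intro!: exI[of _ "{}"])
    fix \<C> :: "'a set set set" assume C: "\<C> \<noteq> {}" "subset.chain (Collect inf_intersections) \<C>"
    have "infinite (\<Inter>F)" if F: "finite F" "F \<subseteq> \<Union>\<C>" for F
    proof -
      obtain D where "D \<in> \<C>" "F \<subseteq> D"
        using finite_subset_Union_chain[OF F C] by metis
      with C F show ?thesis
        by (auto simp: subset.chain_def inf_intersections_def)
    qed
    then show "\<Union>\<C> \<in> Collect inf_intersections" by (auto simp: inf_intersections_def)
  qed
  then show ?thesis by auto
qed

definition ultra :: "nat set set" where
  "ultra = (SOME C. inf_intersections C \<and> (\<forall>D. inf_intersections D \<longrightarrow> C \<subseteq> D \<longrightarrow> D = C))"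

lemma ultra_inf_intersections: "finite F \<Longrightarrow> F \<subseteq> ultra \<Longrightarrow> infinite (\<Inter>F)"
  and ultra_maximal: "inf_intersections D \<Longrightarrow> ultra \<subseteq> D \<Longrightarrow> D = ultra"
  using someI_ex[OF ex_maximal_inf_intersections[OF infinite_UNIV_nat]]
  unfolding ultra_def[symmetric] by (auto simp: inf_intersections_def)

lemma ultra_infinite: "X \<in> ultra \<Longrightarrow> infinite X"
  using ultra_inf_intersections[of "{X}"] by simp

text \<open>If neither set could be added, finitely many members would meet X in a finite set and
  finitely many would meet its complement in a finite set; all of them together would have a finite
  intersection.\<close>

lemma ultra_cases: "X \<in> ultra \<or> - X \<in> ultra"
proof (rule ccontr)
  assume "\<not> ?thesis"
  have *: "\<exists>F. finite F \<and> F \<subseteq> ultra \<and> finite (\<Inter>F \<inter> X)" if "X \<notin> ultra" for X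
  proof -
    have "\<not> inf_intersections (insert X ultra)"
      using ultra_maximal[of "insert X ultra"] that by auto
    then obtain F where F: "finite F" "F \<subseteq> insert X ultra" "finite (\<Inter>F)"
      by (auto simp: inf_intersections_def)
    then have "finite (\<Inter>(F - {X}) \<inter> X)"
      by (elim finite_subset[rotated]) auto
    with F show ?thesis by (intro exI[of _ "F - {X}"]) auto
  qed
  obtain F G where F: "finite F" "F \<subseteq> ultra" "finite (\<Inter>F \<inter> X)"
    and G: "finite G" "G \<subseteq> ultra" "finite (\<Inter>G \<inter> - X)"
    using *[of X] *[of "- X"] \<open>\<not> _\<close> by auto
  have "finite (\<Inter>(F \<union> G))"
    by (rule finite_subset[OF _ finite_UnI[OF F(3) G(3)]]) auto
  with ultra_inf_intersections[of "F \<union> G"] F G show False by auto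
qed

lemma ultra_superset:
  assumes "X \<in> ultra" "Y \<in> ultra" "X \<inter> Y \<subseteq> Z"
  shows "Z \<in> ultra"
proof (rule ccontr)
  assume "Z \<notin> ultra"
  with assms ultra_cases[of Z] have "infinite (\<Inter>{X, Y, - Z})"
    by (intro ultra_inf_intersections) auto
  moreover have "\<Inter>{X, Y, - Z} = {}" using assms(3) by auto
  ultimately show False by simp
qed

lemma UNIV_ultra: "UNIV \<in> ultra"
  using ultra_cases[of "{}"] ultra_infinite[of "{}"] by auto

definition ultra_eq :: "(nat \<Rightarrow> 'a) \<Rightarrow> (nat \<Rightarrow> 'a) \<Rightarrow> bool" where
  "ultra_eq f g \<longleftrightarrow> {n. f n = g n} \<in> ultra"

lemma ultra_eq_cong:
  assumes "ultra_eq f f'" "ultra_eq g g'" "\<And>n. f n = f' n \<Longrightarrow> g n = g' n \<Longrightarrow> h n = h' n"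
  shows "ultra_eq h h'"
  using ultra_superset[OF assms(1,2)[unfolded ultra_eq_def], of "{n. h n = h' n}"] assms(3)
  by (auto simp: ultra_eq_def)

lemma ultra_eq_refl: "(\<And>n. f n = g n) \<Longrightarrow> ultra_eq f g"
  using UNIV_ultra by (simp add: ultra_eq_def)

quotient_type 'a ultrapower = "nat \<Rightarrow> 'a" / ultra_eq
proof (intro equivpI reflpI sympI transpI)
  fix f g h :: "nat \<Rightarrow> 'a"
  show "ultra_eq f f" by (rule ultra_eq_refl) simp
  show "ultra_eq g f" if "ultra_eq f g" using that that by (rule ultra_eq_cong) simp
  show "ultra_eq f h" if "ultra_eq f g" "ultra_eq g h" using that by (rule ultra_eq_cong) simp
qed

instantiation ultrapower :: (idom) idom
begin

lift_definition zero_ultrapower :: "'a ultrapower" is "\<lambda>_. 0" .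
lift_definition one_ultrapower :: "'a ultrapower" is "\<lambda>_. 1" .
lift_definition plus_ultrapower :: "'a ultrapower \<Rightarrow> 'a ultrapower \<Rightarrow> 'a ultrapower"
  is "\<lambda>f g n. f n + g n" by (erule ultra_eq_cong, assumption, simp)
lift_definition minus_ultrapower :: "'a ultrapower \<Rightarrow> 'a ultrapower \<Rightarrow> 'a ultrapower"
  is "\<lambda>f g n. f n - g n" by (erule ultra_eq_cong, assumption, simp)
lift_definition uminus_ultrapower :: "'a ultrapower \<Rightarrow> 'a ultrapower"
  is "\<lambda>f n. - f n" by (rule ultra_eq_cong, assumption, assumption, simp)
lift_definition times_ultrapower :: "'a ultrapower \<Rightarrow> 'a ultrapower \<Rightarrow> 'a ultrapower"
  is "\<lambda>f g n. f n * g n" by (erule ultra_eq_cong, assumption, simp)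

instance
proof
  fix a b :: "'a ultrapower"
  show "(0 :: 'a ultrapower) \<noteq> 1"
    by transfer (use ultra_infinite[of "{}"] in \<open>auto simp: ultra_eq_def\<close>)
  assume "a \<noteq> 0" "b \<noteq> 0"
  then show "a * b \<noteq> 0"
  proof transfer
    fix f g :: "nat \<Rightarrow> 'a"
    assume "\<not> ultra_eq f (\<lambda>_. 0)" "\<not> ultra_eq g (\<lambda>_. 0)"
    \<comment> \<open>The complements of both zero sets lie in the ultrafilter, hence so does their
      intersection, on which the product is nonzero.\<close>
    then have "- {n. f n = 0} \<in> ultra" "- {n. g n = 0} \<in> ultra"
      using ultra_cases by (auto simp: ultra_eq_def)
    then have "- {n. f n * g n = 0} \<in> ultra" by (rule ultra_superset) auto
    then show "\<not> ultra_eq (\<lambda>n. f n * g n) (\<lambda>_. 0)"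
      using ultra_superset[of "{n. f n * g n = 0}" "- {n. f n * g n = 0}" "{}"]
        ultra_infinite[of "{}"] by (auto simp: ultra_eq_def)
  qed
qed (transfer, rule ultra_eq_refl, simp add: algebra_simps)+

end

lift_definition ultra_class :: "(nat \<Rightarrow> 'a) \<Rightarrow> 'a ultrapower" is "\<lambda>f. f" .

lemma ultra_class_simps:
  "ultra_class (\<lambda>_. 0) = 0" "ultra_class (\<lambda>_. 1) = 1"
  "ultra_class (\<lambda>n. f n + g n) = ultra_class f + ultra_class g"
  "ultra_class (\<lambda>n. f n * g n) = ultra_class f * ultra_class g"
  by (transfer; rule ultra_eq_refl; simp)+

text \<open>This is where nonprincipality is felt: a nonzero polynomial has finitely many roots, so
  an injective sequence cannot satisfy it in the ultrapower.\<close>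

lemma ultra_class_eq_0: "ultra_class f = 0 \<Longrightarrow> infinite {n. f n = 0}"
  by transfer (auto simp: ultra_eq_def dest: ultra_infinite)

instance ultrapower :: ("{idom,ring_char_0}") ring_char_0
proof
  have *: "of_nat m = ultra_class (\<lambda>_. of_nat m :: 'a)" for m
    by (induction m) (simp_all add: ultra_class_simps)
  show "inj (of_nat :: nat \<Rightarrow> 'a ultrapower)"
  proof (rule injI)
    fix m n assume "of_nat m = (of_nat n :: 'a ultrapower)"
    then have "ultra_eq (\<lambda>_. of_nat m :: 'a) (\<lambda>_. of_nat n)"
      unfolding * by transfer
    then have "{_ :: nat. (of_nat m :: 'a) = of_nat n} \<noteq> {}"
      unfolding ultra_eq_def using ultra_infinite by force
    then show "m = n" by (simp split: if_splits)
  qed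
qed

lemma poly_ultra_class:
  "poly (map_poly (\<lambda>c. ultra_class (\<lambda>_. c)) p) (ultra_class f) = ultra_class (\<lambda>n. poly p (f n))"
proof (induction p)
  case (pCons a p)
  then show ?case
    by (simp add: map_poly_pCons ultra_class_simps)
qed (simp add: ultra_class_simps)

lemma (in lie_algebra) bracket_simps:
  "bracket (x + y) z = bracket x z + bracket y z" "bracket x (y + z) = bracket x y + bracket x z"
  "bracket (scale c x) y = scale c (bracket x y)" "bracket x (scale c y) = scale c (bracket x y)"
  "bracket (- x) y = - bracket x y" "bracket x (- y) = - bracket x y"
  "bracket 0 x = 0" "bracket x 0 = 0"
proof -
  interpret l: Vector_Spaces.linear scale scale "\<lambda>x. bracket x y" for y by (rule bracket_linear_left)
  interpret r: Vector_Spaces.linear scale scale "\<lambda>y. bracket x y" for x by (rule bracket_linear_right)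
  show "bracket (x + y) z = bracket x z + bracket y z" "bracket x (y + z) = bracket x y + bracket x z"
    "bracket (scale c x) y = scale c (bracket x y)" "bracket x (scale c y) = scale c (bracket x y)"
    "bracket (- x) y = - bracket x y" "bracket x (- y) = - bracket x y"
    "bracket 0 x = 0" "bracket x 0 = 0"
    by (simp_all add: l.add r.add l.scale r.scale l.neg r.neg)
qed

section \<open>Regular functions and invariant derivations\<close>

lemma gen_algebra_sum:
  "(\<And>i. i \<in> I \<Longrightarrow> f i \<in> gen_algebra S) \<Longrightarrow> (\<lambda>x. \<Sum>i\<in>I. f i x) \<in> gen_algebra S"
  by (induction I rule: infinite_finite_induct) (auto intro: gen_algebra.intros)

text \<open>Sums of pure tensors contain the constants and both factors and are closed under sums
  and products. As lists, sums are concatenations and no indices have to be renumbered.\<close>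

lemma product_algebra_list:
  assumes "F \<in> product_algebra (gen_algebra S) (gen_algebra T)"
  shows "\<exists>ps. set ps \<subseteq> gen_algebra S \<times> gen_algebra T \<and>
    (\<forall>x y. F (x, y) = (\<Sum>(a, b)\<leftarrow>ps. a x * b y))"
  using assms unfolding product_algebra_def
proof induction
  case (const c)
  show ?case
    by (rule exI[of _ "[(\<lambda>_. c, \<lambda>_. 1)]"]) (auto intro: gen_algebra.const)
next
  case (gen F)
  then consider f where "f \<in> gen_algebra S" "F = (\<lambda>(x, y). f x)"
    | g where "g \<in> gen_algebra T" "F = (\<lambda>(x, y). g y)" by blast
  then show ?case
  proof cases
    case 1
    then show ?thesis by (intro exI[of _ "[(f, \<lambda>_. 1)]"]) (auto intro: gen_algebra.const)
  next
    case 2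
    then show ?thesis by (intro exI[of _ "[(\<lambda>_. 1, g)]"]) (auto intro: gen_algebra.const)
  qed
next
  case (add F G)
  then obtain ps qs where "set ps \<subseteq> gen_algebra S \<times> gen_algebra T"
    "\<forall>x y. F (x, y) = (\<Sum>(a, b)\<leftarrow>ps. a x * b y)" "set qs \<subseteq> gen_algebra S \<times> gen_algebra T"
    "\<forall>x y. G (x, y) = (\<Sum>(a, b)\<leftarrow>qs. a x * b y)" by blast
  then show ?case by (intro exI[of _ "ps @ qs"]) auto
next
  case (mult F G)
  then obtain ps qs where *: "set ps \<subseteq> gen_algebra S \<times> gen_algebra T"
    "\<forall>x y. F (x, y) = (\<Sum>(a, b)\<leftarrow>ps. a x * b y)" "set qs \<subseteq> gen_algebra S \<times> gen_algebra T"
    "\<forall>x y. G (x, y) = (\<Sum>(a, b)\<leftarrow>qs. a x * b y)" by blast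
  define rs where "rs = concat (map (\<lambda>(a, b). map (\<lambda>(a', b').
    (\<lambda>x. a x * a' x, \<lambda>y. b y * b' y)) qs) ps)"
  have "(\<Sum>(a, b)\<leftarrow>rs. a x * b y) = (\<Sum>(a, b)\<leftarrow>ps. a x * b y) * (\<Sum>(a, b)\<leftarrow>qs. a x * b y)" for x y
    unfolding rs_def
    by (induction ps) (auto simp: algebra_simps sum_list_mult_const[symmetric]
        sum_list_const_mult[symmetric] case_prod_unfold o_def intro!: arg_cong[of _ _ sum_list])
  moreover have "set rs \<subseteq> gen_algebra S \<times> gen_algebra T"
    using *(1,3) by (auto simp: rs_def intro!: gen_algebra.mult)
  ultimately show ?case using * by (intro exI[of _ rs]) auto
qed

lemma product_algebraE:
  assumes "F \<in> product_algebra (gen_algebra S) (gen_algebra T)"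
  obtains n :: nat and a b where
    "\<And>i. i < n \<Longrightarrow> a i \<in> gen_algebra S" "\<And>i. i < n \<Longrightarrow> b i \<in> gen_algebra T"
    "\<And>x y. F (x, y) = (\<Sum>i<n. a i x * b i y)"
proof -
  obtain ps where ps: "set ps \<subseteq> gen_algebra S \<times> gen_algebra T"
    "\<And>x y. F (x, y) = (\<Sum>(a, b)\<leftarrow>ps. a x * b y)"
    using product_algebra_list[OF assms] by blast
  show ?thesis
  proof (rule that)
    fix i assume "i < length ps"
    then have "ps ! i \<in> gen_algebra S \<times> gen_algebra T" using ps(1) nth_mem by blast
    then show "fst (ps ! i) \<in> gen_algebra S" "snd (ps ! i) \<in> gen_algebra T" by auto
  next
    show "F (x, y) = (\<Sum>i<length ps. fst (ps ! i) x * snd (ps ! i) y)" for x y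
      unfolding ps(2) by (simp add: sum_list_sum_nth case_prod_unfold atLeast0LessThan)
  qed
qed

text \<open>A tangent vector at x. Homogeneity follows from the Leibniz rule with a constant
  factor.\<close>

definition point_derivation :: "('a \<Rightarrow> 'k::comm_ring_1) set \<Rightarrow> 'a \<Rightarrow> (('a \<Rightarrow> 'k) \<Rightarrow> 'k) \<Rightarrow> bool" where
  "point_derivation A x \<delta> \<longleftrightarrow> (\<forall>c. \<delta> (\<lambda>_. c) = 0) \<and>
     (\<forall>f\<in>A. \<forall>g\<in>A. \<delta> (\<lambda>y. f y + g y) = \<delta> f + \<delta> g \<and> \<delta> (\<lambda>y. f y * g y) = f x * \<delta> g + \<delta> f * g x)"

text \<open>Composed with a homomorphism to the dual numbers, \<theta> splits into a character,
  which is a point x by the definition of a variety, and an infinitesimal part, which is a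
  derivation at x. On functions that \<theta> sends to multiples of \<chi>, both are read off from c
  + \<epsilon>.\<close>

lemma variety_dual_points:
  fixes A :: "('a \<Rightarrow> 'k::field_char_0) set" and \<theta> :: "('a \<Rightarrow> 'k) \<Rightarrow> 'r::{idom,ring_char_0}"
  assumes alg_closed: "\<And>p :: 'k poly. degree p > 0 \<Longrightarrow> \<exists>x. poly p x = 0"
    and variety: "affine_variety A"
    and \<iota>: "ring_hom_on UNIV \<iota>"
    and transcendental: "\<And>p. poly (map_poly \<iota> p) \<chi> = 0 \<Longrightarrow> p = 0"
    and theta_const: "\<And>c. \<theta> (\<lambda>_. c) = \<iota> c"
    and theta_add: "\<And>f g. f \<in> A \<Longrightarrow> g \<in> A \<Longrightarrow> \<theta> (\<lambda>x. f x + g x) = \<theta> f + \<theta> g"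
    and theta_mult: "\<And>f g. f \<in> A \<Longrightarrow> g \<in> A \<Longrightarrow> \<theta> (\<lambda>x. f x * g x) = \<theta> f * \<theta> g"
  obtains F where "finite F"
    "\<And>c. c \<notin> F \<Longrightarrow> \<exists>x \<delta>. point_derivation A x \<delta> \<and>
      (\<forall>f\<in>A. \<forall>a. \<theta> f = \<iota> a * \<chi> \<longrightarrow> f x = a * c \<and> \<delta> f = a)"
proof -
  obtain S where S: "finite S" "A = gen_algebra S"
    using variety unfolding affine_variety_def by blast
  have points: "\<exists>x. \<forall>f\<in>A. ev f = f x" if "algebra_character A ev" for ev
    using variety that unfolding affine_variety_def by blast
  obtain R F where R: "is_subring R" "range \<iota> \<subseteq> R" "\<chi> \<in> R" "\<theta> ` S \<subseteq> R" "finite F"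
    "\<And>c. c \<notin> F \<Longrightarrow> \<exists>\<psi>. ring_hom_on R \<psi> \<and> (\<forall>a. \<psi> (\<iota> a) = Dual a 0) \<and> \<psi> \<chi> = Dual c 1"
    by (rule finitely_generated_dual_points[OF alg_closed \<iota> transcendental, where X = "\<theta> ` S"])
      (use S(1) in auto)
  interpret subring_of R by standard (rule R)
  have \<theta>R: "\<theta> f \<in> R" if "f \<in> A" for f
    using that unfolding S(2)
  proof induction
    case (gen f)
    then show ?case using R(4) by auto
  next
    case (const c)
    then show ?case using R(2) theta_const by auto
  qed (use theta_add theta_mult S in auto)
  show ?thesis
  proof (rule that[OF R(5)])
    fix c assume "c \<notin> F"
    then obtain \<psi> where \<psi>: "ring_hom_on R \<psi>" "\<And>a. \<psi> (\<iota> a) = Dual a 0" "\<psi> \<chi> = Dual c 1"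
      using R(6) by blast
    interpret subring_hom R \<psi> by standard (rule \<psi>)
    have "algebra_character A (\<lambda>f. dreal (\<psi> (\<theta> f)))"
      unfolding algebra_character_def using \<theta>R by (auto simp: theta_const theta_add theta_mult \<psi>)
    then obtain x where x: "\<And>f. f \<in> A \<Longrightarrow> dreal (\<psi> (\<theta> f)) = f x"
      using points by blast
    have "point_derivation A x (\<lambda>f. deps (\<psi> (\<theta> f)))"
      unfolding point_derivation_def using \<theta>R x by (auto simp: theta_const theta_add theta_mult \<psi>)
    moreover have "f x = a * c \<and> deps (\<psi> (\<theta> f)) = a" if "f \<in> A" "\<theta> f = \<iota> a * \<chi>" for f a
    proof -
      have "\<psi> (\<theta> f) = Dual a 0 * Dual c 1"
        using that(2) hom_simps(4)[OF subsetD[OF R(2) rangeI] R(3)] by (simp only: \<psi>)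
      then show ?thesis using x[OF that(1)] by simp
    qed
    ultimately show "\<exists>x \<delta>. point_derivation A x \<delta> \<and>
      (\<forall>f\<in>A. \<forall>a. \<theta> f = \<iota> a * \<chi> \<longrightarrow> f x = a * c \<and> \<delta> f = a)" by blast
  qed
qed

section \<open>Comultiplication and left-invariant derivations\<close>

context affine_algebraic_group
begin

lemma A_gen: obtains S where "finite S" "A = gen_algebra S"
  using variety unfolding affine_variety_def by blast

lemma A_const [simp, intro]: "(\<lambda>_. c) \<in> A"
  by (metis A_gen gen_algebra.const)

lemma A_add [simp, intro]: "f \<in> A \<Longrightarrow> g \<in> A \<Longrightarrow> (\<lambda>x. f x + g x) \<in> A"
  by (metis A_gen gen_algebra.add)

lemma A_mult [simp, intro]: "f \<in> A \<Longrightarrow> g \<in> A \<Longrightarrow> (\<lambda>x. f x * g x) \<in> A"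
  by (metis A_gen gen_algebra.mult)

lemma A_sum [simp, intro]: "(\<And>i. i \<in> I \<Longrightarrow> f i \<in> A) \<Longrightarrow> (\<lambda>x. \<Sum>i\<in>I. f i x) \<in> A"
  by (metis A_gen gen_algebra_sum)

lemma comultE:
  assumes "f \<in> A"
  obtains n :: nat and a b where "\<And>i. i < n \<Longrightarrow> a i \<in> A" "\<And>i. i < n \<Longrightarrow> b i \<in> A"
    "\<And>x y. f (mult x y) = (\<Sum>i<n. a i x * b i y)"
proof -
  obtain S where S: "A = gen_algebra S" using A_gen by blast
  obtain n :: nat and a b where "\<And>i. i < n \<Longrightarrow> a i \<in> A" "\<And>i. i < n \<Longrightarrow> b i \<in> A"
    "\<And>x y. (case (x, y) of (x, y) \<Rightarrow> f (mult x y)) = (\<Sum>i<n. a i x * b i y)"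
    using product_algebraE[OF mult_regular[OF assms, unfolded S]] unfolding S by blast
  then show ?thesis by (intro that) auto
qed

lemma comult_divE:
  assumes "f \<in> A"
  obtains n :: nat and a b where "\<And>i. i < n \<Longrightarrow> a i \<in> A" "\<And>i. i < n \<Longrightarrow> b i \<in> A"
    "\<And>x y. f (mult x (ginv y)) = (\<Sum>i<n. a i x * b i y)"
proof -
  obtain n :: nat and a b where "\<And>i. i < n \<Longrightarrow> a i \<in> A" "\<And>i. i < n \<Longrightarrow> b i \<in> A"
    "\<And>x y. f (mult x y) = (\<Sum>i<n. a i x * b i y)" using comultE[OF assms] by metis
  then show ?thesis
    by (intro that[of n a "\<lambda>i y. b i (ginv y)"]) (auto intro: ginv_regular)
qed

lemma A_translate [simp, intro]:
  assumes "f \<in> A"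
  shows "(\<lambda>x. f (mult g x)) \<in> A" "(\<lambda>x. f (mult x g)) \<in> A"
proof -
  obtain n :: nat and a b where "\<And>i. i < n \<Longrightarrow> a i \<in> A" "\<And>i. i < n \<Longrightarrow> b i \<in> A"
    "\<And>x y. f (mult x y) = (\<Sum>i<n. a i x * b i y)" using comultE[OF assms] by metis
  then show "(\<lambda>x. f (mult g x)) \<in> A" "(\<lambda>x. f (mult x g)) \<in> A"
    by (auto intro!: A_sum)
qed

lemma A_translate_twice [simp, intro]: "f \<in> A \<Longrightarrow> (\<lambda>x. f (mult g (mult h x))) \<in> A"
  using A_translate(1)[of f "mult g h"] by (simp add: assoc)

lemma left_invariant_derivationD:
  assumes D: "D \<in> left_invariant_derivations" and "f \<in> A"
  shows "D f \<in> A" "h \<in> A \<Longrightarrow> D (\<lambda>x. f x + h x) = (\<lambda>x. D f x + D h x)"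
    "D (\<lambda>x. c * f x) = (\<lambda>x. c * D f x)"
    "h \<in> A \<Longrightarrow> D (\<lambda>x. f x * h x) = (\<lambda>x. D f x * h x + f x * D h x)"
    "D (\<lambda>x. f (mult g x)) = (\<lambda>x. D f (mult g x))"
  using assms unfolding left_invariant_derivations_def by auto

lemma derivation_const:
  assumes D: "D \<in> left_invariant_derivations"
  shows "D (\<lambda>_. c) = (\<lambda>_. 0)"
proof -
  have "D (\<lambda>x. 1 * 1) = (\<lambda>x. D (\<lambda>_. 1) x * 1 + 1 * D (\<lambda>_. 1) x)"
    using left_invariant_derivationD(4)[OF D A_const A_const, of 1 1] .
  then have "D (\<lambda>_. 1) x = 0" for x by (auto dest: fun_cong[of _ _ x])
  then show ?thesis
    using left_invariant_derivationD(3)[OF D A_const, of c 1] by auto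
qed

lemma derivation_sum:
  assumes D: "D \<in> left_invariant_derivations" and "\<And>i. i < (n::nat) \<Longrightarrow> f i \<in> A"
  shows "D (\<lambda>x. \<Sum>i<n. f i x) = (\<lambda>x. \<Sum>i<n. D (f i) x)"
  using assms(2)
proof (induction n)
  case (Suc n)
  then have "(\<lambda>x. \<Sum>i<n. f i x) \<in> A" by (auto intro!: A_sum)
  with Suc show ?case by (simp add: left_invariant_derivationD(2)[OF D])
qed (simp add: derivation_const[OF D])

lemma derivation_at:
  assumes "D \<in> left_invariant_derivations" "f \<in> A"
  shows "D f g = D (\<lambda>x. f (mult g x)) one"
  using left_invariant_derivationD(5)[OF assms, of g] by simp

text \<open>The differential of inversion at the identity is -1. Split F(u v) by comultiplication,
  put v = \<open>ginv u\<close>, and differentiate the resulting constant function.\<close>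

lemma derivation_inverse:
  assumes D: "D \<in> left_invariant_derivations" and F: "F \<in> A"
  shows "D F one + D (\<lambda>u. F (ginv u)) one = 0"
proof -
  note [simp] = derivation_sum[OF D] left_invariant_derivationD(3,4)[OF D]
  obtain n :: nat and p q where pq: "\<And>i. i < n \<Longrightarrow> p i \<in> A" "\<And>i. i < n \<Longrightarrow> q i \<in> A"
    "\<And>u v. F (mult u v) = (\<Sum>i<n. p i u * q i v)" using comultE[OF F] by metis
  define q' where "q' i u = q i (ginv u)" for i u
  have q': "q' i \<in> A" if "i < n" for i
    using ginv_regular[OF pq(2)[OF that]] by (simp add: q'_def[abs_def])
  have "(\<lambda>u. F (mult u one)) = (\<lambda>u. \<Sum>i<n. q i one * p i u)"
    by (simp only: pq(3) mult.commute)
  then have 1: "D F one = (\<Sum>i<n. q i one * D (p i) one)"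
    using pq by simp
  have "(\<lambda>u. F (mult one (ginv u))) = (\<lambda>u. \<Sum>i<n. p i one * q' i u)"
    by (simp only: pq(3) q'_def)
  then have 2: "D (\<lambda>u. F (ginv u)) one = (\<Sum>i<n. p i one * D (q' i) one)"
    using pq q' by simp
  have "(\<lambda>u. F (mult u (ginv u))) = (\<lambda>u. \<Sum>i<n. p i u * q' i u)"
    by (simp only: pq(3) q'_def)
  then have "D (\<lambda>_. F one) = (\<lambda>u. \<Sum>i<n. D (p i) u * q' i u + p i u * D (q' i) u)"
    using pq q' by simp
  then have "(\<Sum>i<n. D (p i) one * q' i one + p i one * D (q' i) one) = 0"
    unfolding derivation_const[OF D] by (metis (mono_tags, lifting))
  then show ?thesis
    using 1 2 by (simp add: q'_def sum.distrib mult.commute)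
qed

text \<open>The element \<open>mult x (ginv y)\<close> does not change when x and y are multiplied
  on the right by the same u; the identity is the derivative of this invariance. F carries the
  dependence on u through x, and F after inversion the dependence through y.\<close>

lemma derivation_div:
  assumes D: "D \<in> left_invariant_derivations" and f: "f \<in> A"
    and ab: "\<And>i. i < (n::nat) \<Longrightarrow> a i \<in> A" "\<And>i. i < n \<Longrightarrow> b i \<in> A"
    "\<And>x y. f (mult x (ginv y)) = (\<Sum>i<n. a i x * b i y)"
  shows "(\<Sum>i<n. D (a i) x * b i y + a i x * D (b i) y) = 0"
proof -
  note [simp] = derivation_sum[OF D] left_invariant_derivationD(3,4)[OF D]
  define F where "F u = f (mult (mult x u) (ginv y))" for u
  have F: "F \<in> A" unfolding F_def using A_translate[OF A_translate(2)[OF f, of "ginv y"]] by simp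
  have "F = (\<lambda>u. \<Sum>i<n. b i y * a i (mult x u))"
    by (simp add: F_def ab(3) mult.commute fun_eq_iff)
  then have 1: "D F one = (\<Sum>i<n. b i y * D (a i) x)"
    using ab by (simp add: derivation_at[OF D, of _ x])
  have "F (ginv u) = f (mult x (ginv (mult y u)))" for u
    by (simp add: F_def inverse_distrib_swap assoc)
  then have "(\<lambda>u. F (ginv u)) = (\<lambda>u. \<Sum>i<n. a i x * b i (mult y u))"
    by (simp add: ab(3))
  then have "D (\<lambda>u. F (ginv u)) one = (\<Sum>i<n. a i x * D (b i) y)"
    using ab by (simp add: derivation_at[OF D, of _ y])
  with 1 derivation_inverse[OF D F] show ?thesis
    by (simp add: sum.distrib mult.commute)
qed

lemma Ad_derivation_mem:
  assumes D: "D \<in> left_invariant_derivations"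
  shows "Ad_derivation g D \<in> left_invariant_derivations"
proof -
  note [simp] = left_invariant_derivationD[OF D]
  have inv: "D (\<lambda>x. f (mult (mult h x) (ginv g))) = (\<lambda>x. D (\<lambda>y. f (mult y (ginv g))) (mult h x))"
    if "f \<in> A" for f h
    using left_invariant_derivationD(5)[OF D A_translate(2)[OF that, of "ginv g"], of h] .
  have cancel: "mult (mult x g) (ginv g) = x" for x by (simp add: assoc)
  show ?thesis
    unfolding left_invariant_derivations_def Ad_derivation_def
    by (auto simp: inv cancel assoc[symmetric] simp del: right_inverse)
qed

text \<open>Left translations spread the tangent vector over the group. Comultiplication separates
  the translated point from the variable that \<delta> differentiates, which makes
  \<open>D f\<close> regular.\<close>

lemma point_derivation_extends:
  assumes \<delta>: "point_derivation A h \<delta>"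
  obtains D where "D \<in> left_invariant_derivations" "\<And>f. f \<in> A \<Longrightarrow> D f h = \<delta> f"
proof -
  define D where "D = (\<lambda>f\<in>A. \<lambda>x. \<delta> (\<lambda>u. f (mult (mult x (ginv h)) u)))"
  have \<delta>_simps: "\<delta> (\<lambda>_. c) = 0" "f \<in> A \<Longrightarrow> g \<in> A \<Longrightarrow> \<delta> (\<lambda>y. f y + g y) = \<delta> f + \<delta> g"
    "f \<in> A \<Longrightarrow> g \<in> A \<Longrightarrow> \<delta> (\<lambda>y. f y * g y) = f h * \<delta> g + \<delta> f * g h" for c f g
    using \<delta> unfolding point_derivation_def by auto
  have \<delta>_scale: "\<delta> (\<lambda>y. c * f y) = c * \<delta> f" if "f \<in> A" for c f
    using \<delta>_simps(3)[OF A_const that, of c] by (simp add: \<delta>_simps)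
  have \<delta>_sum: "\<delta> (\<lambda>y. \<Sum>i<n. f i y) = (\<Sum>i<n. \<delta> (f i))" if "\<And>i. i < n \<Longrightarrow> f i \<in> A"
    for n :: nat and f
    using that
  proof (induction n)
    case (Suc n)
    then have "(\<lambda>x. \<Sum>i<n. f i x) \<in> A" by (auto intro!: A_sum)
    with Suc show ?case by (simp add: \<delta>_simps)
  qed (simp add: \<delta>_simps)
  have "D \<in> left_invariant_derivations"
    unfolding left_invariant_derivations_def
  proof (intro CollectI conjI ballI allI)
    show "D \<in> A \<rightarrow>\<^sub>E A"
    proof
      fix f assume f: "f \<in> A"
      obtain n :: nat and a b where ab: "\<And>i. i < n \<Longrightarrow> a i \<in> A" "\<And>i. i < n \<Longrightarrow> b i \<in> A"
        "\<And>x y. f (mult x y) = (\<Sum>i<n. a i x * b i y)" using comultE[OF f] by metis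
      have "D f = (\<lambda>x. \<Sum>i<n. a i (mult x (ginv h)) * \<delta> (b i))"
        using f ab by (simp add: D_def \<delta>_sum \<delta>_scale)
      then show "D f \<in> A" using ab by (auto intro!: A_sum A_mult)
    qed (auto simp: D_def)
  qed (auto simp: D_def \<delta>_simps \<delta>_scale assoc mult.commute add.commute)
  moreover have "D f h = \<delta> f" if "f \<in> A" for f using that by (simp add: D_def)
  ultimately show ?thesis using that by blast
qed

end


section \<open>Coadjoint orbits\<close>

context lie_algebra_of_group
begin

lemma phi_mem [simp]: "\<phi> \<xi> \<in> left_invariant_derivations"
  using bij by (auto simp: bij_betw_def)

lemma phi_closed [simp, intro]: "f \<in> A \<Longrightarrow> \<phi> \<xi> f \<in> A"
  by (rule left_invariant_derivationD(1)[OF phi_mem])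

lemma phi_eqI:
  assumes "\<And>f. f \<in> A \<Longrightarrow> \<phi> \<xi> f = \<phi> \<eta> f"
  shows "\<xi> = \<eta>"
proof -
  have "\<phi> \<xi> = \<phi> \<eta>"
    by (rule extensionalityI[of _ A])
      (use phi_mem assms in \<open>auto simp: left_invariant_derivations_def PiE_def\<close>)
  then show ?thesis using bij by (auto simp: bij_betw_def inj_on_def)
qed

lemma phi_Ad: "\<phi> (Ad g \<xi>) = Ad_derivation g (\<phi> \<xi>)"
  unfolding Ad_def
  by (rule bij_betw_inv_into_right[OF bij Ad_derivation_mem[OF phi_mem]])

lemma phi_Ad_apply: "f \<in> A \<Longrightarrow> \<phi> (Ad g \<xi>) f x = \<phi> \<xi> (\<lambda>y. f (mult y (ginv g))) (mult x g)"
  by (simp add: phi_Ad Ad_derivation_def)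

lemma Ad_one [simp]: "Ad one \<xi> = \<xi>"
  by (rule phi_eqI) (simp add: phi_Ad_apply fun_eq_iff)

lemma Ad_mult: "Ad (mult g h) \<xi> = Ad g (Ad h \<xi>)"
  by (rule phi_eqI) (simp add: phi_Ad_apply fun_eq_iff inverse_distrib_swap assoc)

lemma coadjoint_orbit_eq: "coadjoint_orbit \<alpha> = {\<lambda>\<xi>. \<alpha> (Ad h \<xi>) | h. True}"
proof -
  have "(\<lambda>\<xi>. \<alpha> (Ad h \<xi>)) \<in> coadjoint_orbit \<alpha>" for h
    unfolding coadjoint_orbit_def by (rule image_eqI[of _ _ "ginv h"]) auto
  then show ?thesis unfolding coadjoint_orbit_def by auto
qed

lemma conical_orbit_iff:
  "conical_orbit \<alpha> \<longleftrightarrow> (\<forall>c. c \<noteq> 0 \<longrightarrow> (\<exists>h. \<forall>\<xi>. \<alpha> (Ad h \<xi>) = c * \<alpha> \<xi>))"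
  unfolding conical_orbit_def coadjoint_orbit_eq by (auto simp: fun_eq_iff eq_commute)

lemma conical_orbit_translate:
  assumes "conical_orbit \<alpha>"
  shows "conical_orbit (\<lambda>\<xi>. \<alpha> (Ad g \<xi>))"
  unfolding conical_orbit_iff
proof (intro allI impI)
  fix c :: 'k assume "c \<noteq> 0"
  then obtain h where h: "\<And>\<xi>. \<alpha> (Ad h \<xi>) = c * \<alpha> \<xi>"
    using assms unfolding conical_orbit_iff by blast
  \<comment> \<open>The conjugate of h scales the translated functional by the same factor.\<close>
  have "\<alpha> (Ad g (Ad (mult (ginv g) (mult h g)) \<xi>)) = c * \<alpha> (Ad g \<xi>)" for \<xi>
    by (simp flip: Ad_mult assoc) (simp add: Ad_mult h)
  then show "\<exists>h. \<forall>\<xi>. \<alpha> (Ad g (Ad h \<xi>)) = c * \<alpha> (Ad g \<xi>)" by blast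
qed

lemma phi_one_functional:
  assumes "f \<in> A"
  shows "Vector_Spaces.linear scale (*) (\<lambda>\<xi>. \<phi> \<xi> f one)"
  unfolding linear_functional_iff using assms by (simp add: add scale)

text \<open>A left-invariant derivation is determined by its values at the identity, so the
  functionals \<open>\<lambda>\<xi>. \<phi> \<xi> f one\<close> vanish together only at 0 and, in
  finite dimension, exhaust the dual. Functionals can then be handled as differentials of regular
  functions.\<close>

lemma dual_eq_tangent:
  assumes fin: "finite B" "span B = UNIV" and "\<alpha> \<in> dual"
  obtains f where "f \<in> A" "\<And>\<xi>. \<alpha> \<xi> = \<phi> \<xi> f one"
proof -
  define E where "E = (\<lambda>f \<xi>. \<phi> \<xi> f one) ` A"
  have zero: "\<xi> = 0" if "\<And>e. e \<in> E \<Longrightarrow> e \<xi> = 0" for \<xi>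
  proof (rule phi_eqI)
    fix f assume f: "f \<in> A"
    have "\<phi> \<xi> f g = 0" for g
      using that f unfolding E_def by (subst derivation_at[OF phi_mem]) auto
    moreover have "\<phi> 0 f g = 0" for g
      using scale[OF f, of 0 0] by simp
    ultimately show "\<phi> \<xi> f = \<phi> 0 f" by auto
  qed
  have "\<alpha> \<in> E"
  proof (rule functional_mem_of_kernel[OF fin])
    show "Vector_Spaces.linear scale (*) \<alpha>" using assms by (simp add: dual_def)
    show "Vector_Spaces.linear scale (*) e" if "e \<in> E" for e
      using that by (auto simp: E_def phi_one_functional)
    show "(\<lambda>_. 0) \<in> E"
      unfolding E_def by (rule image_eqI[of _ _ "\<lambda>_. 0"]) (auto simp: derivation_const)
    show "(\<lambda>x. e x + e' x) \<in> E" if e: "e \<in> E" "e' \<in> E" for e e'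
    proof -
      obtain f f' where f: "f \<in> A" "f' \<in> A" "e = (\<lambda>\<xi>. \<phi> \<xi> f one)" "e' = (\<lambda>\<xi>. \<phi> \<xi> f' one)"
        using e by (auto simp: E_def)
      then show ?thesis
        unfolding E_def
        by (intro image_eqI[of _ _ "\<lambda>x. f x + f' x"]) (auto simp: left_invariant_derivationD(2))
    qed
    show "(\<lambda>x. c * e x) \<in> E" if e: "e \<in> E" for c e
    proof -
      obtain f where f: "f \<in> A" "e = (\<lambda>\<xi>. \<phi> \<xi> f one)" using e by (auto simp: E_def)
      then show ?thesis
        unfolding E_def
        by (intro image_eqI[of _ _ "\<lambda>x. c * f x"]) (auto simp: left_invariant_derivationD(3))
    qed
    show "\<alpha> x = 0" if "\<And>e. e \<in> E \<Longrightarrow> e x = 0" for x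
    proof -
      have "x = 0" by (intro zero that)
      then show ?thesis using assms(3) by (simp add: dual_def functional_simps)
    qed
  qed
  then obtain f where "f \<in> A" "\<alpha> = (\<lambda>\<xi>. \<phi> \<xi> f one)" by (auto simp: E_def)
  then show ?thesis by (intro that) auto
qed

text \<open>The differential of \<open>Ad\<close> is \<open>ad\<close>.\<close>

lemma Ad_coefficient:
  assumes fin: "finite B" "span B = UNIV" and \<alpha>: "\<alpha> \<in> dual"
  shows "(\<lambda>h. \<alpha> (Ad h \<xi>)) \<in> A"
    and "\<phi> \<zeta> (\<lambda>h. \<alpha> (Ad h \<xi>)) = (\<lambda>h. \<alpha> (Ad h (bracket \<zeta> \<xi>)))"
proof -
  obtain f where f: "f \<in> A" "\<And>\<xi>. \<alpha> \<xi> = \<phi> \<xi> f one"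
    using dual_eq_tangent[OF fin \<alpha>] by metis
  obtain n :: nat and a b where ab: "\<And>i. i < n \<Longrightarrow> a i \<in> A" "\<And>i. i < n \<Longrightarrow> b i \<in> A"
    "\<And>x y. f (mult x (ginv y)) = (\<Sum>i<n. a i x * b i y)" using comult_divE[OF f(1)] by metis
  have sums: "\<phi> \<xi> (\<lambda>x. \<Sum>i<n. b i y * a i x) z = (\<Sum>i<n. b i y * \<phi> \<xi> (a i) z)" for \<xi> y z
    using ab by (simp add: derivation_sum[OF phi_mem] left_invariant_derivationD(3)[OF phi_mem])
  \<comment> \<open>In \<open>Ad h\<close> the element h occurs twice, as the point of evaluation
    and in a right translation; the functions \<open>b i\<close> carry the second
    occurrence.\<close>
  have coeff: "\<alpha> (Ad h \<xi>) = (\<Sum>i<n. \<phi> \<xi> (a i) h * b i h)" for h \<xi>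
    using sums by (simp add: f(2) phi_Ad_apply[OF f(1)] ab(3) mult.commute)
  show "(\<lambda>h. \<alpha> (Ad h \<xi>)) \<in> A"
    unfolding coeff using ab by (auto intro!: A_sum)
  show "\<phi> \<zeta> (\<lambda>h. \<alpha> (Ad h \<xi>)) = (\<lambda>h. \<alpha> (Ad h (bracket \<zeta> \<xi>)))"
  proof
    fix h
    \<comment> \<open>Fix y = h in the infinitesimal invariance and differentiate it in x along
      \<xi>. This trades the terms in which \<zeta> hits \<open>b i\<close> for second derivatives
      of \<open>a i\<close>, which complete the commutator.\<close>
    have "\<phi> \<xi> (\<lambda>x. \<Sum>i<n. \<phi> \<zeta> (a i) x * b i h + a i x * \<phi> \<zeta> (b i) h) h = 0"
      by (simp add: derivation_div[OF phi_mem f(1) ab] derivation_const)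
    also have "(\<lambda>x. \<Sum>i<n. \<phi> \<zeta> (a i) x * b i h + a i x * \<phi> \<zeta> (b i) h) =
        (\<lambda>x. \<Sum>i<n. b i h * \<phi> \<zeta> (a i) x + \<phi> \<zeta> (b i) h * a i x)"
      by (simp add: mult.commute)
    also have "\<phi> \<xi> \<dots> h = (\<Sum>i<n. b i h * \<phi> \<xi> (\<phi> \<zeta> (a i)) h + \<phi> \<zeta> (b i) h * \<phi> \<xi> (a i) h)"
      using ab by (simp add: derivation_sum[OF phi_mem] left_invariant_derivationD(2,3)[OF phi_mem])
    finally have 0: "(\<Sum>i<n. b i h * \<phi> \<xi> (\<phi> \<zeta> (a i)) h) =
        - (\<Sum>i<n. \<phi> \<zeta> (b i) h * \<phi> \<xi> (a i) h)"
      by (simp add: sum.distrib eq_neg_iff_add_eq_0)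
    have "\<phi> \<zeta> (\<lambda>h. \<alpha> (Ad h \<xi>)) h =
        (\<Sum>i<n. \<phi> \<zeta> (\<phi> \<xi> (a i)) h * b i h + \<phi> \<xi> (a i) h * \<phi> \<zeta> (b i) h)"
      unfolding coeff using ab
      by (simp add: derivation_sum[OF phi_mem] left_invariant_derivationD(4)[OF phi_mem])
    also have "\<dots> = (\<Sum>i<n. \<phi> \<zeta> (\<phi> \<xi> (a i)) h * b i h) - (\<Sum>i<n. b i h * \<phi> \<xi> (\<phi> \<zeta> (a i)) h)"
      unfolding 0 by (simp add: sum.distrib mult.commute)
    also have "\<dots> = \<alpha> (Ad h (bracket \<zeta> \<xi>))"
      unfolding coeff using ab by (simp add: bracket algebra_simps sum_subtractf)
    finally show "\<phi> \<zeta> (\<lambda>h. \<alpha> (Ad h \<xi>)) h = \<alpha> (Ad h (bracket \<zeta> \<xi>))" .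
  qed
qed

end


section \<open>Transcendence of the exponential series\<close>

unbundle fps_syntax

text \<open>The derivative of p(exp t) is exp t times p'(exp t), so p' is again a relation and
  vanishes by induction on the degree; then p is a constant relation.\<close>

lemma fps_exp_transcendental:
  fixes p :: "'k::field_char_0 poly"
  assumes "poly (map_poly fps_const p) (fps_exp 1) = 0"
  shows "p = 0"
  using assms
proof (induction "degree p" arbitrary: p rule: less_induct)
  case less
  have deriv: "fps_deriv (poly (map_poly fps_const q) (fps_exp 1)) =
      fps_exp 1 * poly (map_poly fps_const (pderiv q)) (fps_exp 1)" for q :: "'k poly"
  proof (induction q)
    case (pCons a q)
    have "map_poly fps_const (q + r) = map_poly fps_const q + map_poly fps_const r"
      for q r :: "'k poly"
      by (auto intro!: poly_eqI simp: coeff_map_poly)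
    with pCons show ?case by (simp add: map_poly_pCons pderiv_pCons algebra_simps)
  qed simp
  have "fps_exp 1 * poly (map_poly fps_const (pderiv p)) (fps_exp 1) = 0"
    using deriv[of p] less.prems by simp
  moreover have "fps_exp (1 :: 'k) $ 0 \<noteq> 0" by simp
  then have "fps_exp (1 :: 'k) \<noteq> 0" by (metis fps_zero_nth)
  ultimately have p': "poly (map_poly fps_const (pderiv p)) (fps_exp 1) = 0" by simp
  have "degree p = 0"
  proof (rule ccontr)
    assume "degree p \<noteq> 0"
    then have "pderiv p = 0" using less.hyps[OF _ p'] by (simp add: degree_pderiv)
    with \<open>degree p \<noteq> 0\<close> show False by (simp add: pderiv_eq_0_iff)
  qed
  then obtain c where "p = [:c:]" by (metis degree_eq_zeroE)
  with less.prems show ?case by (simp add: map_poly_pCons)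
qed

instance fps :: (ring_char_0) ring_char_0 ..

section \<open>Conical orbits and the coadjoint representation\<close>

context lie_algebra_of_group
begin

text \<open>A sequence of group elements scaling \<open>\<alpha>\<close> by infinitely many factors is a point of the
  stabilizer of the line through \<open>\<alpha>\<close> in an ultrapower. Specializing this point to the dual numbers
  yields a tangent vector of that stabilizer along which the scaling factor varies.\<close>

lemma ad_star_of_conical_orbit:
  assumes alg_closed: "\<And>p :: 'k poly. degree p > 0 \<Longrightarrow> \<exists>x. poly p x = 0"
    and fin: "finite B" "span B = UNIV" and \<alpha>: "\<alpha> \<in> dual" and conical: "conical_orbit \<alpha>"
  shows "\<alpha> \<in> range (\<lambda>\<xi>. ad_star \<xi> \<alpha>)"
proof -
  \<comment> \<open>The factors n + 1 are nonzero, as conicality demands, and pairwise distinct in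
    characteristic zero, which makes \<chi> transcendental.\<close>
  have "\<exists>h. \<forall>\<xi>. \<alpha> (Ad h \<xi>) = of_nat (Suc n) * \<alpha> \<xi>" for n
    using conical unfolding conical_orbit_iff by (metis of_nat_neq_0)
  then obtain h where h: "\<And>n \<xi>. \<alpha> (Ad (h n) \<xi>) = of_nat (Suc n) * \<alpha> \<xi>" by metis
  define \<iota> :: "'k \<Rightarrow> 'k ultrapower" where "\<iota> c = ultra_class (\<lambda>_. c)" for c
  define \<theta> where "\<theta> f = ultra_class (\<lambda>n. f (h n))" for f :: "'g \<Rightarrow> 'k"
  define \<chi> :: "'k ultrapower" where "\<chi> = ultra_class (\<lambda>n. of_nat (Suc n))"
  have \<iota>: "ring_hom_on UNIV \<iota>"
    by (simp add: ring_hom_on_def \<iota>_def ultra_class_simps)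
  have transcendental: "p = 0" if "poly (map_poly \<iota> p) \<chi> = 0" for p
  proof (rule ccontr)
    assume "p \<noteq> 0"
    then have "finite {c. poly p c = 0}" by (rule poly_roots_finite)
    then have "finite ((\<lambda>n. of_nat (Suc n)) -` {c. poly p c = 0})"
      by (rule finite_vimageI) (auto simp: inj_on_def simp del: of_nat_Suc)
    moreover have "ultra_class (\<lambda>n. poly p (of_nat (Suc n))) = 0"
      using that unfolding \<iota>_def \<chi>_def poly_ultra_class .
    from ultra_class_eq_0[OF this] have "infinite ((\<lambda>n. of_nat (Suc n)) -` {c. poly p c = 0})"
      by (simp add: vimage_def)
    ultimately show False by simp
  qed
  obtain F where F: "finite F" "\<And>c. c \<notin> F \<Longrightarrow> \<exists>x \<delta>. point_derivation A x \<delta> \<and>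
      (\<forall>f\<in>A. \<forall>a. \<theta> f = \<iota> a * \<chi> \<longrightarrow> f x = a * c \<and> \<delta> f = a)"
    by (rule variety_dual_points[OF alg_closed variety \<iota> transcendental, where \<theta> = \<theta>])
      (auto simp: \<theta>_def \<iota>_def ultra_class_simps)
  obtain c where c: "c \<notin> insert 0 F"
    using ex_new_if_finite[OF infinite_UNIV_char_0, of "insert 0 F"] F(1) by blast
  then obtain x \<delta> where \<delta>: "point_derivation A x \<delta>"
    "\<And>f a. f \<in> A \<Longrightarrow> \<theta> f = \<iota> a * \<chi> \<Longrightarrow> f x = a * c \<and> \<delta> f = a" using F(2)[of c] by auto
  obtain D where D: "D \<in> left_invariant_derivations" "\<And>f. f \<in> A \<Longrightarrow> D f x = \<delta> f"
    using point_derivation_extends[OF \<delta>(1)] by metis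
  obtain \<zeta> where \<zeta>: "\<phi> \<zeta> = D" using bij D(1) unfolding bij_betw_def by (metis imageE)
  have F_eta: "\<alpha> (Ad x \<eta>) = \<alpha> \<eta> * c \<and> \<delta> (\<lambda>g. \<alpha> (Ad g \<eta>)) = \<alpha> \<eta>" for \<eta>
  proof (rule \<delta>(2)[OF Ad_coefficient(1)[OF fin \<alpha>]])
    show "\<theta> (\<lambda>g. \<alpha> (Ad g \<eta>)) = \<iota> (\<alpha> \<eta>) * \<chi>"
      by (simp add: \<theta>_def \<iota>_def \<chi>_def h mult.commute flip: ultra_class_simps)
  qed
  \<comment> \<open>The coefficient of [\<zeta>, \<eta>] has the value c \<alpha>([\<zeta>, \<eta>])
    at x; by \<open>Ad_coefficient\<close> it is the derivative along \<zeta> of the coefficient of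
    \<eta>, whose value at x is \<alpha>(\<eta>).\<close>
  have "\<alpha> (bracket \<zeta> \<eta>) * c = \<alpha> \<eta>" for \<eta>
    using F_eta[of \<eta>] F_eta[of "bracket \<zeta> \<eta>"] D(2)[OF Ad_coefficient(1)[OF fin \<alpha>, of \<eta>]]
      Ad_coefficient(2)[OF fin \<alpha>, of \<zeta> \<eta>] by (simp add: \<zeta>)
  then have "\<alpha> = ad_star (scale (- c) \<zeta>) \<alpha>"
    using c \<alpha> by (auto simp: ad_star_def dual_def functional_simps bracket_simps fun_eq_iff field_simps)
  then show ?thesis by blast
qed

text \<open>If \<open>\<alpha>([\<zeta>, \<eta>]) = \<alpha>(\<eta>)\<close>, then the formal curve \<open>exp(t\<zeta>)\<close> scales \<open>\<alpha>\<close> by the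
  transcendental series \<open>exp(t)\<close>, so specializations of it scale \<open>\<alpha>\<close> by almost every constant.
  These constants form a group.\<close>

lemma conical_orbit_of_ad_star:
  assumes alg_closed: "\<And>p :: 'k poly. degree p > 0 \<Longrightarrow> \<exists>x. poly p x = 0"
    and fin: "finite B" "span B = UNIV" and \<alpha>: "\<alpha> \<in> dual"
    and mem: "\<alpha> \<in> range (\<lambda>\<xi>. ad_star \<xi> \<alpha>)"
  shows "conical_orbit \<alpha>"
proof -
  obtain \<xi> where "\<alpha> = ad_star \<xi> \<alpha>" using mem by blast
  then have \<xi>: "\<alpha> \<eta> = - \<alpha> (bracket \<xi> \<eta>)" for \<eta> by (metis ad_star_def)
  \<comment> \<open>The sign cancels the one in \<open>ad_star\<close>, so that
    \<alpha>([-\<xi>, \<eta>]) = \<alpha>(\<eta>).\<close>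
  define D where "D = \<phi> (- \<xi>)"
  have D: "D \<in> left_invariant_derivations" by (simp add: D_def)
  note D_simps = left_invariant_derivationD[OF D]
  have coeff: "(\<lambda>h. \<alpha> (Ad h \<eta>)) \<in> A" "D (\<lambda>h. \<alpha> (Ad h \<eta>)) = (\<lambda>h. \<alpha> (Ad h (bracket (- \<xi>) \<eta>)))" for \<eta>
    using Ad_coefficient[OF fin \<alpha>] by (auto simp: D_def)
  have bracket_minus: "\<alpha> (bracket (- \<xi>) \<eta>) = \<alpha> \<eta>" for \<eta>
    using \<alpha> by (subst (2) \<xi>) (simp add: dual_def functional_simps bracket_simps)
  \<comment> \<open>Taylor expansion at the identity along the flow of D: the restriction of f to
    the formal one-parameter subgroup.\<close>
  define \<theta> where "\<theta> f = Abs_fps (\<lambda>n. (D ^^ n) f one / fact n)" for f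
  have pow_mem: "(D ^^ n) f \<in> A" if "f \<in> A" for f n
    using that D_simps(1) by (induction n) auto
  have \<theta>_deriv: "fps_deriv (\<theta> f) = \<theta> (D f)" for f
    by (rule fps_ext) (simp add: \<theta>_def funpow_Suc_right field_simps del: funpow.simps of_nat_Suc)
  have \<theta>_add: "\<theta> (\<lambda>x. f x + g x) = \<theta> f + \<theta> g" if "f \<in> A" "g \<in> A" for f g
  proof -
    have "(D ^^ n) (\<lambda>x. f x + g x) = (\<lambda>x. (D ^^ n) f x + (D ^^ n) g x)" for n
      using that pow_mem by (induction n) (auto simp: D_simps)
    then show ?thesis by (auto intro!: fps_ext simp: \<theta>_def add_divide_distrib)
  qed
  have \<theta>_mult: "\<theta> (\<lambda>x. f x * g x) = \<theta> f * \<theta> g" if "f \<in> A" "g \<in> A" for f g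
  proof (rule fps_ext)
    show "\<theta> (\<lambda>x. f x * g x) $ n = (\<theta> f * \<theta> g) $ n" for n
      using that
    proof (induction n arbitrary: f g)
      case 0
      then show ?case by (simp add: \<theta>_def)
    next
      case (Suc n)
      \<comment> \<open>Compare derivatives: the Leibniz rule of D matches the product rule for
        series, and n + 1 cancels in characteristic zero.\<close>
      have "of_nat (Suc n) * \<theta> (\<lambda>x. f x * g x) $ Suc n = \<theta> (\<lambda>x. D f x * g x + f x * D g x) $ n"
        using fps_deriv_nth[of "\<theta> (\<lambda>x. f x * g x)" n] Suc.prems by (simp add: \<theta>_deriv D_simps)
      also have "\<dots> = (\<theta> (D f) * \<theta> g + \<theta> f * \<theta> (D g)) $ n"
        using Suc by (simp add: \<theta>_add D_simps(1))
      also have "\<dots> = fps_deriv (\<theta> f * \<theta> g) $ n"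
        by (simp add: \<theta>_deriv add.commute)
      also have "\<dots> = of_nat (Suc n) * (\<theta> f * \<theta> g) $ Suc n"
        by (simp only: fps_deriv_nth Suc_eq_plus1)
      finally show ?case by (simp del: of_nat_Suc)
    qed
  qed
  have \<theta>_const: "\<theta> (\<lambda>_. c) = fps_const c" for c
  proof -
    have Suc: "\<theta> (\<lambda>_. c) $ Suc n = 0" for n
    proof -
      have "(D ^^ n) (\<lambda>_. 0) = (\<lambda>_. 0)"
        by (induction n) (auto simp: derivation_const[OF D])
      then show ?thesis
        by (simp add: \<theta>_def funpow_Suc_right derivation_const[OF D] del: funpow.simps)
    qed
    have "\<theta> (\<lambda>_. c) $ n = fps_const c $ n" for n
      by (cases n) (simp_all add: Suc, simp add: \<theta>_def)
    then show ?thesis by (rule fps_ext)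
  qed
  \<comment> \<open>Each application of D replaces \<eta> by [-\<xi>, \<eta>], on which \<alpha>
    takes the same value. So every iterated derivative at the identity equals
    \<alpha>(\<eta>).\<close>
  have \<theta>_coeff: "\<theta> (\<lambda>h. \<alpha> (Ad h \<eta>)) = fps_const (\<alpha> \<eta>) * fps_exp 1" for \<eta>
  proof -
    have "(D ^^ n) (\<lambda>h. \<alpha> (Ad h \<eta>)) one = \<alpha> \<eta>" for n
      by (induction n arbitrary: \<eta>)
        (simp_all add: funpow_Suc_right coeff bracket_minus del: funpow.simps(2))
    then show ?thesis by (intro fps_ext) (simp add: \<theta>_def)
  qed
  have \<iota>: "ring_hom_on UNIV (fps_const :: 'k \<Rightarrow> 'k fps)"
    by (simp add: ring_hom_on_def)
  obtain F where F: "finite F" "\<And>c. c \<notin> F \<Longrightarrow> \<exists>x \<delta>. point_derivation A x \<delta> \<and>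
      (\<forall>f\<in>A. \<forall>a. \<theta> f = fps_const a * fps_exp 1 \<longrightarrow> f x = a * c \<and> \<delta> f = a)"
    by (rule variety_dual_points[OF alg_closed variety \<iota> fps_exp_transcendental, where \<theta> = \<theta>])
      (auto simp: \<theta>_const \<theta>_add \<theta>_mult)
  have scaled: "\<exists>x. \<forall>\<eta>. \<alpha> (Ad x \<eta>) = c * \<alpha> \<eta>" if "c \<notin> F" for c
    using F(2)[OF that] coeff(1) \<theta>_coeff by (metis mult.commute)
  show ?thesis
    unfolding conical_orbit_iff
  proof (intro allI impI)
    fix c :: 'k assume "c \<noteq> 0"
    \<comment> \<open>The excluded values make both factors of c = d (c / d) avoid F.\<close>
    obtain d where d: "d \<notin> insert 0 F \<union> (\<lambda>f. c / f) ` F"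
      using ex_new_if_finite[OF infinite_UNIV_char_0, of "insert 0 F \<union> (\<lambda>f. c / f) ` F"] F(1)
      by blast
    then have "c / d \<notin> F" using \<open>c \<noteq> 0\<close> by (auto simp: image_iff)
    then obtain x y where "\<And>\<eta>. \<alpha> (Ad x \<eta>) = d * \<alpha> \<eta>" "\<And>\<eta>. \<alpha> (Ad y \<eta>) = c / d * \<alpha> \<eta>"
      using scaled d by (metis UnCI insertCI)
    then have "\<alpha> (Ad (mult x y) \<eta>) = c * \<alpha> \<eta>" for \<eta>
      using d by (simp add: Ad_mult)
    then show "\<exists>h. \<forall>\<xi>. \<alpha> (Ad h \<xi>) = c * \<alpha> \<xi>" by blast
  qed
qed

text \<open>The same open set U serves both sides. An orbit that meets U does so in a translate of
  its base point, and conicality passes to this translate, where the pointwise equivalence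
  applies.\<close>

lemma generic_orbit_not_conical_iff:
  assumes alg_closed: "\<And>p :: 'k poly. degree p > 0 \<Longrightarrow> \<exists>x. poly p x = 0"
    and fin: "finite B" "span B = UNIV"
  shows "generic_orbit_not_conical \<longleftrightarrow> generic_point (\<lambda>\<alpha>. \<alpha> \<notin> range (\<lambda>\<xi>. ad_star \<xi> \<alpha>))"
proof -
  have open_dual: "U \<subseteq> dual" if "open_in_dual U" for U
    using that unfolding open_in_dual_def zariski_open_def by blast
  have self: "\<alpha> \<in> coadjoint_orbit \<alpha>" for \<alpha>
    unfolding coadjoint_orbit_eq by (intro CollectI exI[of _ one]) simp
  have "(\<forall>\<alpha>\<in>dual. coadjoint_orbit \<alpha> \<inter> U \<noteq> {} \<longrightarrow> \<not> conical_orbit \<alpha>) \<longleftrightarrow>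
      (\<forall>\<alpha>\<in>U. \<alpha> \<notin> range (\<lambda>\<xi>. ad_star \<xi> \<alpha>))" if U: "open_in_dual U" for U
  proof
    assume L: "\<forall>\<alpha>\<in>dual. coadjoint_orbit \<alpha> \<inter> U \<noteq> {} \<longrightarrow> \<not> conical_orbit \<alpha>"
    show "\<forall>\<alpha>\<in>U. \<alpha> \<notin> range (\<lambda>\<xi>. ad_star \<xi> \<alpha>)"
      using L self open_dual[OF U] conical_orbit_of_ad_star[OF alg_closed fin] by blast
  next
    assume R: "\<forall>\<alpha>\<in>U. \<alpha> \<notin> range (\<lambda>\<xi>. ad_star \<xi> \<alpha>)"
    show "\<forall>\<alpha>\<in>dual. coadjoint_orbit \<alpha> \<inter> U \<noteq> {} \<longrightarrow> \<not> conical_orbit \<alpha>"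
    proof (intro ballI impI notI)
      fix \<alpha> assume \<alpha>: "\<alpha> \<in> dual" "coadjoint_orbit \<alpha> \<inter> U \<noteq> {}" "conical_orbit \<alpha>"
      then obtain h where h: "(\<lambda>\<xi>. \<alpha> (Ad h \<xi>)) \<in> U" by (auto simp: coadjoint_orbit_eq)
      then have "(\<lambda>\<xi>. \<alpha> (Ad h \<xi>)) \<in> dual" using open_dual[OF U] by blast
      from ad_star_of_conical_orbit[OF alg_closed fin this conical_orbit_translate[OF \<alpha>(3)]]
      show False using R h by blast
    qed
  qed
  then show ?thesis
    unfolding generic_orbit_not_conical_def generic_point_def by blast
qed

end

section \<open>Alternating forms\<close>

definition antisymmetric :: "nat \<Rightarrow> ((nat \<Rightarrow> 'v) \<Rightarrow> 'k::field_char_0) \<Rightarrow> bool" where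
  "antisymmetric p \<omega> \<longleftrightarrow>
     (\<forall>v a b. a < p \<longrightarrow> b < p \<longrightarrow> a \<noteq> b \<longrightarrow> \<omega> (v \<circ> transpose a b) = - \<omega> v)"

text \<open>The vectors whose interior product with \<omega> vanishes, tested in every slot so that
  no antisymmetry of \<omega> is presupposed.\<close>

definition killed_by :: "nat \<Rightarrow> ((nat \<Rightarrow> 'v) \<Rightarrow> 'k::field_char_0) \<Rightarrow> 'v \<Rightarrow> bool" where
  "killed_by p \<omega> x \<longleftrightarrow> (\<forall>v. (\<exists>i<p. v i = x) \<longrightarrow> \<omega> v = 0)"

lemma killed_byD: "killed_by p \<omega> x \<Longrightarrow> j < p \<Longrightarrow> v j = x \<Longrightarrow> \<omega> v = 0"
  unfolding killed_by_def by blast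

text \<open>The sum over all permutations antisymmetrizes arbitrary \<omega> and \<eta>: composing
  \<sigma> on the left with a transposition reindexes the sum and flips every sign.\<close>

lemma antisymmetric_wedge: "antisymmetric (p + q) (wedge p q \<omega> \<eta>)"
  unfolding antisymmetric_def
proof (intro allI impI)
  fix v :: "nat \<Rightarrow> 'a" and a b assume ab: "a < p + q" "b < p + q" "a \<noteq> b"
  let ?\<tau> = "transpose a b"
  let ?f = "\<lambda>v \<sigma>. of_int (sign \<sigma>) * \<omega> (\<lambda>i. v (\<sigma> i)) * \<eta> (\<lambda>i. v (\<sigma> (p + i)))"
  have \<tau>: "?\<tau> permutes {..<p + q}" using ab by (intro permutes_swap_id) auto
  have "sum (?f v) {\<sigma>. \<sigma> permutes {..<p + q}} = (\<Sum>\<sigma> | \<sigma> permutes {..<p + q}. ?f v (?\<tau> \<circ> \<sigma>))"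
    by (rule setum_permutations_compose_left[OF \<tau>])
  also have "\<dots> = (\<Sum>\<sigma> | \<sigma> permutes {..<p + q}. - ?f (v \<circ> ?\<tau>) \<sigma>)"
  proof (rule sum.cong)
    fix \<sigma> assume "\<sigma> \<in> {\<sigma>. \<sigma> permutes {..<p + q}}"
    then have "permutation \<sigma>" using permutation_permutes by auto
    then have "sign (?\<tau> \<circ> \<sigma>) = - sign \<sigma>"
      using ab by (simp add: sign_compose permutation_swap_id sign_swap_id)
    then show "?f v (?\<tau> \<circ> \<sigma>) = - ?f (v \<circ> ?\<tau>) \<sigma>" by simp
  qed simp
  finally show "wedge p q \<omega> \<eta> (v \<circ> ?\<tau>) = - wedge p q \<omega> \<eta> v"
    by (simp add: wedge_def sum_negf)
qed

lemma antisymmetric_wedge_power: "antisymmetric (n * p) (wedge_power p \<omega> n)"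
  using antisymmetric_wedge[of p _ \<omega>] by (cases n) (auto simp: antisymmetric_def)

lemma antisymmetric_repeat:
  assumes "antisymmetric p \<omega>" "a < p" "b < p" "a \<noteq> b" "v a = v b"
  shows "\<omega> v = 0"
proof -
  have "v \<circ> transpose a b = v" using assms(5) by (auto simp: transpose_def fun_eq_iff)
  then have "\<omega> v = - \<omega> v" using assms unfolding antisymmetric_def by metis
  then show ?thesis by (simp add: equal_neg_zero)
qed

text \<open>The offset k selects the block of arguments that the form reads: k = 2 for the second
  factor of a wedge with a two-form, k = 0 for a first factor.\<close>

lemma antisymmetric_permute:
  assumes \<omega>: "antisymmetric p \<omega>" and "\<tau> permutes {k..<k + p}"
  shows "\<omega> (\<lambda>i. w (\<tau> (k + i))) = of_int (sign \<tau>) * \<omega> (\<lambda>i. w (k + i))"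
  using finite_atLeastLessThan assms(2)
proof (induction \<tau> rule: permutes_rev_induct)
  case (swap a b \<tau>)
  have "(\<lambda>i. w ((\<tau> \<circ> transpose a b) (k + i))) = (\<lambda>i. w (\<tau> (k + i))) \<circ> transpose (a - k) (b - k)"
    using swap(1,2) by (auto simp: fun_eq_iff transpose_def)
  then have "\<omega> (\<lambda>i. w ((\<tau> \<circ> transpose a b) (k + i))) = - \<omega> (\<lambda>i. w (\<tau> (k + i)))"
    using \<omega> swap(1-3) unfolding antisymmetric_def by auto
  moreover have "permutation \<tau>"
    unfolding permutation_permutes using swap(4) by (intro exI[of _ "{k..<k + p}"]) simp
  then have "sign (\<tau> \<circ> transpose a b) = - sign \<tau>"
    using swap(3) by (simp add: sign_compose permutation_swap_id sign_swap_id)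
  ultimately show ?case by (simp only: swap(5) of_int_minus mult_minus_left)
qed simp

lemma killed_by_wedge:
  assumes "killed_by p \<omega> x" "killed_by q \<eta> x"
  shows "killed_by (p + q) (wedge p q \<omega> \<eta>) x"
  unfolding killed_by_def
proof (intro allI impI)
  fix v assume "\<exists>j<p + q. v j = x"
  then obtain j where j: "j < p + q" "v j = x" by blast
  have "\<omega> (\<lambda>i. v (\<sigma> i)) * \<eta> (\<lambda>i. v (\<sigma> (p + i))) = 0" if \<sigma>: "\<sigma> permutes {..<p + q}" for \<sigma>
  proof -
    obtain i where i: "i < p + q" "\<sigma> i = j"
      using permutes_image[OF \<sigma>] j(1) by (metis imageE lessThan_iff)
    show ?thesis
    proof (cases "i < p")
      case True
      then show ?thesis using assms(1) i j unfolding killed_by_def by auto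
    next
      case False
      then have "i - p < q" "v (\<sigma> (p + (i - p))) = x" using i j by auto
      then show ?thesis using assms(2) unfolding killed_by_def by auto
    qed
  qed
  then have "(\<Sum>\<sigma> | \<sigma> permutes {..<p + q}.
      of_int (sign \<sigma>) * \<omega> (\<lambda>i. v (\<sigma> i)) * \<eta> (\<lambda>i. v (\<sigma> (p + i)))) = 0"
    by (intro sum.neutral) (auto simp: mult.assoc)
  then show "wedge p q \<omega> \<eta> v = 0" by (simp add: wedge_def)
qed

lemma killed_by_wedge_power:
  "killed_by p \<omega> x \<Longrightarrow> killed_by (n * p) (wedge_power p \<omega> n) x"
  by (induction n) (simp add: killed_by_def, simp add: killed_by_wedge)

context vector_space
begin

definition multilinear_form :: "nat \<Rightarrow> ((nat \<Rightarrow> 'b) \<Rightarrow> 'a) \<Rightarrow> bool" where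
  "multilinear_form p \<omega> \<longleftrightarrow>
     (\<forall>v w. (\<forall>i<p. v i = w i) \<longrightarrow> \<omega> v = \<omega> w) \<and>
     (\<forall>v j. j < p \<longrightarrow> Vector_Spaces.linear scale (*) (\<lambda>x. \<omega> (v(j := x))))"

end

text \<open>A permutation puts slot j into exactly one argument of exactly one of the two factors,
  so every summand is linear in it.\<close>

lemma multilinear_form_wedge:
  fixes scale :: "'k::field_char_0 \<Rightarrow> 'v::ab_group_add \<Rightarrow> 'v"
  assumes "vector_space scale"
    and \<omega>: "vector_space.multilinear_form scale p \<omega>"
    and \<eta>: "vector_space.multilinear_form scale q \<eta>"
  shows "vector_space.multilinear_form scale (p + q) (wedge p q \<omega> \<eta>)"
proof -
  interpret vector_space scale by fact
  have local: "\<And>v w. (\<And>i. i < p \<Longrightarrow> v i = w i) \<Longrightarrow> \<omega> v = \<omega> w"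
    "\<And>v w. (\<And>i. i < q \<Longrightarrow> v i = w i) \<Longrightarrow> \<eta> v = \<eta> w"
    and lin: "\<And>v j. j < p \<Longrightarrow> Vector_Spaces.linear scale (*) (\<lambda>x. \<omega> (v(j := x)))"
    "\<And>v j. j < q \<Longrightarrow> Vector_Spaces.linear scale (*) (\<lambda>x. \<eta> (v(j := x)))"
    using \<omega> \<eta> unfolding multilinear_form_def by blast+
  show ?thesis
    unfolding multilinear_form_def
  proof (intro conjI allI impI)
    fix v w :: "nat \<Rightarrow> 'v" assume eq: "\<forall>i<p + q. v i = w i"
    have "\<omega> (\<lambda>i. v (\<sigma> i)) = \<omega> (\<lambda>i. w (\<sigma> i))"
      "\<eta> (\<lambda>i. v (\<sigma> (p + i))) = \<eta> (\<lambda>i. w (\<sigma> (p + i)))" if "\<sigma> permutes {..<p + q}" for \<sigma>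
      by (rule local, use eq permutes_in_image[OF that] in simp)+
    then show "wedge p q \<omega> \<eta> v = wedge p q \<omega> \<eta> w"
      unfolding wedge_def by (intro arg_cong2[of _ _ _ _ "(/)"] sum.cong) auto
  next
    fix v :: "nat \<Rightarrow> 'v" and j assume j: "j < p + q"
    define T where "T \<sigma> x = of_int (sign \<sigma>) * \<omega> (\<lambda>i. (v(j := x)) (\<sigma> i)) *
      \<eta> (\<lambda>i. (v(j := x)) (\<sigma> (p + i)))" for \<sigma> x
    have T: "Vector_Spaces.linear scale (*) (T \<sigma>)" if \<sigma>: "\<sigma> permutes {..<p + q}" for \<sigma>
    proof -
      obtain i where i: "i < p + q" "\<sigma> i = j"
        using permutes_image[OF \<sigma>] j by (metis imageE lessThan_iff)
      have inj: "\<sigma> k = j \<longleftrightarrow> k = i" for k using permutes_inj[OF \<sigma>] i by (auto dest: injD)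
      show ?thesis
      proof (cases "i < p")
        case True
        have "(\<lambda>k. (v(j := x)) (\<sigma> k)) = (\<lambda>k. v (\<sigma> k))(i := x)"
          "(\<lambda>k. (v(j := x)) (\<sigma> (p + k))) = (\<lambda>k. v (\<sigma> (p + k)))" for x
          using inj True by (auto simp: fun_eq_iff)
        then show ?thesis
          using lin(1)[OF True, of "\<lambda>k. v (\<sigma> k)"] unfolding T_def[abs_def] linear_functional_iff
          by (simp add: algebra_simps)
      next
        case False
        have "(\<lambda>k. (v(j := x)) (\<sigma> (p + k))) = (\<lambda>k. v (\<sigma> (p + k)))(i - p := x)" for x
          using inj False by (auto simp: fun_eq_iff)
        moreover have "\<omega> (\<lambda>k. (v(j := x)) (\<sigma> k)) = \<omega> (\<lambda>k. v (\<sigma> k))" for x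
          by (rule local) (use inj False in auto)
        ultimately show ?thesis
          using lin(2)[of "i - p" "\<lambda>k. v (\<sigma> (p + k))"] i False
          unfolding T_def[abs_def] linear_functional_iff
          by (simp add: algebra_simps)
      qed
    qed
    have "(\<Sum>\<sigma> | \<sigma> permutes {..<p + q}. T \<sigma> (x + y)) =
        (\<Sum>\<sigma> | \<sigma> permutes {..<p + q}. T \<sigma> x) + (\<Sum>\<sigma> | \<sigma> permutes {..<p + q}. T \<sigma> y)"
      "(\<Sum>\<sigma> | \<sigma> permutes {..<p + q}. T \<sigma> (scale c x)) =
        c * (\<Sum>\<sigma> | \<sigma> permutes {..<p + q}. T \<sigma> x)" for x y c
      using T by (simp_all add: functional_simps sum_distrib_left flip: sum.distrib)
    moreover have "wedge p q \<omega> \<eta> (v(j := x)) =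
        (\<Sum>\<sigma> | \<sigma> permutes {..<p + q}. T \<sigma> x) / (fact p * fact q)" for x
      by (simp add: wedge_def T_def)
    ultimately show "Vector_Spaces.linear scale (*) (\<lambda>x. wedge p q \<omega> \<eta> (v(j := x)))"
      unfolding linear_functional_iff by (simp add: add_divide_distrib)
  qed
qed

lemma multilinear_form_wedge_power:
  fixes scale :: "'k::field_char_0 \<Rightarrow> 'v::ab_group_add \<Rightarrow> 'v"
  assumes "vector_space scale" "vector_space.multilinear_form scale p \<omega>"
  shows "vector_space.multilinear_form scale (n * p) (wedge_power p \<omega> n)"
proof (induction n)
  case 0
  show ?case using assms(1) by (simp add: vector_space.multilinear_form_def)
next
  case (Suc n)
  show ?case using multilinear_form_wedge[OF assms Suc] by simp
qed

text \<open>Cramer's rule: after expanding slot j, every term except the one with \<open>v j\<close>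
  repeats an argument and vanishes.\<close>

lemma alternating_form_coordinates:
  fixes scale :: "'k::field_char_0 \<Rightarrow> 'v::ab_group_add \<Rightarrow> 'v"
  assumes "vector_space scale"
    and \<omega>: "vector_space.multilinear_form scale p \<omega>" "antisymmetric p \<omega>" and j: "j < p"
  shows "\<omega> (v(j := \<Sum>i<p. scale (c i) (v i))) = c j * \<omega> v"
proof -
  interpret vector_space scale by fact
  have lin: "Vector_Spaces.linear scale (*) (\<lambda>x. \<omega> (v(j := x)))"
    using \<omega>(1) j by (simp add: multilinear_form_def)
  have "\<omega> (v(j := \<Sum>i<p. scale (c i) (v i))) = (\<Sum>i<p. c i * \<omega> (v(j := v i)))"
    by (simp add: functional_simps(2,6)[OF lin])
  also have "\<dots> = (\<Sum>i<p. if i = j then c j * \<omega> v else 0)"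
    using antisymmetric_repeat[OF \<omega>(2), of _ j "v(j := v _)"] j by (intro sum.cong) auto
  finally show ?thesis using j by simp
qed

lemma alternating_form_independent:
  fixes scale :: "'k::field_char_0 \<Rightarrow> 'v::ab_group_add \<Rightarrow> 'v"
  assumes vs: "vector_space scale"
    and \<omega>: "vector_space.multilinear_form scale p \<omega>" "antisymmetric p \<omega>" "\<omega> v \<noteq> 0"
  shows "inj_on v {..<p}" "\<not> module.dependent scale (v ` {..<p})"
proof -
  interpret vector_space scale by fact
  show inj: "inj_on v {..<p}"
    using antisymmetric_repeat[OF \<omega>(2)] \<omega>(3) by (auto intro!: inj_onI)
  show "\<not> dependent (v ` {..<p})"
  proof (rule independent_if_scalars_zero)
    fix f x assume 0: "(\<Sum>x\<in>v ` {..<p}. scale (f x) x) = 0" and "x \<in> v ` {..<p}"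
    then obtain j where j: "j < p" "x = v j" by auto
    have "\<omega> (v(j := \<Sum>i<p. scale (f (v i)) (v i))) = f (v j) * \<omega> v"
      by (rule alternating_form_coordinates[OF vs \<omega>(1,2) j(1)])
    moreover have "(\<Sum>i<p. scale (f (v i)) (v i)) = 0"
      using 0 by (simp add: sum.reindex[OF inj])
    moreover have "Vector_Spaces.linear scale (*) (\<lambda>x. \<omega> (v(j := x)))"
      using \<omega>(1) j by (simp add: multilinear_form_def)
    ultimately show "f x = 0" using \<omega>(3) j functional_simps(3) by fastforce
  qed simp
qed

text \<open>Vectors on which a form of top degree does not vanish are a basis. Up to the factor
  \<omega> v, the coordinates of x are values of \<omega> with x inserted, hence zero.\<close>

lemma top_form_killed_zero:
  fixes scale :: "'k::field_char_0 \<Rightarrow> 'v::ab_group_add \<Rightarrow> 'v"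
  assumes fd: "finite_dimensional_vector_space scale B"
    and \<omega>: "vector_space.multilinear_form scale p \<omega>" "antisymmetric p \<omega>" "\<omega> v \<noteq> 0"
    and dim: "vector_space.dim scale UNIV = p" and x: "killed_by p \<omega> x"
  shows "x = 0"
proof -
  interpret finite_dimensional_vector_space scale B by fact
  note vs = vector_space_axioms
  note indep = alternating_form_independent[OF vs \<omega>]
  have "UNIV \<subseteq> span (v ` {..<p})"
    using indep dim by (intro card_ge_dim_independent) (auto simp: card_image)
  then have "x \<in> span (v ` {..<p})" by blast
  then obtain u where "x = (\<Sum>y\<in>v ` {..<p}. scale (u y) y)"
    by (auto simp: span_finite)
  then have u: "x = (\<Sum>i<p. scale (u (v i)) (v i))" by (simp add: sum.reindex[OF indep(1)])
  have "u (v j) = 0" if j: "j < p" for j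
  proof -
    have "\<omega> (v(j := x)) = 0" by (rule killed_byD[OF x j]) simp
    then show ?thesis
      using alternating_form_coordinates[OF vs \<omega>(1,2) j, of v "\<lambda>i. u (v i)"] u \<omega>(3) by simp
  qed
  then show ?thesis by (subst u) simp
qed

text \<open>A permutation that moves p feeds z to W and contributes 0. Those that fix p all
  contribute \<open>W v * \<beta> z\<close>, and their number, at least one, is nonzero in
  characteristic zero.\<close>

lemma wedge_kernel_functional_nonzero:
  fixes \<beta> :: "'v \<Rightarrow> 'k::field_char_0"
  assumes W: "antisymmetric p W" "\<And>v w. (\<And>i. i < p \<Longrightarrow> v i = w i) \<Longrightarrow> W v = W w"
    and "killed_by p W z" "W v \<noteq> 0" "\<beta> z \<noteq> 0"
  shows "wedge p 1 W (\<lambda>v. \<beta> (v 0)) (v(p := z)) \<noteq> 0"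
proof -
  define u where "u = v(p := z)"
  let ?S = "{\<sigma>. \<sigma> permutes {..<p + 1}}"
  have "of_int (sign \<sigma>) * W (\<lambda>i. u (\<sigma> i)) * \<beta> (u (\<sigma> (p + 0))) =
      (if \<sigma> p = p then W v * \<beta> z else 0)" if \<sigma>: "\<sigma> \<in> ?S" for \<sigma>
  proof (cases "\<sigma> p = p")
    case True
    have "\<sigma> permutes {0..<0 + p}"
    proof (rule permutes_superset)
      show "\<sigma> permutes {..<p + 1}" using \<sigma> by simp
      show "\<sigma> x = x" if "x \<in> {..<p + 1} - {0..<0 + p}" for x
      proof -
        have "x = p" using that by auto
        then show ?thesis using True by simp
      qed
    qed
    from antisymmetric_permute[OF W(1) this, of u]
    have "W (\<lambda>i. u (\<sigma> i)) = of_int (sign \<sigma>) * W u" by simp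
    moreover have "W u = W v" by (rule W(2)) (simp add: u_def)
    moreover have "(of_int (sign \<sigma>) :: 'k) * of_int (sign \<sigma>) = 1"
      by (metis of_int_1 of_int_mult sign_idempotent)
    ultimately show ?thesis using True by (simp add: u_def mult.assoc[symmetric])
  next
    case False
    obtain j where j: "j < p + 1" "\<sigma> j = p"
      using \<sigma> permutes_image[of \<sigma> "{..<p + 1}"] by (metis (mono_tags, lifting) imageE lessThan_iff
          less_add_one mem_Collect_eq)
    with False have "j < p" by (metis Suc_eq_plus1 less_SucE)
    then have "W (\<lambda>i. u (\<sigma> i)) = 0" 
      by (intro killed_byD[OF assms(3)]) (use j in \<open>auto simp: u_def\<close>)
    with False show ?thesis by simp
  qed
  then have "wedge p 1 W (\<lambda>v. \<beta> (v 0)) u =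
      (\<Sum>\<sigma>\<in>?S. if \<sigma> p = p then W v * \<beta> z else 0) / (fact p * fact 1)"
    unfolding wedge_def by (intro arg_cong2[of _ _ _ _ "(/)"] sum.cong) auto
  also have "(\<Sum>\<sigma>\<in>?S. if \<sigma> p = p then W v * \<beta> z else 0) = (\<Sum>\<sigma>\<in>{\<sigma> \<in> ?S. \<sigma> p = p}. W v * \<beta> z)"
    by (rule sum.inter_filter[symmetric]) (simp add: finite_permutations)
  also have "\<dots> = of_nat (card {\<sigma> \<in> ?S. \<sigma> p = p}) * (W v * \<beta> z)" by simp
  finally have eq: "wedge p 1 W (\<lambda>v. \<beta> (v 0)) u =
      of_nat (card {\<sigma> \<in> ?S. \<sigma> p = p}) * (W v * \<beta> z) / (fact p * fact 1)" .
  have "id \<in> {\<sigma> \<in> ?S. \<sigma> p = p}" by (simp add: permutes_id)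
  then have "card {\<sigma> \<in> ?S. \<sigma> p = p} \<noteq> 0"
    using finite_permutations[of "{..<p + 1}"] by (subst card_0_eq) (auto intro!: exI[of _ id] permutes_id)
  with eq assms(4,5) show ?thesis by (simp add: u_def)
qed


section \<open>Symplectic families\<close>

definition partner :: "nat \<Rightarrow> nat" where
  "partner i = (if even i then i + 1 else i - 1)"

definition partner_sign :: "nat \<Rightarrow> 'k::comm_ring_1" where
  "partner_sign i = (if even i then 1 else - 1)"

lemma partner_simps [simp]:
  "partner (partner i) = i" "partner i < 2 * m \<longleftrightarrow> i < 2 * m" "partner i = partner j \<longleftrightarrow> i = j"
  "partner i \<noteq> i" "partner_sign (partner i) = (- partner_sign i :: 'a::comm_ring_1)"
  "partner_sign i * partner_sign i = (1 :: 'a::comm_ring_1)"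
proof -
  show *: "partner (partner i) = i" for i by (auto simp: partner_def elim!: oddE)
  show "partner i = partner j \<longleftrightarrow> i = j" using *[of i] *[of j] by metis
  show "partner i < 2 * m \<longleftrightarrow> i < 2 * m" by (cases "even i") (auto simp: partner_def, presburger+)
  show "partner i \<noteq> i" by (cases "even i") (auto simp: partner_def elim!: oddE)
  show "partner_sign (partner i) = (- partner_sign i :: 'a)"
    by (cases "even i") (auto simp: partner_def partner_sign_def)
  show "partner_sign i * partner_sign i = (1 :: 'a)" by (simp add: partner_sign_def)
qed

locale alternating_bilinear = finite_dimensional_vector_space scale Basis
  for scale :: "'k::field_char_0 \<Rightarrow> 'v::ab_group_add \<Rightarrow> 'v" and Basis +
  fixes b :: "'v \<Rightarrow> 'v \<Rightarrow> 'k"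
  assumes linear_left: "Vector_Spaces.linear scale (*) (\<lambda>x. b x y)"
    and linear_right: "Vector_Spaces.linear scale (*) (b x)"
    and self: "b x x = 0"
begin

lemma antisym: "b x y = - b y x"
proof -
  have "b (x + y) (x + y) = (b x x + b x y) + (b y x + b y y)"
    by (simp only: functional_simps(1)[OF linear_left] functional_simps(1)[OF linear_right] add_ac)
  then show ?thesis by (simp add: self eq_neg_iff_add_eq_0)
qed

text \<open>The pairs are \<open>(v 0, v 1), (v 2, v 3), \<dots>\<close>.\<close>

definition symplectic :: "nat \<Rightarrow> (nat \<Rightarrow> 'v) \<Rightarrow> bool" where
  "symplectic m v \<longleftrightarrow> (\<forall>i<2 * m. \<forall>j<2 * m.
     b (v i) (v j) = (if j = partner i then partner_sign i else 0))"

lemma symplectic_coordinate: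
  assumes "symplectic m v" "j < 2 * m"
  shows "b (\<Sum>i<2 * m. scale (c i) (v i)) (v j) = - c (partner j) * partner_sign j"
proof -
  have "b (\<Sum>i<2 * m. scale (c i) (v i)) (v j) = (\<Sum>i<2 * m. c i * b (v i) (v j))"
    by (simp add: functional_simps(2,6)[OF linear_left])
  also have "\<dots> = (\<Sum>i<2 * m. if i = partner j then - c (partner j) * partner_sign j else 0)"
    using assms by (intro sum.cong) (auto simp: symplectic_def)
  finally show ?thesis using assms(2) by simp
qed

lemma symplectic_inj: "symplectic m v \<Longrightarrow> inj_on v {..<2 * m}"
proof (rule inj_onI)
  fix i j assume v: "symplectic m v" and ij: "i \<in> {..<2 * m}" "j \<in> {..<2 * m}" "v i = v j"
  have "b (v i) (v (partner i)) = partner_sign i"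
    using v ij(1,2) unfolding symplectic_def by simp
  moreover have "b (v j) (v (partner i)) = (if i = j then partner_sign j else 0)"
    using v ij(1,2) unfolding symplectic_def by simp
  ultimately show "i = j" using ij(3) by (auto simp: partner_sign_def split: if_splits)
qed

lemma symplectic_independent:
  assumes "symplectic m v"
  shows "independent (v ` {..<2 * m})"
proof (rule independent_if_scalars_zero)
  fix f x assume 0: "(\<Sum>x\<in>v ` {..<2 * m}. scale (f x) x) = 0" and "x \<in> v ` {..<2 * m}"
  then obtain j where j: "j < 2 * m" "x = v j" by auto
  have "(\<Sum>i<2 * m. scale (f (v i)) (v i)) = 0"
    using 0 by (simp add: sum.reindex[OF symplectic_inj[OF assms]])
  then have "0 = - f (v j) * partner_sign (partner j)"
    using symplectic_coordinate[OF assms, of "partner j" "\<lambda>i. f (v i)"] j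
      functional_simps(3)[OF linear_left] by simp
  then show "f x = 0" using j by (auto simp: partner_sign_def split: if_splits)
qed simp

lemma symplectic_bound: "symplectic m v \<Longrightarrow> 2 * m \<le> dim UNIV"
  using independent_card_le_dim[OF subset_UNIV symplectic_independent]
  by (simp add: card_image symplectic_inj del: dim_UNIV)

lemma symplectic_extend:
  assumes v: "symplectic m v" and x: "\<And>i. i < 2 * m \<Longrightarrow> b x (v i) = 0"
    and y: "\<And>i. i < 2 * m \<Longrightarrow> b y (v i) = 0" and xy: "b x y = 1"
  shows "symplectic (Suc m) (v(2 * m := x, Suc (2 * m) := y))"
  unfolding symplectic_def
proof (intro allI impI)
  have p: "partner (2 * m) = Suc (2 * m)" "partner (Suc (2 * m)) = 2 * m"
    "partner i = 2 * m \<longleftrightarrow> i = Suc (2 * m)" "partner i = Suc (2 * m) \<longleftrightarrow> i = 2 * m"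
    "2 * m = partner i \<longleftrightarrow> i = Suc (2 * m)" "Suc (2 * m) = partner i \<longleftrightarrow> i = 2 * m" for i
    using partner_simps(3)[of i "Suc (2 * m)"] partner_simps(3)[of i "2 * m"]
    by (auto simp: partner_def)
  have x': "b (v i) x = 0" and y': "b (v i) y = 0" if "i < 2 * m" for i
    using x[OF that] y[OF that] antisym[of "v i"] by auto
  have yx: "b y x = - 1" using xy antisym[of y x] by simp
  fix i j assume "i < 2 * Suc m" "j < 2 * Suc m"
  then have "i < 2 * m \<or> i = 2 * m \<or> i = Suc (2 * m)" "j < 2 * m \<or> j = 2 * m \<or> j = Suc (2 * m)"
    by (auto simp: less_Suc_eq)
  then show "b ((v(2 * m := x, Suc (2 * m) := y)) i) ((v(2 * m := x, Suc (2 * m) := y)) j) =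
      (if j = partner i then partner_sign i else 0)"
    by (elim disjE) (insert v x y x' y' xy yx self p, auto simp: symplectic_def partner_sign_def)
qed

definition radical :: "'v set" where
  "radical = {x. \<forall>y. b x y = 0}"

text \<open>For m maximal, the orthogonal complement C of the family is isotropic, since otherwise
  it would contain a further pair. As C is also complementary to the span of the family, it
  coincides with the radical.\<close>

lemma exists_symplectic:
  obtains m v where "symplectic m v" "dim (UNIV :: 'v set) = 2 * m + dim radical"
proof -
  have ex: "\<exists>m. \<exists>v. symplectic m v" by (intro exI[of _ 0]) (simp add: symplectic_def)
  have bd: "m \<le> dim (UNIV :: 'v set)" if "\<exists>v. symplectic m v" for m
    using symplectic_bound that by fastforce
  obtain m where "\<exists>v. symplectic m v" and max: "\<And>m'. \<exists>v. symplectic m' v \<Longrightarrow> m' \<le> m"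
    using GreatestI_ex_nat[OF ex bd] Greatest_le_nat[of "\<lambda>m. \<exists>v. symplectic m v", OF _ bd] by blast
  then obtain v where v: "symplectic m v" by blast
  define C where "C = {x. \<forall>i<2 * m. b x (v i) = 0}"
  have bC: "b x y = 0" if "x \<in> C" "y \<in> C" for x y
  proof (rule ccontr)
    assume nz: "b x y \<noteq> 0"
    have "symplectic (Suc m) (v(2 * m := x, Suc (2 * m) := scale (inverse (b x y)) y))"
      using that nz functional_simps(2)[OF linear_left] functional_simps(2)[OF linear_right]
      by (intro symplectic_extend[OF v]) (auto simp: C_def)
    then show False using max[of "Suc m"] by auto
  qed
  have decomp: "\<exists>c. w - (\<Sum>i<2 * m. scale (c i) (v i)) \<in> C" for w
  proof (intro exI)
    \<comment> \<open>Symplectic projection: up to sign, the coefficient of \<open>v i\<close> is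
      the pairing of w with the partner of \<open>v i\<close>.\<close>
    show "w - (\<Sum>i<2 * m. scale (b w (v (partner i)) * partner_sign i) (v i)) \<in> C"
      using symplectic_coordinate[OF v, of _ "\<lambda>i. b w (v (partner i)) * partner_sign i"]
      by (simp add: C_def functional_simps(5)[OF linear_left] mult.assoc)
  qed
  have C: "C = radical"
  proof
    show "radical \<subseteq> C" by (auto simp: radical_def C_def)
    show "C \<subseteq> radical"
    proof
      fix x assume x: "x \<in> C"
      have "b x w = 0" for w
      proof -
        obtain c where c: "w - (\<Sum>i<2 * m. scale (c i) (v i)) \<in> C" using decomp by blast
        have "b x (\<Sum>i<2 * m. scale (c i) (v i)) = 0"
          using x by (simp add: functional_simps(2,6)[OF linear_right] C_def)
        with bC[OF x c] show ?thesis by (simp add: functional_simps(5)[OF linear_right])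
      qed
      then show "x \<in> radical" by (simp add: radical_def)
    qed
  qed
  have "subspace C"
    unfolding subspace_def C_def using functional_simps(1-3)[OF linear_left] by auto
  let ?S = "span (v ` {..<2 * m})"
  have "dim {x + y | x y. x \<in> ?S \<and> y \<in> C} + dim (?S \<inter> C) = dim ?S + dim C"
    by (rule dim_sums_Int) (use \<open>subspace C\<close> in auto)
  moreover have "{x + y | x y. x \<in> ?S \<and> y \<in> C} = UNIV"
  proof -
    have "\<exists>x y. w = x + y \<and> x \<in> ?S \<and> y \<in> C" for w
    proof -
      obtain c where c: "w - (\<Sum>i<2 * m. scale (c i) (v i)) \<in> C" using decomp by blast
      have "(\<Sum>i<2 * m. scale (c i) (v i)) \<in> ?S" by (intro span_sum span_scale span_base) auto
      with c show ?thesis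
        by (intro exI[of _ "\<Sum>i<2 * m. scale (c i) (v i)"] exI[of _ "w - (\<Sum>i<2 * m. scale (c i) (v i))"])
          auto
    qed
    then show ?thesis by auto
  qed
  moreover have "?S \<inter> C = {0}"
  proof -
    have "x = 0" if x: "x \<in> ?S" "x \<in> C" for x
    proof -
      obtain u where "x = (\<Sum>y\<in>v ` {..<2 * m}. scale (u y) y)"
        using x(1) by (auto simp: span_finite)
      then have u: "x = (\<Sum>i<2 * m. scale (u (v i)) (v i))"
        by (simp add: sum.reindex[OF symplectic_inj[OF v]])
      have "u (v j) = 0" if j: "j < 2 * m" for j
      proof -
        have "b x (v (partner j)) = 0" using x(2) j by (simp add: C_def)
        then show ?thesis
          using symplectic_coordinate[OF v, of "partner j" "\<lambda>i. u (v i)"] j u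
          by (auto simp: partner_sign_def split: if_splits)
      qed
      then show ?thesis by (subst u) simp
    qed
    moreover have "0 \<in> ?S \<inter> C" using \<open>subspace C\<close> by (auto simp: subspace_0 span_zero)
    ultimately show ?thesis by blast
  qed
  moreover have "dim ?S = 2 * m"
    using dim_span_eq_card_independent[OF symplectic_independent[OF v]]
    by (simp add: card_image symplectic_inj[OF v])
  ultimately have "dim (UNIV :: 'v set) = 2 * m + dim radical"
    by (simp add: C del: dim_UNIV)
  with v that show ?thesis by blast
qed

text \<open>A summand of the wedge power with first two indices \<open>\<sigma> 0, \<sigma> 1\<close> vanishes unless these are
  partners. In that case moving this pair to the front by the double transposition \<open>\<kappa>\<close> leaves a
  symplectic family.\<close>

lemma symplectic_summand:
  fixes m :: nat
  defines "N \<equiv> 2 + m * 2"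
  assumes v: "symplectic (Suc m) v" and \<sigma>: "\<sigma> permutes {..<N}"
    and W: "antisymmetric (m * 2) W" "\<And>u. symplectic m u \<Longrightarrow> W u = a"
  shows "of_int (sign \<sigma>) * b (v (\<sigma> 0)) (v (\<sigma> 1)) * W (\<lambda>i. v (\<sigma> (2 + i))) =
    (if \<sigma> 1 = partner (\<sigma> 0) then a else 0)"
proof (cases "\<sigma> 1 = partner (\<sigma> 0)")
  case False
  have "\<sigma> 0 < N" "\<sigma> 1 < N" using permutes_in_image[OF \<sigma>] by (auto simp: N_def)
  then have "b (v (\<sigma> 0)) (v (\<sigma> 1)) = 0"
    using v False by (simp add: symplectic_def N_def mult.commute)
  with False show ?thesis by simp
next
  case True
  have N: "\<sigma> 0 < N" "\<sigma> 1 < N" using permutes_in_image[OF \<sigma>] by (auto simp: N_def)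
  define e where "e = (if even (\<sigma> 0) then \<sigma> 0 else \<sigma> 1)"
  have e: "even e" "e < N" using True N by (auto simp: e_def partner_def)
  then have e1: "Suc e < N" unfolding N_def by presburger
  \<comment> \<open>The pair \<sigma> 0, \<sigma> 1 consists of e and e + 1 with e even. Exchanging
    it with 0, 1 in this order preserves parity and partners and is an even permutation.\<close>
  define \<kappa> where "\<kappa> = transpose 0 e \<circ> transpose 1 (Suc e)"
  have \<kappa>_apply: "\<kappa> i = (if i = e then 0 else if i = Suc e then 1
      else if i = 0 then e else if i = 1 then Suc e else i)" for i
    using e(1) by (auto simp: \<kappa>_def transpose_def)
  have \<kappa>\<kappa>: "\<kappa> (\<kappa> i) = i" for i using e(1) by (auto simp: \<kappa>_apply)
  have \<kappa>_partner: "\<kappa> (partner i) = partner (\<kappa> i)" for i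
    using e(1) unfolding \<kappa>_apply partner_def by (auto elim!: oddE evenE; presburger)
  have \<kappa>_even: "even (\<kappa> i) \<longleftrightarrow> even i" for i
    using e(1) by (auto simp: \<kappa>_apply)
  have \<kappa>_perm: "\<kappa> permutes {..<N}"
    unfolding \<kappa>_def using e e1 by (intro permutes_compose permutes_swap_id) auto
  have \<kappa>_sign: "sign \<kappa> = 1"
    unfolding \<kappa>_def by (cases "e = 0") (auto simp: sign_compose permutation_swap_id sign_swap_id)
  define u where "u i = v (\<kappa> (2 + i))" for i
  have u: "symplectic m u"
    unfolding symplectic_def
  proof (intro allI impI)
    fix i j assume ij: "i < 2 * m" "j < 2 * m"
    have lt: "\<kappa> (2 + i) < 2 * Suc m" "\<kappa> (2 + j) < 2 * Suc m"
      using ij permutes_in_image[OF \<kappa>_perm, of "2 + i"] permutes_in_image[OF \<kappa>_perm, of "2 + j"]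
      by (auto simp: N_def)
    have "\<kappa> (2 + j) = partner (\<kappa> (2 + i)) \<longleftrightarrow> 2 + j = partner (2 + i)"
      by (metis \<kappa>_partner \<kappa>\<kappa>)
    also have "\<dots> \<longleftrightarrow> j = partner i" by (auto simp: partner_def)
    finally show "b (u i) (u j) = (if j = partner i then partner_sign i else 0)"
      using v lt \<kappa>_even[of "2 + i"] by (simp add: symplectic_def u_def partner_sign_def)
  qed
  \<comment> \<open>If \<sigma> lists the pair with the odd index first, one more transposition
    restores the order; its sign is compensated by \<open>partner_sign\<close>.\<close>
  define \<tau> where "\<tau> = (if even (\<sigma> 0) then \<kappa> \<circ> \<sigma> else \<kappa> \<circ> \<sigma> \<circ> transpose 0 1)"
  have \<tau>_perm: "\<tau> permutes {2..<2 + m * 2}"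
  proof (rule permutes_superset)
    show "\<tau> permutes {..<N}"
      unfolding \<tau>_def using \<kappa>_perm \<sigma>
      by (auto intro!: permutes_compose permutes_swap_id simp: N_def)
    have "\<tau> 0 = 0" "\<tau> 1 = 1"
      using True by (cases "even (\<sigma> 0)"; auto simp: \<tau>_def \<kappa>_apply e_def partner_def elim!: oddE)+
    then show "\<tau> x = x" if "x \<in> {..<N} - {2..<2 + m * 2}" for x
      using that by (cases "x = 0") (auto simp: N_def less_2_cases_iff not_le)
  qed
  have "v (\<sigma> (2 + i)) = v (\<kappa> (\<tau> (2 + i)))" for i
    by (simp add: \<tau>_def \<kappa>\<kappa> transpose_def)
  then have "W (\<lambda>i. v (\<sigma> (2 + i))) = of_int (sign \<tau>) * a"
    using antisymmetric_permute[OF W(1) \<tau>_perm, of "\<lambda>i. v (\<kappa> i)"] W(2)[OF u]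
    by (simp add: u_def[abs_def])
  moreover have "b (v (\<sigma> 0)) (v (\<sigma> 1)) = partner_sign (\<sigma> 0)"
    using v N True by (simp add: symplectic_def N_def mult.commute)
  moreover have "permutation \<sigma>" "permutation \<kappa>"
    using \<sigma> \<kappa>_perm permutation_permutes by (metis finite_lessThan)+
  then have "sign \<tau> = (if even (\<sigma> 0) then sign \<sigma> else - sign \<sigma>)"
    by (simp add: \<tau>_def sign_compose \<kappa>_sign permutation_compose permutation_swap_id sign_swap_id)
  moreover have "(of_int (sign \<sigma>) :: 'k) * of_int (sign \<sigma>) = 1"
    by (metis of_int_1 of_int_mult sign_idempotent)
  ultimately show ?thesis
    using True by (simp add: partner_sign_def mult.assoc[symmetric])
qed

text \<open>By \<open>symplectic_summand\<close>, every surviving permutation contributes the value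
  of the lower power, which is the same for all symplectic families. That the identity survives is
  enough for a nonzero count.\<close>

lemma wedge_power_symplectic:
  "\<exists>a. a \<noteq> 0 \<and> (\<forall>v. symplectic m v \<longrightarrow> wedge_power 2 (\<lambda>v. b (v 0) (v 1)) m v = a)"
proof (induction m)
  case 0
  show ?case by (rule exI[of _ 1]) simp
next
  case (Suc m)
  let ?W = "wedge_power 2 (\<lambda>v. b (v 0) (v 1)) m"
  obtain a where a: "a \<noteq> 0" "\<And>v. symplectic m v \<Longrightarrow> ?W v = a" using Suc by blast
  let ?P = "{\<sigma>. \<sigma> permutes {..<2 + m * 2}}"
  let ?Q = "{\<sigma> \<in> ?P. \<sigma> 1 = partner (\<sigma> 0)}"
  have finP: "finite ?P" by (simp add: finite_permutations)
  have "id \<in> ?Q" by (simp add: permutes_id partner_def)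
  then have "card ?Q \<noteq> 0" using finP by (metis (no_types, lifting) card_0_eq emptyE finite_subset
        mem_Collect_eq subsetI)
  moreover have "wedge_power 2 (\<lambda>v. b (v 0) (v 1)) (Suc m) v =
      of_nat (card ?Q) * a / (fact 2 * fact (m * 2))" if v: "symplectic (Suc m) v" for v
  proof -
    have "wedge_power 2 (\<lambda>v. b (v 0) (v 1)) (Suc m) v =
        (\<Sum>\<sigma>\<in>?P. if \<sigma> 1 = partner (\<sigma> 0) then a else 0) / (fact 2 * fact (m * 2))"
      unfolding wedge_power.simps wedge_def
      by (intro arg_cong2[of _ _ _ _ "(/)"] sum.cong refl symplectic_summand[OF v _
          antisymmetric_wedge_power a(2)]) auto
    also have "(\<Sum>\<sigma>\<in>?P. if \<sigma> 1 = partner (\<sigma> 0) then a else 0) = (\<Sum>\<sigma>\<in>?Q. a)"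
      by (rule sum.inter_filter[symmetric]) (rule finP)
    finally show ?thesis by simp
  qed
  ultimately show ?case using a(1)
    by (intro exI[of _ "of_nat (card ?Q) * a / (fact 2 * fact (m * 2))"]) (simp del: wedge_power.simps)
qed

end


section \<open>Contact Lie algebras\<close>

text \<open>For fixed vectors, the wedge is a polynomial in values of its factors. This makes the
  non-vanishing of (d\<alpha>)^n and of its wedge with \<alpha> an open condition on
  \<alpha>.\<close>

lemma gen_algebra_wedge:
  assumes "\<And>v. (\<lambda>\<alpha>. \<omega> \<alpha> v) \<in> gen_algebra S" "\<And>v. (\<lambda>\<alpha>. \<eta> \<alpha> v) \<in> gen_algebra S"
  shows "(\<lambda>\<alpha>. wedge p q (\<omega> \<alpha>) (\<eta> \<alpha>) v) \<in> gen_algebra S"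
  unfolding wedge_def divide_inverse
  by (intro gen_algebra.mult gen_algebra_sum gen_algebra.const assms)

lemma gen_algebra_wedge_power:
  assumes "\<And>v. (\<lambda>\<alpha>. \<omega> \<alpha> v) \<in> gen_algebra S"
  shows "(\<lambda>\<alpha>. wedge_power p (\<omega> \<alpha>) n v) \<in> gen_algebra S"
  by (induction n arbitrary: v) (simp_all add: gen_algebra.const gen_algebra_wedge assms)

context alternating_bilinear
begin

lemma multilinear_form_bilinear: "multilinear_form 2 (\<lambda>v. b (v 0) (v 1))"
  unfolding multilinear_form_def
proof (intro conjI allI impI)
  fix v :: "nat \<Rightarrow> 'v" and j :: nat assume "j < 2"
  then consider "j = 0" | "j = 1" by linarith
  then show "Vector_Spaces.linear scale (*) (\<lambda>x. b ((v(j := x)) 0) ((v(j := x)) 1))"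
    by cases (simp_all add: linear_left linear_right)
qed auto

lemma killed_by_bilinear:
  assumes "x \<in> radical"
  shows "killed_by 2 (\<lambda>v. b (v 0) (v 1)) x"
  unfolding killed_by_def using assms antisym[of _ x]
  by (auto simp: radical_def less_2_cases_iff)

end

section \<open>Zariski topology of the dual and stabilizers\<close>

context lie_algebra
begin

abbreviation coordinate_ring :: "(('q \<Rightarrow> 'k) \<Rightarrow> 'k) set" where
  "coordinate_ring \<equiv> gen_algebra (range (\<lambda>\<xi> \<alpha>. \<alpha> \<xi>))"

lemma principal_open:
  assumes "f \<in> coordinate_ring"
  shows "open_in_dual {\<alpha> \<in> dual. f \<alpha> \<noteq> 0}"
  unfolding open_in_dual_def zariski_open_def zariski_closed_def
  using assms by (intro conjI exI[of _ "{f}"]) auto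

lemma open_contains_principal:
  assumes "open_in_dual U" "\<beta> \<in> U"
  obtains f where "f \<in> coordinate_ring" "f \<beta> \<noteq> 0" "\<And>\<alpha>. \<alpha> \<in> dual \<Longrightarrow> f \<alpha> \<noteq> 0 \<Longrightarrow> \<alpha> \<in> U"
proof -
  obtain S where S: "S \<subseteq> coordinate_ring" "dual - U = {x \<in> dual. \<forall>f\<in>S. f x = 0}" "U \<subseteq> dual"
    using assms(1) unfolding open_in_dual_def zariski_open_def zariski_closed_def by blast
  then have "\<beta> \<in> dual" "\<beta> \<notin> {x \<in> dual. \<forall>f\<in>S. f x = 0}" using assms(2) by auto
  then obtain f where f: "f \<in> S" "f \<beta> \<noteq> 0" by blast
  show ?thesis by (rule that[of f]) (use S f in auto)
qed

lemma dual_line: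
  assumes "\<beta> \<in> dual" "\<gamma> \<in> dual"
  shows "(\<lambda>\<xi>. \<beta> \<xi> + t * (\<gamma> \<xi> - \<beta> \<xi>)) \<in> dual"
  using assms unfolding dual_def linear_functional_iff by (simp add: algebra_simps)

lemma coordinate_ring_line:
  assumes "f \<in> coordinate_ring"
  shows "\<exists>p. \<forall>t. f (\<lambda>\<xi>. \<beta> \<xi> + t * (\<gamma> \<xi> - \<beta> \<xi>)) = poly p t"
  using assms
proof induction
  case (const c)
  show ?case by (rule exI[of _ "[:c:]"]) simp
next
  case (gen f)
  then obtain \<xi> where "f = (\<lambda>\<alpha>. \<alpha> \<xi>)" by blast
  then show ?case by (intro exI[of _ "[:\<beta> \<xi>, \<gamma> \<xi> - \<beta> \<xi>:]"]) simp
next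
  case (add f g)
  then obtain p q where "\<forall>t. f (\<lambda>\<xi>. \<beta> \<xi> + t * (\<gamma> \<xi> - \<beta> \<xi>)) = poly p t"
    "\<forall>t. g (\<lambda>\<xi>. \<beta> \<xi> + t * (\<gamma> \<xi> - \<beta> \<xi>)) = poly q t" by blast
  then show ?case by (intro exI[of _ "p + q"]) simp
next
  case (mult f g)
  then obtain p q where "\<forall>t. f (\<lambda>\<xi>. \<beta> \<xi> + t * (\<gamma> \<xi> - \<beta> \<xi>)) = poly p t"
    "\<forall>t. g (\<lambda>\<xi>. \<beta> \<xi> + t * (\<gamma> \<xi> - \<beta> \<xi>)) = poly q t" by blast
  then show ?case by (intro exI[of _ "p * q"]) simp
qed

text \<open>On the line joining \<beta> and \<gamma>, both functions become nonzero polynomials in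
  one variable, and over an infinite field their product has a nonroot.\<close>

lemma dual_irreducible:
  assumes f: "f \<in> coordinate_ring" "\<beta> \<in> dual" "f \<beta> \<noteq> 0"
    and g: "g \<in> coordinate_ring" "\<gamma> \<in> dual" "g \<gamma> \<noteq> 0"
  obtains \<delta> where "\<delta> \<in> dual" "f \<delta> \<noteq> 0" "g \<delta> \<noteq> 0"
proof -
  define l where "l t = (\<lambda>\<xi>. \<beta> \<xi> + t * (\<gamma> \<xi> - \<beta> \<xi>))" for t
  obtain p q where pq: "\<And>t. f (l t) = poly p t" "\<And>t. g (l t) = poly q t"
    using coordinate_ring_line[OF f(1), of \<beta> \<gamma>] coordinate_ring_line[OF g(1), of \<beta> \<gamma>]
    unfolding l_def by blast
  have "l 0 = \<beta>" "l 1 = \<gamma>" by (simp_all add: l_def)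
  with f g pq have "poly p 0 \<noteq> 0" "poly q 1 \<noteq> 0" by metis+
  then have "p * q \<noteq> 0" by auto
  then obtain t where "poly (p * q) t \<noteq> 0" by (rule infinite_nonroot)
  then show ?thesis using dual_line[OF f(2) g(2)] pq by (intro that[of "l t"]) (auto simp: l_def)
qed

lemma ce_differential_eq: "ce_differential \<alpha> = (\<lambda>v. - \<alpha> (bracket (v 0) (v 1)))"
  by (simp add: fun_eq_iff ce_differential_def)

lemma ce_differential_power_coordinate:
  "(\<lambda>\<alpha>. wedge_power 2 (ce_differential \<alpha>) n v) \<in> coordinate_ring"
proof (rule gen_algebra_wedge_power)
  fix v :: "nat \<Rightarrow> 'q"
  have "(\<lambda>\<alpha>. (\<lambda>_. - 1) \<alpha> * (\<lambda>\<alpha>. \<alpha> (bracket (v 0) (v 1))) \<alpha>) \<in> coordinate_ring"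
    by (intro gen_algebra.mult gen_algebra.const gen_algebra.gen) auto
  then show "(\<lambda>\<alpha>. ce_differential \<alpha> v) \<in> coordinate_ring"
    by (simp add: ce_differential_def)
qed

lemma alternating_bilinear_ce:
  assumes "finite_dimensional_vector_space scale B" "\<alpha> \<in> dual"
  shows "alternating_bilinear scale B (\<lambda>x y. - \<alpha> (bracket x y))"
proof -
  interpret fd: finite_dimensional_vector_space scale B by fact
  show ?thesis
    by unfold_locales
      (use assms(2) bracket_self in \<open>auto simp: linear_functional_iff dual_def bracket_simps
        functional_simps(3) algebra_simps\<close>)
qed

lemma radical_eq_stabilizer:
  assumes "finite_dimensional_vector_space scale B" "\<alpha> \<in> dual"
  shows "alternating_bilinear.radical (\<lambda>x y. - \<alpha> (bracket x y)) = stabilizer \<alpha>"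
proof -
  interpret alternating_bilinear scale B "\<lambda>x y. - \<alpha> (bracket x y)"
    by (rule alternating_bilinear_ce[OF assms])
  show ?thesis by (simp add: radical_def stabilizer_def)
qed

text \<open>By antisymmetry of the bracket, the stabilizer is the common kernel of the subspace
  \<open>range (\<lambda>\<xi>. ad_star \<xi> \<alpha>)\<close>, and in finite dimension a
  functional lies in a subspace of the dual once it vanishes on its common kernel.\<close>

lemma not_ad_star_iff:
  assumes fin: "finite B" "span B = UNIV" and \<alpha>: "\<alpha> \<in> dual"
  shows "\<alpha> \<notin> range (\<lambda>\<xi>. ad_star \<xi> \<alpha>) \<longleftrightarrow> (\<exists>z\<in>stabilizer \<alpha>. \<alpha> z \<noteq> 0)"
proof -
  have lin: "Vector_Spaces.linear scale (*) \<alpha>" using \<alpha> by (simp add: dual_def)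
  note simps = functional_simps[OF lin] bracket_simps
  have antisym: "\<alpha> (bracket x y) = - \<alpha> (bracket y x)" for x y
  proof -
    have "\<alpha> (bracket (x + y) (x + y)) = \<alpha> (bracket x x) + \<alpha> (bracket x y) + (\<alpha> (bracket y x) + \<alpha> (bracket y y))"
      by (simp only: bracket_simps(1,2) functional_simps(1)[OF lin] add_ac)
    then show ?thesis by (simp add: bracket_self simps eq_neg_iff_add_eq_0)
  qed
  have "\<alpha> \<in> range (\<lambda>\<xi>. ad_star \<xi> \<alpha>)" if ker: "\<And>z. z \<in> stabilizer \<alpha> \<Longrightarrow> \<alpha> z = 0"
  proof (rule functional_mem_of_kernel[OF fin _ _ _ _ lin])
    show "Vector_Spaces.linear scale (*) e" if "e \<in> range (\<lambda>\<xi>. ad_star \<xi> \<alpha>)" for e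
      using that by (auto simp: linear_functional_iff ad_star_def simps)
    show "(\<lambda>_. 0) \<in> range (\<lambda>\<xi>. ad_star \<xi> \<alpha>)"
      by (rule image_eqI[of _ _ 0]) (auto simp: ad_star_def simps)
    show "(\<lambda>x. e x + e' x) \<in> range (\<lambda>\<xi>. ad_star \<xi> \<alpha>)"
      if e: "e \<in> range (\<lambda>\<xi>. ad_star \<xi> \<alpha>)" "e' \<in> range (\<lambda>\<xi>. ad_star \<xi> \<alpha>)" for e e'
    proof -
      obtain x y where "e = ad_star x \<alpha>" "e' = ad_star y \<alpha>" using e by blast
      then show ?thesis by (intro image_eqI[of _ _ "x + y"]) (auto simp: ad_star_def simps)
    qed
    show "(\<lambda>x. c * e x) \<in> range (\<lambda>\<xi>. ad_star \<xi> \<alpha>)"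
      if e: "e \<in> range (\<lambda>\<xi>. ad_star \<xi> \<alpha>)" for c e
    proof -
      obtain x where "e = ad_star x \<alpha>" using e by blast
      then show ?thesis by (intro image_eqI[of _ _ "scale c x"]) (auto simp: ad_star_def simps)
    qed
    show "\<alpha> z = 0" if z: "\<And>e. e \<in> range (\<lambda>\<xi>. ad_star \<xi> \<alpha>) \<Longrightarrow> e z = 0" for z
    proof (rule ker)
      have "ad_star \<xi> \<alpha> z = 0" for \<xi> by (rule z) blast
      then show "z \<in> stabilizer \<alpha>" using antisym[of z] by (simp add: stabilizer_def ad_star_def)
    qed
  qed
  moreover have "\<alpha> z = 0" if "\<alpha> = ad_star \<xi> \<alpha>" "z \<in> stabilizer \<alpha>" for z \<xi>
    using that(2) fun_cong[OF that(1), of z] antisym[of \<xi> z] by (simp add: stabilizer_def ad_star_def)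
  ultimately show ?thesis by blast
qed

end

section \<open>The contact criterion in index one\<close>

context fin_dim_lie_algebra
begin

lemma finite_basis: obtains B where "finite_dimensional_vector_space scale B"
proof -
  obtain B\<^sub>0 where B0: "finite B\<^sub>0" "span B\<^sub>0 = UNIV" using finite_dimensional by blast
  obtain B where B: "independent B" "UNIV \<subseteq> span B" using basis_exists[of UNIV] by metis
  have "finite B" using independent_span_bound[OF B0(1) B(1)] B0(2) by auto
  then have "finite_dimensional_vector_space scale B" using B by unfold_locales auto
  then show ?thesis by (rule that)
qed

text \<open>The index enters twice. Some \<gamma> has a one-dimensional stabilizer, which makes the
  dimension 2n + 1 and (d\<gamma>)^n nonzero; and no stabilizer is zero, which provides a vector
  killed by (d\<alpha>)^n on which \<alpha> can be tested.\<close>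

lemma contact_iff_generic:
  assumes index: "index = 1"
  shows "contact \<longleftrightarrow> generic_point (\<lambda>\<alpha>. \<alpha> \<notin> range (\<lambda>\<xi>. ad_star \<xi> \<alpha>))"
proof -
  obtain B where fd: "finite_dimensional_vector_space scale B" by (rule finite_basis)
  interpret fd: finite_dimensional_vector_space scale B by fact
  have fin: "finite B" "span B = UNIV" by (auto simp: fd.finite_Basis fd.span_Basis)
  have "(\<lambda>_. 0) \<in> dual" by (simp add: dual_def linear_functional_iff)
  then have ne: "(\<lambda>\<gamma>. dim (stabilizer \<gamma>)) ` dual \<noteq> {}" by blast
  have "index \<in> (\<lambda>\<gamma>. dim (stabilizer \<gamma>)) ` dual"
    unfolding index_def by (rule Inf_nat_def1[OF ne])
  then obtain \<gamma> where "\<gamma> \<in> dual" "1 = dim (stabilizer \<gamma>)"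
    unfolding index by (rule imageE)
  then have \<gamma>: "\<gamma> \<in> dual" "dim (stabilizer \<gamma>) = 1" by auto
  have dim_ge: "dim (stabilizer \<alpha>) \<ge> 1" if "\<alpha> \<in> dual" for \<alpha>
  proof -
    have "index \<le> dim (stabilizer \<alpha>)"
      unfolding index_def by (rule cInf_lower) (use that in auto)
    then show ?thesis using index by simp
  qed
  interpret \<gamma>: alternating_bilinear scale B "\<lambda>x y. - \<gamma> (bracket x y)"
    by (rule alternating_bilinear_ce[OF fd \<gamma>(1)])
  obtain n v where v: "\<gamma>.symplectic n v" and "dim UNIV = 2 * n + dim \<gamma>.radical"
    by (rule \<gamma>.exists_symplectic)
  then have dim: "dim UNIV = 2 * n + 1"
    using \<gamma>(2) radical_eq_stabilizer[OF fd \<gamma>(1)] by simp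
  have \<gamma>v: "wedge_power 2 (ce_differential \<gamma>) n v \<noteq> 0"
  proof -
    obtain a where "a \<noteq> 0" and a: "\<And>v. \<gamma>.symplectic n v \<Longrightarrow>
        wedge_power 2 (\<lambda>v. - \<gamma> (bracket (v 0) (v 1))) n v = a"
      using \<gamma>.wedge_power_symplectic[of n] by blast
    then show ?thesis unfolding ce_differential_eq a[OF v] by simp
  qed
  let ?W = "\<lambda>\<alpha>. wedge_power 2 (ce_differential \<alpha>) n"
  let ?\<Omega> = "\<lambda>\<alpha>. wedge (2 * n) 1 (?W \<alpha>) (\<lambda>v. \<alpha> (v 0))"
  have contact: "contact \<longleftrightarrow> (\<exists>\<alpha>\<in>dual. ?\<Omega> \<alpha> \<noteq> (\<lambda>_. 0))"
  proof -
    have "2 * n + 1 = 2 * n' + 1 \<longleftrightarrow> n' = n" for n' :: nat by auto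
    then show ?thesis unfolding contact_def dim by (simp only: simp_thms)
  qed
  have W_forms: "multilinear_form (2 * n) (?W \<alpha>)" "antisymmetric (2 * n) (?W \<alpha>)"
    "\<And>x. x \<in> stabilizer \<alpha> \<Longrightarrow> killed_by (2 * n) (?W \<alpha>) x" if \<alpha>: "\<alpha> \<in> dual" for \<alpha>
  proof -
    interpret \<alpha>: alternating_bilinear scale B "\<lambda>x y. - \<alpha> (bracket x y)"
      by (rule alternating_bilinear_ce[OF fd \<alpha>])
    show "multilinear_form (2 * n) (?W \<alpha>)"
      using multilinear_form_wedge_power[OF vector_space_axioms \<alpha>.multilinear_form_bilinear, of n]
      by (simp add: ce_differential_eq mult.commute)
    show "antisymmetric (2 * n) (?W \<alpha>)"
      using antisymmetric_wedge_power[of n 2] by (simp add: mult.commute)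
    show "killed_by (2 * n) (?W \<alpha>) x" if "x \<in> stabilizer \<alpha>" for x
      using killed_by_wedge_power[OF \<alpha>.killed_by_bilinear, of x n] that
        radical_eq_stabilizer[OF fd \<alpha>]
      by (simp add: ce_differential_eq mult.commute)
  qed
  show ?thesis
  proof
    assume "contact"
    then obtain \<alpha>\<^sub>0 u where \<alpha>0: "\<alpha>\<^sub>0 \<in> dual" "?\<Omega> \<alpha>\<^sub>0 u \<noteq> 0" unfolding contact by blast
    let ?U = "{\<alpha> \<in> dual. ?\<Omega> \<alpha> u \<noteq> 0}"
    have "(\<lambda>\<alpha>. ?\<Omega> \<alpha> u) \<in> coordinate_ring"
      by (intro gen_algebra_wedge ce_differential_power_coordinate gen_algebra.gen) auto
    then have "open_in_dual ?U" by (rule principal_open)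
    moreover have "\<alpha> \<notin> range (\<lambda>\<xi>. ad_star \<xi> \<alpha>)" if \<alpha>: "\<alpha> \<in> dual" "?\<Omega> \<alpha> u \<noteq> 0" for \<alpha>
    proof -
      have "\<not> stabilizer \<alpha> \<subseteq> {0}"
      proof
        assume "stabilizer \<alpha> \<subseteq> {0}"
        then have "dim (stabilizer \<alpha>) = 0" by simp
        with dim_ge[OF \<alpha>(1)] show False by simp
      qed
      then obtain z where z: "z \<in> stabilizer \<alpha>" "z \<noteq> 0" by blast
      have "multilinear_form 1 (\<lambda>v. \<alpha> (v 0))"
        using \<alpha>(1) by (simp add: multilinear_form_def dual_def)
      then have ml: "multilinear_form (2 * n + 1) (?\<Omega> \<alpha>)"
        by (rule multilinear_form_wedge[OF vector_space_axioms W_forms(1)[OF \<alpha>(1)]])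
      \<comment> \<open>Otherwise both factors, and hence the nonzero top form, would be killed by
        z, which forces z = 0.\<close>
      have "\<alpha> z \<noteq> 0"
      proof
        assume "\<alpha> z = 0"
        then have "killed_by 1 (\<lambda>v. \<alpha> (v 0)) z" by (auto simp: killed_by_def)
        then have "killed_by (2 * n + 1) (?\<Omega> \<alpha>) z"
          by (rule killed_by_wedge[OF W_forms(3)[OF \<alpha>(1) z(1)]])
        from top_form_killed_zero[OF fd ml antisymmetric_wedge \<alpha>(2) dim this] z(2)
        show False by simp
      qed
      then show ?thesis using not_ad_star_iff[OF fin \<alpha>(1)] z(1) by blast
    qed
    ultimately show "generic_point (\<lambda>\<alpha>. \<alpha> \<notin> range (\<lambda>\<xi>. ad_star \<xi> \<alpha>))"
      unfolding generic_point_def using \<alpha>0 by (intro exI[of _ ?U]) auto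
  next
    assume "generic_point (\<lambda>\<alpha>. \<alpha> \<notin> range (\<lambda>\<xi>. ad_star \<xi> \<alpha>))"
    then obtain U \<beta> where U: "open_in_dual U" "\<beta> \<in> U"
      "\<And>\<alpha>. \<alpha> \<in> U \<Longrightarrow> \<alpha> \<notin> range (\<lambda>\<xi>. ad_star \<xi> \<alpha>)"
      unfolding generic_point_def by blast
    then have "\<beta> \<in> dual" by (auto simp: open_in_dual_def zariski_open_def)
    obtain f where f: "f \<in> coordinate_ring" "f \<beta> \<noteq> 0"
      "\<And>\<alpha>. \<alpha> \<in> dual \<Longrightarrow> f \<alpha> \<noteq> 0 \<Longrightarrow> \<alpha> \<in> U"
      using open_contains_principal[OF U(1,2)] by metis
    \<comment> \<open>The given open set contains \<beta>, and \<gamma> satisfies the open condition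
      that the n-th power is nonzero on v. Irreducibility of the dual yields one point with both
      properties.\<close>
    obtain \<delta> where \<delta>: "\<delta> \<in> dual" "f \<delta> \<noteq> 0" "?W \<delta> v \<noteq> 0"
      using dual_irreducible[OF f(1) \<open>\<beta> \<in> dual\<close> f(2) ce_differential_power_coordinate \<gamma>(1) \<gamma>v]
      by metis
    then obtain z where z: "z \<in> stabilizer \<delta>" "\<delta> z \<noteq> 0"
      using U(3) f(3) not_ad_star_iff[OF fin \<delta>(1)] by blast
    \<comment> \<open>The symplectic family of \<gamma> fills the slots of (d\<delta>)^n, and z
      takes the remaining slot 2n.\<close>
    have "?\<Omega> \<delta> (v(2 * n := z)) \<noteq> 0"
    proof (rule wedge_kernel_functional_nonzero)
      show "?W \<delta> v = ?W \<delta> w" if "\<And>i. i < 2 * n \<Longrightarrow> v i = w i" for v w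
        using W_forms(1)[OF \<delta>(1)] that unfolding multilinear_form_def by blast
    qed (use W_forms(2,3)[OF \<delta>(1)] z \<delta> in auto)
    then show "contact" unfolding contact using \<delta>(1) by (auto intro!: bexI[of _ \<delta>])
  qed
qed

end

theorem proposition2p1:
  fixes scale :: "'k::field_char_0 \<Rightarrow> 'q::ab_group_add \<Rightarrow> 'q"
    and bracket :: "'q \<Rightarrow> 'q \<Rightarrow> 'q"
  assumes "fin_dim_lie_algebra scale bracket"
    and "lie_algebra.index scale bracket = 1"
  shows "(lie_algebra.contact scale bracket \<longleftrightarrow>
            lie_algebra.generic_point scale
              (\<lambda>\<alpha>. \<alpha> \<notin> range (\<lambda>\<xi>. lie_algebra.ad_star bracket \<xi> \<alpha>))) \<and>
         ((\<forall>p :: 'k poly. degree p > 0 \<longrightarrow> (\<exists>x. poly p x = 0)) \<longrightarrow>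
          (\<forall>(mult :: 'g \<Rightarrow> 'g \<Rightarrow> 'g) one ginv (A :: ('g \<Rightarrow> 'k) set) \<phi>.
             lie_algebra_of_group scale bracket mult one ginv A \<phi> \<and>
             affine_algebraic_group.connected_group A \<longrightarrow>
             (lie_algebra.generic_point scale
                (\<lambda>\<alpha>. \<alpha> \<notin> range (\<lambda>\<xi>. lie_algebra.ad_star bracket \<xi> \<alpha>)) \<longleftrightarrow>
              lie_algebra_of_group.generic_orbit_not_conical scale mult ginv A \<phi>)))"
proof (intro conjI impI allI)
  interpret fin_dim_lie_algebra scale bracket by fact
  show "contact \<longleftrightarrow> generic_point (\<lambda>\<alpha>. \<alpha> \<notin> range (\<lambda>\<xi>. ad_star \<xi> \<alpha>))"
    by (rule contact_iff_generic[OF assms(2)])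
  fix mult :: "'g \<Rightarrow> 'g \<Rightarrow> 'g" and one ginv and A :: "('g \<Rightarrow> 'k) set" and \<phi>
  assume closed: "\<forall>p :: 'k poly. degree p > 0 \<longrightarrow> (\<exists>x. poly p x = 0)"
    and "lie_algebra_of_group scale bracket mult one ginv A \<phi> \<and>
      affine_algebraic_group.connected_group A"
  then interpret G: lie_algebra_of_group scale bracket mult one ginv A \<phi> by blast
  obtain B where fin: "finite B" "span B = UNIV" using finite_dimensional by blast
  show "generic_point (\<lambda>\<alpha>. \<alpha> \<notin> range (\<lambda>\<xi>. ad_star \<xi> \<alpha>)) \<longleftrightarrow> G.generic_orbit_not_conical"
    using G.generic_orbit_not_conical_iff[OF _ fin] closed by blast
qed

end
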